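(* Let $F$ be a differential field with derivation $D$, let $n\geq 1$, and let $V\subseteq F^{2n}$ be a $j$-broad variety. Then there is a differential field extension $K\supseteq F$ such that $V(K)$ contains an $E_j$-point, that is, a point $(\bar z,\bar j)=(z_1,\ldots,z_n,j_1,\ldots,j_n)\in V(K)$ with $(z_i,j_i)\in E_j(K)$ for all $i=1,\ldots,n$. In particular, if $F$ is differentially closed then $V(F)$ contains an $E_j$-point.
   Context: All fields have characteristic $0$. A differential field here is a field with a single derivation $D$. A variety $V\subseteq F^{N}$ means a variety defined over $F$, identified with its set of $F^{\mathrm{alg}}$-points; $V(K)$ is its set of $K$-points for a field $K\supseteq F$. Let $$\Psi(y_0,y_1,y_2,y_3)=\frac{y_3}{y_1}-\frac{3}{2}\left( \frac{y_2}{y_1} \right)^2 + \frac{y_0^2-1968y_0+2654208}{2y_0^2(y_0-1728)^2}\cdot y_1^2 ,$$ so that $\Psi(y,y',y'',y''')=0$ is the differential equation of the modular $j$-function. Below $y',y'',y'''$ are just names of variables/coordinates, not derivatives. In a differential field $(K;+,\cdot,D)$ the $4$-ary relation $E_J(x,y,y',y'')$ is defined by $$\exists y'''\left[\Psi(y,y',y'',y''')=0\wedge Dy=y'Dx\wedge Dy'=y''Dx\wedge Dy''=y'''Dx\right].$$ $E_J(K)\subseteq K^4$ is the set of tuples satisfying it. The binary relation $E_j(x,y)$ is the projection of $E_J$ onto its first two coordinates: $E_j(x,y)$ holds iff there are $y',y''\in K$ with $E_J(x,y,y',y'')$; $E_j(K)\subseteq K^2$ is the set of pairs satisfying it. $j$-broad: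 for $1\leq i_1<\ldots<i_k\leq n$ let $\pi_{\bar i}$ be the projection from $2n$-space to $2k$-space given by $(\bar x,\bar y)\mapsto(x_{i_1},\ldots,x_{i_k},y_{i_1},\ldots,y_{i_k})$. An irreducible algebraic variety $V$ in $2n$-space over an algebraically closed field is $j$-broad if $\dim \pi_{\bar i}(V)\geq k$ for all $1\leq k\leq n$ and all $1\leq i_1<\ldots<i_k\leq n$ (dimension of the Zariski closure of the image).
   Formalization: The formal theorem also assumes that no coordinate y_i (i=1,…,n) is identically 0 or identically 1728 on V; otherwise Ψ is undefined on V and no E_j-point exists, e.g. for n=1 and V={y=0}, which is j-broad. *)

theory Defs
  imports "HOL-Algebra.Algebraic_Closure" "HOL-Library.Extended_Nat"
begin

section \<open>Differential fields\<close>

text \<open>All fields have characteristic 0; this is part of the locale.\<close>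

locale differential_field = field K for K (structure) +
  fixes D :: "'a \<Rightarrow> 'a"
  assumes char_0: "(0::nat) < k \<Longrightarrow> [k] \<cdot> \<one> \<noteq> \<zero>"
    and D_closed: "x \<in> carrier K \<Longrightarrow> D x \<in> carrier K"
    and D_add: "\<lbrakk>x \<in> carrier K; y \<in> carrier K\<rbrakk> \<Longrightarrow> D (x \<oplus> y) = D x \<oplus> D y"
    and D_mult: "\<lbrakk>x \<in> carrier K; y \<in> carrier K\<rbrakk> \<Longrightarrow> D (x \<otimes> y) = x \<otimes> D y \<oplus> D x \<otimes> y"

text \<open>An extension is given by an embedding; a unital homomorphism of fields is injective.\<close>

locale differential_field_extension =
  F: differential_field F D + K: differential_field K \<delta>
  for F :: "('a, 'm) ring_scheme" (structure) and D
    and K :: "('b, 'r) ring_scheme" (structure) and \<delta> +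
  fixes \<sigma> :: "'a \<Rightarrow> 'b"
  assumes hom: "\<sigma> \<in> ring_hom F K"
    and commutes: "x \<in> carrier F \<Longrightarrow> \<sigma> (D x) = \<delta> (\<sigma> x)"


section \<open>Affine varieties\<close>

text \<open>
  Polynomials are those of \<^theory>\<open>HOL-Algebra.Indexed_Polynomials\<close>: coefficient functions on
  monomials, a monomial being a multiset of variables. The elements of \<open>carrier R[\<X>\<^bsub>I\<^esub>]\<close> have
  finite support. Points of affine \<open>m\<close>-space are lists of length \<open>m\<close>, and the variables of
  polynomials on it are the indices \<open>0, \<dots>, m - 1\<close>.
\<close>

definition (in ring) mpoly_eval :: "('c multiset \<Rightarrow> 'a) \<Rightarrow> ('c \<Rightarrow> 'a) \<Rightarrow> 'a"
  where "mpoly_eval P a =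
    (\<Oplus>\<mu> \<in> {\<mu>. P \<mu> \<noteq> \<zero>}. P \<mu> \<otimes> (\<Otimes>i \<in> set_mset \<mu>. a i [^] count \<mu> i))"

definition (in ring) affine_space :: "nat \<Rightarrow> 'a list set"
  where "affine_space m = {p. length p = m \<and> set p \<subseteq> carrier R}"

definition (in ring) zero_locus :: "nat \<Rightarrow> (nat multiset \<Rightarrow> 'a) set \<Rightarrow> 'a list set"
  where "zero_locus m S = {p \<in> affine_space m. \<forall>P \<in> S. mpoly_eval P (\<lambda>i. p ! i) = \<zero>}"

text \<open>
  The \<open>K\<close>-points of the variety in \<open>m\<close>-space defined by a set \<open>S\<close> of polynomials over a smaller
  field embedded in \<open>K\<close> by \<open>\<sigma>\<close>.
\<close>

definition variety_points ::
    "('b, 'r) ring_scheme \<Rightarrow> ('a \<Rightarrow> 'b) \<Rightarrow> nat \<Rightarrow> (nat multiset \<Rightarrow> 'a) set \<Rightarrow> 'b list set"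
  where "variety_points K \<sigma> m S = ring.zero_locus K m ((\<lambda>P. \<sigma> \<circ> P) ` S)"

definition (in ring) zariski_closed :: "nat \<Rightarrow> 'a list set \<Rightarrow> bool"
  where "zariski_closed m Z \<longleftrightarrow> (\<exists>S \<subseteq> carrier R[\<X>\<^bsub>{..<m}\<^esub>]. Z = zero_locus m S)"

definition (in ring) zariski_closure :: "nat \<Rightarrow> 'a list set \<Rightarrow> 'a list set"
  where "zariski_closure m W = \<Inter>{Z. zariski_closed m Z \<and> W \<subseteq> Z}"

definition (in ring) irreducible_variety :: "nat \<Rightarrow> 'a list set \<Rightarrow> bool"
  where "irreducible_variety m Z \<longleftrightarrow> zariski_closed m Z \<and> Z \<noteq> {} \<and>
    (\<forall>A B. zariski_closed m A \<longrightarrow> zariski_closed m B \<longrightarrow> Z \<subseteq> A \<union> B \<longrightarrow> Z \<subseteq> A \<or> Z \<subseteq> B)"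

text \<open>
  Krull dimension of the Zariski closure: the supremum of the lengths \<open>k\<close> of chains
  \<open>Z\<^sub>0 \<subset> \<dots> \<subset> Z\<^sub>k\<close> of irreducible closed subsets.
\<close>

definition (in ring) zariski_dim :: "nat \<Rightarrow> 'a list set \<Rightarrow> enat"
  where "zariski_dim m W = (SUP k \<in> {k. \<exists>Z.
      (\<forall>i\<le>k. irreducible_variety m (Z i) \<and> Z i \<subseteq> zariski_closure m W) \<and>
      (\<forall>i<k. Z i \<subset> Z (Suc i))}. enat k)"


section \<open>Broad varieties\<close>

text \<open>
  A point of \<open>2n\<close>-space is \<open>(x\<^sub>0, \<dots>, x\<^sub>n\<^sub>-\<^sub>1, y\<^sub>0, \<dots>, y\<^sub>n\<^sub>-\<^sub>1)\<close>; indices start at 0.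
\<close>

definition coord_proj :: "nat \<Rightarrow> nat list \<Rightarrow> 'a list \<Rightarrow> 'a list"
  where "coord_proj n is p = map (\<lambda>i. p ! i) is @ map (\<lambda>i. p ! (n + i)) is"

definition (in ring) j_broad :: "nat \<Rightarrow> 'a list set \<Rightarrow> bool"
  where "j_broad n V \<longleftrightarrow> irreducible_variety (2 * n) V \<and>
    (\<forall>is. is \<noteq> [] \<and> sorted_wrt (<) is \<and> set is \<subseteq> {..<n} \<longrightarrow>
      zariski_dim (2 * length is) (coord_proj n is ` V) \<ge> enat (length is))"


section \<open>The differential equation of the \<open>j\<close>-function\<close>

definition (in field) Psi :: "'a \<Rightarrow> 'a \<Rightarrow> 'a \<Rightarrow> 'a \<Rightarrow> 'a"
  where "Psi y0 y1 y2 y3 =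
    y3 \<otimes> inv y1
    \<ominus> ([(3::nat)] \<cdot> \<one> \<otimes> inv ([(2::nat)] \<cdot> \<one>)) \<otimes> (y2 \<otimes> inv y1) [^] (2::nat)
    \<oplus> ((y0 [^] (2::nat) \<ominus> [(1968::nat)] \<cdot> y0 \<oplus> [(2654208::nat)] \<cdot> \<one>)
        \<otimes> inv ([(2::nat)] \<cdot> (y0 [^] (2::nat) \<otimes> (y0 \<ominus> [(1728::nat)] \<cdot> \<one>) [^] (2::nat))))
      \<otimes> y1 [^] (2::nat)"

text \<open>
  \<open>\<Psi>\<close> is a rational function, so \<open>\<Psi> = 0\<close> includes the requirement that its denominators \<open>y1\<close>
  and \<open>2 y0\<^sup>2 (y0 - 1728)\<^sup>2\<close> do not vanish; the library's \<open>inv \<zero>\<close> is an arbitrary value. Hence a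
  variety on which some \<open>y\<close>-coordinate is identically 0 or 1728 has no \<open>E_j\<close>-points at all, even
  if it is \<open>j\<close>-broad.
\<close>

definition (in differential_field) E_J :: "'a \<Rightarrow> 'a \<Rightarrow> 'a \<Rightarrow> 'a \<Rightarrow> bool"
  where "E_J x y0 y1 y2 \<longleftrightarrow> {x, y0, y1, y2} \<subseteq> carrier K \<and>
    (\<exists>y3 \<in> carrier K.
      (y1 \<noteq> \<zero> \<and> y0 \<noteq> \<zero> \<and> y0 \<noteq> [(1728::nat)] \<cdot> \<one> \<and> Psi y0 y1 y2 y3 = \<zero>) \<and>
      D y0 = y1 \<otimes> D x \<and> D y1 = y2 \<otimes> D x \<and> D y2 = y3 \<otimes> D x)"

definition (in differential_field) E_j :: "'a \<Rightarrow> 'a \<Rightarrow> bool"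
  where "E_j x y \<longleftrightarrow> (\<exists>y1 \<in> carrier K. \<exists>y2 \<in> carrier K. E_J x y y1 y2)"

definition (in differential_field) E_j_point :: "nat \<Rightarrow> 'a list \<Rightarrow> bool"
  where "E_j_point n p \<longleftrightarrow> (\<forall>i<n. E_j (p ! i) (p ! (n + i)))"


section \<open>Differentially closed fields\<close>

text \<open>
  Differential polynomials in \<open>m\<close> indeterminates have variables \<open>(i, r)\<close> with \<open>i < m\<close>, standing
  for the \<open>r\<close>-th derivative of the \<open>i\<close>-th indeterminate.
\<close>

definition (in differential_field) diff_solution ::
    "nat \<Rightarrow> ((nat \<times> nat) multiset \<Rightarrow> 'a) set \<Rightarrow> ((nat \<times> nat) multiset \<Rightarrow> 'a) set \<Rightarrow> 'a list \<Rightarrow> bool"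
  where "diff_solution m P Q a \<longleftrightarrow> a \<in> affine_space m \<and>
    (\<forall>p \<in> P. mpoly_eval p (\<lambda>(i, r). (D ^^ r) (a ! i)) = \<zero>) \<and>
    (\<forall>q \<in> Q. mpoly_eval q (\<lambda>(i, r). (D ^^ r) (a ! i)) \<noteq> \<zero>)"

text \<open>
  Differentially closed means existentially closed: each finite system of differential
  polynomial equations and inequations over \<open>F\<close> that is solvable in a differential field
  extension is solvable in \<open>F\<close>. The extensions range over structures on the type of \<open>F\<close>; this is
  no restriction, since a solution in an arbitrary extension lies in a subextension generated by
  finitely many elements together with their derivatives, which has the same cardinality as \<open>F\<close>.
\<close>

definition differentially_closed :: "'a ring \<Rightarrow> ('a \<Rightarrow> 'a) \<Rightarrow> bool"
  where "differentially_closed F D \<longleftrightarrow> differential_field F D \<and>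
    (\<forall>(K :: 'a ring) \<delta> \<sigma> m P Q.
      differential_field_extension F D K \<delta> \<sigma> \<and> finite P \<and> finite Q \<and>
      P \<union> Q \<subseteq> ring.indexed_pset F ({..<m} \<times> UNIV) (carrier F) \<and>
      (\<exists>a. differential_field.diff_solution K \<delta> m ((\<lambda>p. \<sigma> \<circ> p) ` P) ((\<lambda>q. \<sigma> \<circ> q) ` Q) a) \<longrightarrow>
      (\<exists>a. differential_field.diff_solution F D m P Q a))"

end

theory Submission
  imports Defs
begin

text \<open>
  Let \<open>(x, y)\<close> be a generic point of \<open>V\<close> over \<open>k = F\<^sup>a\<^sup>l\<^sup>g\<close>, in a field \<open>L\<close> that also contains elements
  \<open>y'\<^sub>1, \<dots>, y'\<^sub>n, y''\<^sub>1, \<dots>, y''\<^sub>n\<close> algebraically independent over \<open>k(x, y)\<close>, and let \<open>y'''\<^sub>i\<close> be the solution of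
  \<open>\<Psi>(y\<^sub>i, y'\<^sub>i, y''\<^sub>i, y'''\<^sub>i) = 0\<close>, which exists because \<open>y\<^sub>i\<close> is neither 0 nor 1728, as it is not identically so on \<open>V\<close>. It suffices to find a derivation \<open>\<delta>\<close> of \<open>L\<close> that extends \<open>D\<close> and satisfies
  \<open>\<delta>y\<^sub>i = y'\<^sub>i \<delta>x\<^sub>i\<close>, \<open>\<delta>y'\<^sub>i = y''\<^sub>i \<delta>x\<^sub>i\<close> and \<open>\<delta>y''\<^sub>i = y'''\<^sub>i \<delta>x\<^sub>i\<close>. By independence, the values of \<open>\<delta>\<close> at \<open>y'\<^sub>i\<close> and
  \<open>y''\<^sub>i\<close> can be chosen freely, so only the equations \<open>\<delta>y\<^sub>i = y'\<^sub>i \<delta>x\<^sub>i\<close> matter. They form an inhomogeneous linear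
  system on the space \<open>Der\<^sub>k(L)\<close>, which is solvable if the functionals \<open>\<partial> \<mapsto> \<partial>y\<^sub>i - y'\<^sub>i \<partial>x\<^sub>i\<close> are
  linearly independent there.

  This is where broadness enters. Suppose that \<open>\<Sum>\<^sub>i \<mu>\<^sub>i (\<partial>y\<^sub>i - y'\<^sub>i \<partial>x\<^sub>i) = 0\<close> for all \<open>\<partial>\<close>, with \<open>\<mu>\<close> supported on a
  nonempty set \<open>I\<close> of indices and normalized to be 1 at some index. Let \<open>\<epsilon>\<^sub>a\<close> be derivations that kill \<open>k(x, y)\<close> and
  satisfy \<open>\<epsilon>\<^sub>a(y'\<^sub>i) = 1\<close> for \<open>i = a\<close> and \<open>0\<close> otherwise. Since \<open>[\<epsilon>\<^sub>a, \<partial>]\<close> is in \<open>Der\<^sub>k(L)\<close> again, applying \<open>\<epsilon>\<^sub>a\<close> to the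
  coefficients of a relation between the \<open>dx\<^sub>i, dy\<^sub>i\<close> gives another relation (\<open>annihilates_derivation\<close>). So there are \<open>|I| + 1\<close>
  relations between \<open>2|I|\<close> differentials, of which \<open>|I|\<close> are independent because the projection
  of \<open>V\<close> to the coordinates in \<open>I\<close> has dimension at least \<open>|I|\<close>. Hence the relations are linearly
  dependent, and the shape of their coefficients excludes this (\<open>no_normalized_relation\<close>).

  Two general facts are behind the argument. In characteristic 0 derivations extend from
  subrings to the whole field, with arbitrary values at transcendental elements
  (\<open>derivation_graph_extends\<close>, \<open>derivation_prescribe\<close>); it follows that derivations detect algebraic
  dependence. And if the Krull dimension of a set is at least \<open>k\<close>, then \<open>k\<close> of the coordinates
  are algebraically independent on it (\<open>zariski_dim_alg_indep\<close>): along a chain of irreducible closed sets,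
  each step adds an independent coordinate.

  The field \<open>L\<close> is a residue field of a ring of functions and too large for the type of \<open>F\<close>. The differential
  subfield generated by \<open>F\<close> and the solution has the cardinality of \<open>F\<close>, and so a copy on that type
  (\<open>differential_subextension_on_base_type\<close>). For a differentially closed \<open>F\<close>, the conditions on the solution, with the
  denominators of \<open>\<Psi>\<close> cleared, are a finite system of differential polynomial equations and
  inequations over \<open>F\<close>.
\<close>

section \<open>Polynomials in one element\<close>

text \<open>
  Horner's rule: the value at \<open>t\<close> of the polynomial of degree at most \<open>m\<close> whose coefficients are the
  first \<open>m + 1\<close> values of \<open>f\<close>, and the value of its formal derivative. The same functions are used in
  a field and in its ring of dual numbers.
\<close>

primrec (in ring) poly_sum :: "(nat \<Rightarrow> 'a) \<Rightarrow> 'a \<Rightarrow> nat \<Rightarrow> 'a" where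
  "poly_sum f t 0 = f 0"
| "poly_sum f t (Suc m) = f 0 \<oplus> t \<otimes> poly_sum (\<lambda>i. f (Suc i)) t m"

primrec (in ring) poly_deriv_sum :: "(nat \<Rightarrow> 'a) \<Rightarrow> 'a \<Rightarrow> nat \<Rightarrow> 'a" where
  "poly_deriv_sum f t 0 = \<zero>"
| "poly_deriv_sum f t (Suc m) = poly_sum (\<lambda>i. f (Suc i)) t m \<oplus> t \<otimes> poly_deriv_sum (\<lambda>i. f (Suc i)) t m"

definition (in ring) transcendental_over :: "'a set \<Rightarrow> 'a \<Rightarrow> bool" where
  "transcendental_over A t \<longleftrightarrow>
     (\<forall>f m. (\<forall>i. f i \<in> A) \<and> poly_sum f t m = \<zero> \<longrightarrow> (\<forall>i\<le>m. f i = \<zero>))"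

context cring
begin

lemma poly_sum_closed [simp]:
  "\<lbrakk>\<And>i. f i \<in> carrier R; t \<in> carrier R\<rbrakk> \<Longrightarrow> poly_sum f t m \<in> carrier R"
  by (induction m arbitrary: f) auto

lemma poly_deriv_sum_closed [simp]:
  "\<lbrakk>\<And>i. f i \<in> carrier R; t \<in> carrier R\<rbrakk> \<Longrightarrow> poly_deriv_sum f t m \<in> carrier R"
  by (induction m arbitrary: f) auto

lemma poly_sum_cong: "(\<And>i. i \<le> m \<Longrightarrow> f i = g i) \<Longrightarrow> poly_sum f t m = poly_sum g t m"
proof (induction m arbitrary: f g)
  case (Suc m)
  have "poly_sum (\<lambda>i. f (Suc i)) t m = poly_sum (\<lambda>i. g (Suc i)) t m" by (rule Suc.IH) (simp add: Suc.prems)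
  then show ?case using Suc.prems[of 0] by simp
qed simp

lemma poly_sum_zero: "t \<in> carrier R \<Longrightarrow> poly_sum (\<lambda>_. \<zero>) t m = \<zero>"
  by (induction m) auto

lemma poly_sum_add:
  assumes "\<And>i. f i \<in> carrier R" "\<And>i. g i \<in> carrier R" "t \<in> carrier R"
  shows "poly_sum (\<lambda>i. f i \<oplus> g i) t m = poly_sum f t m \<oplus> poly_sum g t m"
  using assms by (induction m arbitrary: f g) (simp_all add: r_distr a_ac)

lemma poly_sum_scale:
  assumes "\<And>i. f i \<in> carrier R" "c \<in> carrier R" "t \<in> carrier R"
  shows "poly_sum (\<lambda>i. c \<otimes> f i) t m = c \<otimes> poly_sum f t m"
  using assms by (induction m arbitrary: f) (simp_all add: r_distr m_lcomm)

lemma poly_sum_drop: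
  assumes "\<And>i. f i \<in> carrier R" "t \<in> carrier R" "f (Suc m) = \<zero>"
  shows "poly_sum f t (Suc m) = poly_sum f t m"
  using assms
proof (induction m arbitrary: f)
  case (Suc m)
  have "poly_sum (\<lambda>i. f (Suc i)) t (Suc m) = poly_sum (\<lambda>i. f (Suc i)) t m" by (rule Suc.IH) (simp_all add: Suc.prems)
  then show ?case using Suc.prems by simp
qed simp

lemma poly_sum_pad:
  assumes "\<And>i. f i \<in> carrier R" "t \<in> carrier R"
  shows "poly_sum (\<lambda>i. if i \<le> m then f i else \<zero>) t (m + k) = poly_sum f t m"
proof (induction k)
  case 0
  show ?case by (simp, rule poly_sum_cong, simp)
next
  case (Suc k)
  then show ?case using poly_sum_drop[of "\<lambda>i. if i \<le> m then f i else \<zero>" t "m + k"] assms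
    by (simp del: poly_sum.simps)
qed

lemma poly_sum_scale_arg:
  assumes "\<And>i. f i \<in> carrier R" "c \<in> carrier R" "t \<in> carrier R"
  shows "poly_sum f (c \<otimes> t) m = poly_sum (\<lambda>i. f i \<otimes> c [^] i) t m"
  using assms(1)
proof (induction m arbitrary: f)
  case (Suc m)
  have "poly_sum (\<lambda>i. f (Suc i) \<otimes> c [^] Suc i) t m = poly_sum (\<lambda>i. c \<otimes> (f (Suc i) \<otimes> c [^] i)) t m"
    using Suc.prems assms by (intro poly_sum_cong) (simp add: m_ac)
  also have "\<dots> = c \<otimes> poly_sum (\<lambda>i. f (Suc i)) (c \<otimes> t) m"
    using Suc assms by (subst poly_sum_scale) auto
  finally show ?case using Suc.prems assms by (simp add: m_ac)
qed simp

text \<open>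
  The derivative is again the value of a polynomial, of smaller degree and with coefficients in the
  same subring; this is what minimality of a relation is played against below.
\<close>

lemma poly_deriv_sum_poly_sum:
  assumes "\<And>i. f i \<in> carrier R" "t \<in> carrier R"
  shows "poly_deriv_sum f t (Suc m) = poly_sum (\<lambda>i. [Suc i] \<cdot> f (Suc i)) t m"
  using assms(1)
proof (induction m arbitrary: f)
  case 0 then show ?case using assms by (simp add: add.nat_pow_Suc)
next
  case (Suc m)
  have "poly_sum (\<lambda>i. [Suc (Suc i)] \<cdot> f (Suc (Suc i))) t m =
        poly_sum (\<lambda>i. f (Suc (Suc i)) \<oplus> [Suc i] \<cdot> f (Suc (Suc i))) t m"
    using Suc.prems by (intro poly_sum_cong) (simp add: a_ac)
  also have "\<dots> = poly_sum (\<lambda>i. f (Suc (Suc i))) t m \<oplus> poly_deriv_sum (\<lambda>i. f (Suc i)) t (Suc m)"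
    using Suc.IH[of "\<lambda>i. f (Suc i)"] Suc.prems assms by (subst poly_sum_add) (auto simp del: poly_deriv_sum.simps)
  finally show ?case using Suc.prems assms
    by (simp add: r_distr a_ac)
qed

lemma poly_sum_shift:
  assumes "\<And>i. f i \<in> carrier R" "t \<in> carrier R"
  shows "poly_sum (\<lambda>i. if i < k then \<zero> else f (i - k)) t (k + m) = t [^] k \<otimes> poly_sum f t m"
proof (induction k)
  case (Suc k)
  have "(if Suc i < Suc k then \<zero> else f (Suc i - Suc k)) = (if i < k then \<zero> else f (i - k))" for i
    by simp
  then have "poly_sum (\<lambda>i. if i < Suc k then \<zero> else f (i - Suc k)) t (Suc (k + m)) =
     t \<otimes> poly_sum (\<lambda>i. if i < k then \<zero> else f (i - k)) t (k + m)"
    using assms by (simp del: diff_Suc_Suc)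
  then show ?case using Suc assms by (simp add: m_ac)
qed (use assms in simp)

end

text \<open>
  Division with remainder by a monic polynomial that vanishes at \<open>t\<close>.
\<close>

lemma (in cring) poly_sum_reduce:
  assumes G: "subring G R" and t: "t \<in> carrier R" and f: "\<And>i. f i \<in> G"
    and p: "\<And>i. p i \<in> G" "p (Suc d) = \<one>" "poly_sum p t (Suc d) = \<zero>"
  shows "\<exists>g. (\<forall>i. g i \<in> G) \<and> poly_sum f t m = poly_sum g t d"
  using f
proof (induction m arbitrary: f)
  case 0
  let ?g = "\<lambda>i. if i \<le> 0 then f i else \<zero>"
  have fc: "f i \<in> carrier R" for i using 0 subringE(1)[OF G] by blast
  have "poly_sum f t 0 = poly_sum ?g t d" using poly_sum_pad[of f t 0 d, OF fc t] by simp
  moreover have "\<forall>i. ?g i \<in> G" using 0 subringE(2)[OF G] by simp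
  ultimately show ?case by (intro exI[of _ ?g] conjI)
next
  case (Suc m)
  note E = subringE[OF G]
  have Gc: "x \<in> carrier R" if "x \<in> G" for x using E(1) that by auto
  show ?case
  proof (cases "Suc m \<le> d")
    case True
    then obtain k where k: "d = Suc m + k" using le_Suc_ex by blast
    let ?g = "\<lambda>i. if i \<le> Suc m then f i else \<zero>"
    have "poly_sum f t (Suc m) = poly_sum ?g t d"
      unfolding k using poly_sum_pad[of f t "Suc m" k] Gc Suc.prems t by simp
    moreover have "\<forall>i. ?g i \<in> G" using Suc.prems E(2) by simp
    ultimately show ?thesis by (intro exI[of _ ?g] conjI)
  next
    case False
    define k where "k = m - d"
    have k: "k + Suc d = Suc m" "\<not> Suc m < k" "Suc m - k = Suc d" using False by (auto simp: k_def)
    define l where "l = \<ominus> f (Suc m)"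
    define s where "s i = (if i < k then \<zero> else p (i - k))" for i
    define h where "h i = f i \<oplus> l \<otimes> s i" for i
    have mem: "l \<in> G" "s i \<in> G" "h i \<in> G" for i
      using Suc.prems p(1) E(2,5,6,7) by (simp_all add: l_def s_def h_def)
    have c: "l \<in> carrier R" "s i \<in> carrier R" "f i \<in> carrier R" "h i \<in> carrier R" for i
      using mem Suc.prems Gc by auto
    have "poly_sum s t (Suc m) = t [^] k \<otimes> poly_sum p t (Suc d)"
      using poly_sum_shift[of p t k "Suc d"] Gc p(1) t unfolding s_def k(1) by blast
    then have s0: "poly_sum s t (Suc m) = \<zero>" using p(3) t by simp
    have "poly_sum h t (Suc m) = poly_sum f t (Suc m) \<oplus> l \<otimes> poly_sum s t (Suc m)"
      unfolding h_def using c t poly_sum_add[of f "\<lambda>i. l \<otimes> s i" t "Suc m"] poly_sum_scale[of s l t "Suc m"] by simp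
    then have "poly_sum f t (Suc m) = poly_sum h t (Suc m)" using s0 c t poly_sum_closed[of f t "Suc m"] by (simp del: poly_sum.simps)
    also have "h (Suc m) = \<zero>" using k(2,3) p(2) c by (simp add: h_def s_def l_def r_neg)
    then have "poly_sum h t (Suc m) = poly_sum h t m" using poly_sum_drop[of h t m] c t by blast
    finally show ?thesis using Suc.IH[of h] mem(3) by simp
  qed
qed

definition (in ring) adjoin :: "'a set \<Rightarrow> 'a \<Rightarrow> 'a set" where
  "adjoin G t = {poly_sum f t m | f m. \<forall>i. f i \<in> G}"

text \<open>
  Closure under products follows by recursion on Horner's rule: it reduces to products with a
  coefficient and with \<open>t\<close>.
\<close>

lemma (in cring) adjoin_subring:
  assumes G: "subring G R" and t: "t \<in> carrier R"
  shows "subring (adjoin G t) R"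
proof -
  note E = subringE[OF G]
  have Gc: "x \<in> carrier R" if "x \<in> G" for x using E(1) that by auto
  have add: "x \<oplus> y \<in> adjoin G t" if "x \<in> adjoin G t" "y \<in> adjoin G t" for x y
  proof -
    from that obtain f m g n where f: "x = poly_sum f t m" "\<And>i. f i \<in> G" and g: "y = poly_sum g t n" "\<And>i. g i \<in> G"
      unfolding adjoin_def by auto
    let ?f = "\<lambda>i. if i \<le> m then f i else \<zero>" and ?g = "\<lambda>i. if i \<le> n then g i else \<zero>"
    have "x = poly_sum ?f t (m + n)" using poly_sum_pad[of f t m n] f t Gc by simp
    moreover have "y = poly_sum ?g t (m + n)" using poly_sum_pad[of g t n m] g t Gc by (simp add: add.commute)
    ultimately have "x \<oplus> y = poly_sum (\<lambda>i. ?f i \<oplus> ?g i) t (m + n)"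
      using f g t Gc by (subst poly_sum_add) auto
    moreover have "\<forall>i. ?f i \<oplus> ?g i \<in> G" using f g E by auto
    ultimately show ?thesis unfolding adjoin_def by blast
  qed
  have scale: "c \<otimes> x \<in> adjoin G t" if "x \<in> adjoin G t" "c \<in> G" for x c
  proof -
    from that obtain f m where f: "x = poly_sum f t m" "\<And>i. f i \<in> G"
      unfolding adjoin_def by auto
    then have "c \<otimes> x = poly_sum (\<lambda>i. c \<otimes> f i) t m" using that t Gc by (subst poly_sum_scale) auto
    moreover have "\<forall>i. c \<otimes> f i \<in> G" using f that E by auto
    ultimately show ?thesis unfolding adjoin_def by blast
  qed
  have shift: "t \<otimes> x \<in> adjoin G t" if "x \<in> adjoin G t" for x
  proof -
    from that obtain f m where f: "x = poly_sum f t m" "\<And>i. f i \<in> G"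
      unfolding adjoin_def by auto
    then have "t \<otimes> x = poly_sum (\<lambda>i. if i < 1 then \<zero> else f (i - 1)) t (1 + m)" using that t Gc by (subst poly_sum_shift) auto
    moreover have "\<forall>i. (if i < 1 then \<zero> else f (i - 1)) \<in> G" using f that E by auto
    ultimately show ?thesis unfolding adjoin_def by blast
  qed
  have sub: "adjoin G t \<subseteq> carrier R" unfolding adjoin_def using Gc t by auto
  have mult: "poly_sum f t m \<otimes> y \<in> adjoin G t" if "\<And>i. f i \<in> G" "y \<in> adjoin G t" for f m y
    using that(1)
  proof (induction m arbitrary: f)
    case 0 then show ?case using scale that by simp
  next
    case (Suc m)
    have y: "y \<in> carrier R" using that sub by auto
    have "poly_sum f t (Suc m) \<otimes> y = f 0 \<otimes> y \<oplus> t \<otimes> (poly_sum (\<lambda>i. f (Suc i)) t m \<otimes> y)"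
      using y Suc.prems t Gc by (simp add: l_distr m_assoc)
    then show ?case using add scale shift Suc that(2) by simp
  qed
  have inG: "x \<in> adjoin G t" if "x \<in> G" for x
  proof -
    have "x = poly_sum (\<lambda>_. x) t 0" by simp
    then show ?thesis unfolding adjoin_def using that by blast
  qed
  show ?thesis
  proof (rule subringI[OF sub])
    show "\<one> \<in> adjoin G t" using inG E by auto
    show "x \<otimes> y \<in> adjoin G t" if "x \<in> adjoin G t" "y \<in> adjoin G t" for x y
      using mult that unfolding adjoin_def by blast
    show "x \<oplus> y \<in> adjoin G t" if "x \<in> adjoin G t" "y \<in> adjoin G t" for x y using add that .
    show "\<ominus> x \<in> adjoin G t" if "x \<in> adjoin G t" for x
    proof -
      have "(\<ominus> \<one>) \<otimes> x \<in> adjoin G t" using that E by (intro scale) auto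
      then show ?thesis using that sub by (simp add: l_minus subsetD)
    qed
  qed
qed

lemma (in cring) adjoin_base: "G \<subseteq> adjoin G t"
proof
  fix x assume "x \<in> G"
  moreover have "x = poly_sum (\<lambda>_. x) t 0" by simp
  ultimately show "x \<in> adjoin G t" unfolding adjoin_def by blast
qed

lemma (in cring) adjoin_gen:
  assumes "subring G R" "t \<in> carrier R" shows "t \<in> adjoin G t"
proof -
  let ?f = "\<lambda>i::nat. if i = 0 then \<zero> else \<one>"
  have 1: "t = poly_sum ?f t 1" using assms by simp
  have 2: "\<forall>i. ?f i \<in> G" using subringE(2,3)[OF assms(1)] by simp
  show ?thesis unfolding adjoin_def
    by (rule CollectI, rule exI[of _ ?f], rule exI[of _ 1], rule conjI[OF 1 2])
qed

section \<open>Dual numbers\<close>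

text \<open>
  The ring of dual numbers \<open>a + a'\<epsilon>\<close> with \<open>\<epsilon>\<^sup>2 = 0\<close>. A map \<open>d\<close> on a subring is a derivation iff the
  pairs \<open>(a, d a)\<close> form a subring of it, so that derivations can be handled as graphs and the
  product rule never has to be carried along.
\<close>

definition dual_numbers :: "('a, 'm) ring_scheme \<Rightarrow> ('a \<times> 'a) ring" where
  "dual_numbers R = \<lparr>carrier = carrier R \<times> carrier R,
     monoid.mult = (\<lambda>x y. (fst x \<otimes>\<^bsub>R\<^esub> fst y, fst x \<otimes>\<^bsub>R\<^esub> snd y \<oplus>\<^bsub>R\<^esub> snd x \<otimes>\<^bsub>R\<^esub> fst y)),
     one = (\<one>\<^bsub>R\<^esub>, \<zero>\<^bsub>R\<^esub>), zero = (\<zero>\<^bsub>R\<^esub>, \<zero>\<^bsub>R\<^esub>),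
     add = (\<lambda>x y. (fst x \<oplus>\<^bsub>R\<^esub> fst y, snd x \<oplus>\<^bsub>R\<^esub> snd y))\<rparr>"

lemma dual_numbers_simps [simp]:
  "carrier (dual_numbers R) = carrier R \<times> carrier R"
  "x \<otimes>\<^bsub>dual_numbers R\<^esub> y = (fst x \<otimes>\<^bsub>R\<^esub> fst y, fst x \<otimes>\<^bsub>R\<^esub> snd y \<oplus>\<^bsub>R\<^esub> snd x \<otimes>\<^bsub>R\<^esub> fst y)"
  "\<one>\<^bsub>dual_numbers R\<^esub> = (\<one>\<^bsub>R\<^esub>, \<zero>\<^bsub>R\<^esub>)" "\<zero>\<^bsub>dual_numbers R\<^esub> = (\<zero>\<^bsub>R\<^esub>, \<zero>\<^bsub>R\<^esub>)"
  "x \<oplus>\<^bsub>dual_numbers R\<^esub> y = (fst x \<oplus>\<^bsub>R\<^esub> fst y, snd x \<oplus>\<^bsub>R\<^esub> snd y)"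
  by (simp_all add: dual_numbers_def)

lemma (in cring) dual_numbers_cring: "cring (dual_numbers R)"
proof (rule cringI)
  show "abelian_group (dual_numbers R)"
  proof (rule abelian_groupI)
    fix x assume "x \<in> carrier (dual_numbers R)"
    then show "\<exists>y\<in>carrier (dual_numbers R). y \<oplus>\<^bsub>dual_numbers R\<^esub> x = \<zero>\<^bsub>dual_numbers R\<^esub>"
      by (intro bexI[of _ "(\<ominus> fst x, \<ominus> snd x)"]) (auto simp: l_neg)
  qed (auto simp: a_ac)
  show "comm_monoid (dual_numbers R)"
    by (rule comm_monoidI) (auto simp: m_ac a_ac l_distr r_distr)
qed (auto simp: m_ac a_ac l_distr r_distr)

lemma (in cring) dual_numbers_minus:
  assumes "x \<in> carrier (dual_numbers R)"
  shows "\<ominus>\<^bsub>dual_numbers R\<^esub> x = (\<ominus> fst x, \<ominus> snd x)"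
proof -
  interpret D: cring "dual_numbers R" by (rule dual_numbers_cring)
  show ?thesis by (rule D.minus_equality) (use assms in \<open>auto simp: l_neg\<close>)
qed

text \<open>
  This is the chain rule: the second component of \<open>p(t, v)\<close> is \<open>p\<^sup>d(t) + p'(t) v\<close>, where \<open>p\<^sup>d\<close> has the
  derivatives of the coefficients of \<open>p\<close> as coefficients.
\<close>

lemma (in cring) poly_sum_dual_numbers:
  assumes "\<And>i. f i \<in> carrier (dual_numbers R)" "t \<in> carrier R" "v \<in> carrier R"
  shows "ring.poly_sum (dual_numbers R) f (t, v) m =
    (poly_sum (\<lambda>i. fst (f i)) t m, poly_sum (\<lambda>i. snd (f i)) t m \<oplus> poly_deriv_sum (\<lambda>i. fst (f i)) t m \<otimes> v)"
proof -
  interpret D: cring "dual_numbers R" by (rule dual_numbers_cring)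
  show ?thesis using assms(1)
  proof (induction m arbitrary: f)
    case 0
    then have "fst (f 0) \<in> carrier R" "snd (f 0) \<in> carrier R" using 0[of 0] by (auto simp: mem_Times_iff)
    then show ?case using assms by (simp)
  next
    case (Suc m)
    have c: "fst (f i) \<in> carrier R" "snd (f i) \<in> carrier R" for i using Suc.prems[of i] by (auto simp: mem_Times_iff)
    show ?case using Suc.IH[of "\<lambda>i. f (Suc i)"] Suc.prems c assms
      by (simp add: l_distr r_distr a_ac m_ac)
  qed
qed

section \<open>Extending derivations\<close>

definition (in ring) derivation :: "('a \<Rightarrow> 'a) \<Rightarrow> bool" where
  "derivation \<delta> \<longleftrightarrow> (\<forall>x\<in>carrier R. \<delta> x \<in> carrier R) \<and>
     (\<forall>x\<in>carrier R. \<forall>y\<in>carrier R. \<delta> (x \<oplus> y) = \<delta> x \<oplus> \<delta> y \<and> \<delta> (x \<otimes> y) = x \<otimes> \<delta> y \<oplus> \<delta> x \<otimes> y)"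

definition (in ring) char_zero :: bool where
  "char_zero \<longleftrightarrow> (\<forall>k::nat. 0 < k \<longrightarrow> [k] \<cdot> \<one> \<noteq> \<zero>)"

text \<open>
  The graph of a derivation defined on some subring. By additivity it is single-valued once it is so
  over \<open>0\<close>.
\<close>

definition (in ring) derivation_graph :: "('a \<times> 'a) set \<Rightarrow> bool" where
  "derivation_graph G \<longleftrightarrow> subring G (dual_numbers R) \<and> (\<forall>w. (\<zero>, w) \<in> G \<longrightarrow> w = \<zero>)"

lemma (in domain) nat_mult_eq_zero:
  assumes "char_zero" "x \<in> carrier R" "[k] \<cdot> x = \<zero>" "0 < (k::nat)"
  shows "x = \<zero>"
proof -
  have "([k] \<cdot> \<one>) \<otimes> x = [k] \<cdot> x" using assms by (simp add: add_pow_ldistr)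
  then show ?thesis using assms unfolding char_zero_def
    by (metis add.nat_pow_closed integral one_closed)
qed

lemma subring_nat_mult:
  assumes "subring A R" "x \<in> A" shows "[(k::nat)] \<cdot>\<^bsub>R\<^esub> x \<in> A"
proof (induction k)
  case 0
  then show ?case using subringE(2)[OF assms(1)] by (simp add: add_pow_def)
next
  case (Suc k)
  then show ?case using subringE(7)[OF assms(1)] assms(2) by (simp add: add_pow_def nat_pow_def)
qed

text \<open>
  An algebraic element satisfies a relation of least degree. In characteristic 0 the derivative of
  this relation is again one over \<open>A\<close>, of smaller degree and with nonzero leading coefficient, so by
  minimality it does not vanish at \<open>t\<close>.
\<close>

lemma (in domain) not_transcendental_separable:
  assumes A: "subring A R" and t: "t \<in> carrier R" and ch: "char_zero"
    and nt: "\<not> transcendental_over A t"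
  obtains p d where "\<And>i. p i \<in> A" "p (Suc d) \<noteq> \<zero>" "poly_sum p t (Suc d) = \<zero>" "poly_deriv_sum p t (Suc d) \<noteq> \<zero>"
    "\<And>g m i. \<lbrakk>m \<le> d; \<And>i. g i \<in> A; poly_sum g t m = \<zero>; i \<le> m\<rbrakk> \<Longrightarrow> g i = \<zero>"
proof -
  have Ac: "x \<in> carrier R" if "x \<in> A" for x using subringE(1)[OF A] that by auto
  define Q where "Q d \<longleftrightarrow> (\<exists>f. (\<forall>i. f i \<in> A) \<and> poly_sum f t d = \<zero> \<and> (\<exists>i\<le>d. f i \<noteq> \<zero>))" for d
  obtain d0 where "Q d0" using nt unfolding transcendental_over_def Q_def by blast
  define d where "d = (LEAST d. Q d)"
  have "Q d" unfolding d_def using \<open>Q d0\<close> by (rule LeastI)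
  then obtain p where p: "\<And>i. p i \<in> A" "poly_sum p t d = \<zero>" "\<exists>i\<le>d. p i \<noteq> \<zero>" unfolding Q_def by blast
  have min: "g i = \<zero>" if "m < d" "\<And>i. g i \<in> A" "poly_sum g t m = \<zero>" "i \<le> m" for g m i
    using not_less_Least[of m Q, folded d_def, unfolded Q_def] that by blast
  have "d \<noteq> 0" using p by (cases d) auto
  then obtain e where e: "d = Suc e" by (cases d) auto
  have top: "p (Suc e) \<noteq> \<zero>"
  proof
    assume z: "p (Suc e) = \<zero>"
    then have "poly_sum p t e = \<zero>" using poly_sum_drop[of p t e] p Ac t e by simp
    then have "p i = \<zero>" if "i \<le> e" for i using min[of e p i] p that e by simp
    then show False using p(3) z e by (metis le_Suc_eq)
  qed
  have "poly_deriv_sum p t (Suc e) \<noteq> \<zero>"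
  proof
    assume "poly_deriv_sum p t (Suc e) = \<zero>"
    then have "poly_sum (\<lambda>i. [Suc i] \<cdot> p (Suc i)) t e = \<zero>" using poly_deriv_sum_poly_sum[of p t e] p Ac t by simp
    then have "[Suc e] \<cdot> p (Suc e) = \<zero>"
      using min[of e "\<lambda>i. [Suc i] \<cdot> p (Suc i)" e] p e subring_nat_mult[OF A] by blast
    then show False using nat_mult_eq_zero[OF ch _ _ zero_less_Suc] top p Ac by blast
  qed
  moreover have "g i = \<zero>" if "m \<le> e" "\<And>i. g i \<in> A" "poly_sum g t m = \<zero>" "i \<le> m" for g m i
    using min[of m g i] that e by simp
  ultimately show ?thesis using that[of p e] p(1,2) top unfolding e by blast
qed

context cring
begin

lemma derivation_graph_unique:
  assumes "derivation_graph G" "(a, b) \<in> G" "(a, c) \<in> G"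
  shows "b = c"
proof -
  interpret D: cring "dual_numbers R" by (rule dual_numbers_cring)
  note E = subringE[of G "dual_numbers R"]
  have s: "subring G (dual_numbers R)" using assms(1) by (simp add: derivation_graph_def)
  have c: "a \<in> carrier R" "b \<in> carrier R" "c \<in> carrier R" using E(1)[OF s] assms by auto
  have "(a, b) \<oplus>\<^bsub>dual_numbers R\<^esub> (\<ominus>\<^bsub>dual_numbers R\<^esub> (a, c)) \<in> G" using E[OF s] assms by metis
  then have "(\<zero>, b \<oplus> \<ominus> c) \<in> G" using dual_numbers_minus[of "(a, c)"] c by (simp add: r_neg)
  then have "b \<oplus> \<ominus> c = \<zero>" using assms(1) by (simp add: derivation_graph_def)
  then show ?thesis using c by (metis minus_equality a_inv_closed minus_minus)
qed

text \<open>
  The subring generated by the graph and \<open>(t, v)\<close> is the graph of an extension with value \<open>v\<close> at \<open>t\<close>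
  as soon as every polynomial relation of \<open>t\<close> is respected by \<open>(t, v)\<close>.
\<close>

lemma derivation_graph_adjoin:
  assumes G: "derivation_graph G" and t: "t \<in> carrier R" "v \<in> carrier R"
    and *: "\<And>f m. \<lbrakk>\<And>i. f i \<in> G; poly_sum (\<lambda>i. fst (f i)) t m = \<zero>\<rbrakk> \<Longrightarrow> ring.poly_sum (dual_numbers R) f (t, v) m = (\<zero>, \<zero>)"
  shows "derivation_graph (ring.adjoin (dual_numbers R) G (t, v))"
proof -
  interpret D: cring "dual_numbers R" by (rule dual_numbers_cring)
  have s: "subring G (dual_numbers R)" using G by (simp add: derivation_graph_def)
  have "subring (D.adjoin G (t, v)) (dual_numbers R)" using D.adjoin_subring[OF s, of "(t, v)"] t by simp
  moreover have "w = \<zero>" if "(\<zero>, w) \<in> D.adjoin G (t, v)" for w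
  proof -
    obtain f m where f: "(\<zero>, w) = D.poly_sum f (t, v) m" "\<And>i. f i \<in> G"
      using \<open>(\<zero>, w) \<in> D.adjoin G (t, v)\<close> unfolding D.adjoin_def by auto
    have fc: "f i \<in> carrier (dual_numbers R)" for i using subringE(1)[OF s] f by auto
    have "poly_sum (\<lambda>i. fst (f i)) t m = \<zero>" using poly_sum_dual_numbers[of f t v m] fc t f(1) by (metis fst_conv)
    then show ?thesis using * f by (metis snd_conv)
  qed
  ultimately show ?thesis by (simp add: derivation_graph_def)
qed

lemma derivation_graph_adjoin_transcendental:
  assumes G: "derivation_graph G" and t: "t \<in> carrier R" "v \<in> carrier R"
    and tr: "transcendental_over (fst ` G) t"
  shows "derivation_graph (ring.adjoin (dual_numbers R) G (t, v))"
proof (rule derivation_graph_adjoin[OF G t])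
  interpret D: cring "dual_numbers R" by (rule dual_numbers_cring)
  fix f m assume f: "\<And>i. f i \<in> G" "poly_sum (\<lambda>i. fst (f i)) t m = \<zero>"
  have "fst (f i) = \<zero>" if "i \<le> m" for i
    using tr f that unfolding transcendental_over_def by (metis image_eqI)
  moreover have "snd (f i) = \<zero>" if "i \<le> m" for i
    using calculation[OF that] f(1)[of i] G unfolding derivation_graph_def by (metis prod.collapse)
  ultimately have "D.poly_sum f (t, v) m = D.poly_sum (\<lambda>_. \<zero>\<^bsub>dual_numbers R\<^esub>) (t, v) m"
    by (intro D.poly_sum_cong) (simp add: prod_eq_iff)
  then show "D.poly_sum f (t, v) m = (\<zero>, \<zero>)" using D.poly_sum_zero[of "(t, v)" m] t by simp
qed

end

text \<open>
  If \<open>p\<close> is a monic relation of \<open>t\<close> of least degree, then \<open>p\<^sup>d(t) + p'(t) v = 0\<close> has a solution \<open>v\<close> since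
  \<open>p'(t) \<noteq> 0\<close>. Then \<open>p\<close> vanishes at \<open>(t, v)\<close>, and division by \<open>p\<close> replaces any other relation by one of
  smaller degree with the same value at \<open>(t, v)\<close>. By minimality its coefficients are zero.
\<close>

lemma (in field) derivation_graph_adjoin_algebraic:
  assumes G: "derivation_graph G" and t: "t \<in> carrier R" and ch: "char_zero"
    and inv: "\<And>a. \<lbrakk>a \<in> fst ` G; a \<noteq> \<zero>\<rbrakk> \<Longrightarrow> inv a \<in> fst ` G"
    and nt: "\<not> transcendental_over (fst ` G) t"
  shows "\<exists>v\<in>carrier R. derivation_graph (ring.adjoin (dual_numbers R) G (t, v))"
proof -
  interpret D: cring "dual_numbers R" by (rule dual_numbers_cring)
  have s: "subring G (dual_numbers R)" using G by (simp add: derivation_graph_def)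
  note GE = subringE[OF s]
  have Gc: "fst x \<in> carrier R" "snd x \<in> carrier R" if "x \<in> G" for x using GE(1) that by auto
  let ?E = "fst ` G"
  have Ec: "?E \<subseteq> carrier R" using Gc by auto
  have E: "subring ?E R"
  proof (rule subringI)
    show "\<one> \<in> ?E" using GE(3) by force
    show "\<ominus> h \<in> ?E" if "h \<in> ?E" for h
    proof -
      from that obtain x where x: "x \<in> G" "h = fst x" by auto
      then have "\<ominus>\<^bsub>dual_numbers R\<^esub> x = (\<ominus> h, \<ominus> snd x)" using dual_numbers_minus[of x] GE(1) by auto
      then show ?thesis using GE(5)[OF x(1)] by force
    qed
    show "h1 \<otimes> h2 \<in> ?E" "h1 \<oplus> h2 \<in> ?E" if "h1 \<in> ?E" "h2 \<in> ?E" for h1 h2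
      using that GE(6,7) by (force simp: image_iff)+
  qed (rule Ec)
  note EE = subringE[OF E]
  obtain p d where p: "\<And>i. p i \<in> ?E" "p (Suc d) \<noteq> \<zero>" "poly_sum p t (Suc d) = \<zero>" "poly_deriv_sum p t (Suc d) \<noteq> \<zero>"
    and min: "\<And>g m i. \<lbrakk>m \<le> d; \<And>i. g i \<in> ?E; poly_sum g t m = \<zero>; i \<le> m\<rbrakk> \<Longrightarrow> g i = \<zero>"
    using not_transcendental_separable[OF E t ch nt] by blast
  have pc: "p i \<in> carrier R" for i using p(1)[of i] Ec by auto
  define c where "c = inv (p (Suc d))"
  have c: "c \<in> ?E" using inv[OF p(1) p(2)] by (simp add: c_def)
  have cc: "c \<in> carrier R" using c Ec by auto
  have "\<exists>x\<in>G. fst x = c \<otimes> p i" for i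
    using EE(6)[OF c p(1)[of i]] by (metis (no_types, lifting) imageE)
  then obtain P where P: "\<And>i. P i \<in> G" "\<And>i. fst (P i) = c \<otimes> p i" by metis
  have PD: "P i \<in> carrier (dual_numbers R)" for i using P GE(1) by auto
  have Punit: "p (Suc d) \<in> Units R" using p(2) pc field_Units by auto
  have Ptop: "P (Suc d) = \<one>\<^bsub>dual_numbers R\<^esub>"
  proof -
    have "fst (P (Suc d)) = \<one>" using P(2) Units_l_inv[OF Punit] by (simp add: c_def)
    then show ?thesis
      using derivation_graph_unique[OF G, of \<one> "snd (P (Suc d))" \<zero>] P(1)[of "Suc d"] GE(3)
      by (metis dual_numbers_simps(3) prod.collapse)
  qed
  have Psum: "poly_sum (\<lambda>i. fst (P i)) t (Suc d) = \<zero>"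
    using poly_sum_scale[of p c t "Suc d"] pc cc t p(3) by (simp add: P(2) del: poly_sum.simps)
  have "c \<noteq> \<zero>" using Units_l_inv[OF Punit] pc by (auto simp: c_def)
  have Pder: "poly_deriv_sum (\<lambda>i. fst (P i)) t (Suc d) = c \<otimes> poly_deriv_sum p t (Suc d)"
  proof -
    have "poly_deriv_sum (\<lambda>i. fst (P i)) t (Suc d) = poly_sum (\<lambda>i. [Suc i] \<cdot> (c \<otimes> p (Suc i))) t d"
      using poly_deriv_sum_poly_sum[of "\<lambda>i. fst (P i)" t d] cc pc P t by (simp del: add.nat_pow_Suc poly_deriv_sum.simps)
    also have "\<dots> = poly_sum (\<lambda>i. c \<otimes> ([Suc i] \<cdot> p (Suc i))) t d"
      using cc pc by (intro poly_sum_cong) (simp add: add_pow_rdistr del: add.nat_pow_Suc)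
    also have "\<dots> = c \<otimes> poly_sum (\<lambda>i. [Suc i] \<cdot> p (Suc i)) t d"
      using cc pc t by (intro poly_sum_scale) auto
    finally show ?thesis using poly_deriv_sum_poly_sum[of p t d] pc t by simp
  qed
  let ?g = "poly_deriv_sum (\<lambda>i. fst (P i)) t (Suc d)" and ?s = "poly_sum (\<lambda>i. snd (P i)) t (Suc d)"
  have gc: "?g \<in> carrier R" and sc: "?s \<in> carrier R" using P(1) Gc t by (blast intro: poly_sum_closed poly_deriv_sum_closed)+
  have "?g \<noteq> \<zero>" unfolding Pder using \<open>c \<noteq> \<zero>\<close> p(4) cc pc t integral[of c "poly_deriv_sum p t (Suc d)"]
    by (auto simp del: poly_deriv_sum.simps)
  then have gU: "?g \<in> Units R" using gc field_Units by auto
  \<comment> \<open>The solution of \<open>?s + ?g v = 0\<close>, which makes \<open>P\<close> vanish at \<open>(t, v)\<close>.\<close>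
  define v where "v = \<ominus> (inv ?g \<otimes> ?s)"
  have v: "v \<in> carrier R" using gU sc by (simp add: v_def del: poly_deriv_sum.simps poly_sum.simps)
  have "?g \<otimes> v = \<ominus> ?s"
  proof -
    have "?g \<otimes> v = \<ominus> (?g \<otimes> (inv ?g \<otimes> ?s))" unfolding v_def using gU gc sc
      by (intro r_minus) (auto simp del: poly_deriv_sum.simps poly_sum.simps)
    also have "?g \<otimes> (inv ?g \<otimes> ?s) = ?s"
      using gU gc sc by (subst m_assoc[symmetric]) (auto simp del: poly_deriv_sum.simps poly_sum.simps)
    finally show ?thesis .
  qed
  then have Pzero: "D.poly_sum P (t, v) (Suc d) = \<zero>\<^bsub>dual_numbers R\<^esub>"
    using poly_sum_dual_numbers[of P t v "Suc d", OF PD t v] Psum sc by (simp add: r_neg del: poly_deriv_sum.simps poly_sum.simps)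
  have tvD: "(t, v) \<in> carrier (dual_numbers R)" using t v by simp
  have key: "D.poly_sum f (t, v) m = (\<zero>, \<zero>)"
    if f: "\<And>i. f i \<in> G" "poly_sum (\<lambda>i. fst (f i)) t m = \<zero>" for f m
  proof -
    obtain g where g: "\<And>i. g i \<in> G" and fg: "D.poly_sum f (t, v) m = D.poly_sum g (t, v) d"
      using D.poly_sum_reduce[of G "(t, v)" f P d m, OF s tvD f(1) P(1) Ptop Pzero] by blast
    have fD: "f i \<in> carrier (dual_numbers R)" and gD: "g i \<in> carrier (dual_numbers R)" for i using f(1) g GE(1) by blast+
    have gz: "poly_sum (\<lambda>i. fst (g i)) t d = \<zero>"
      using poly_sum_dual_numbers[of f t v m, OF fD t v] poly_sum_dual_numbers[of g t v d, OF gD t v] fg f(2) by simp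
    have "fst (g i) = \<zero>" if "i \<le> d" for i
      by (rule min[of d "\<lambda>i. fst (g i)" i, OF le_refl _ gz that]) (use g in simp)
    then have "g i = \<zero>\<^bsub>dual_numbers R\<^esub>" if "i \<le> d" for i
      using that g[of i] G unfolding derivation_graph_def by (metis dual_numbers_simps(4) prod.collapse)
    then have "D.poly_sum g (t, v) d = D.poly_sum (\<lambda>_. \<zero>\<^bsub>dual_numbers R\<^esub>) (t, v) d" by (intro D.poly_sum_cong) simp
    then show ?thesis unfolding fg using D.poly_sum_zero[OF tvD, of d] by (simp only: dual_numbers_simps(4))
  qed
  show ?thesis
    using v derivation_graph_adjoin[OF G t v] key by blast
qed

lemma (in cring) localization_subring:
  assumes G: "subring G R" and S: "S \<subseteq> G" "\<one> \<in> S" "\<And>s u. \<lbrakk>s \<in> S; u \<in> S\<rbrakk> \<Longrightarrow> s \<otimes> u \<in> S"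
  shows "subring {x \<in> carrier R. \<exists>s\<in>S. s \<otimes> x \<in> G} R"
proof (rule subringI)
  note E = subringE[OF G]
  let ?H = "{x \<in> carrier R. \<exists>s\<in>S. s \<otimes> x \<in> G}"
  have Sc: "s \<in> carrier R" "s \<in> G" if "s \<in> S" for s using that S(1) E(1) by auto
  show "\<one> \<in> ?H" using S(2) E(3) by (auto intro!: bexI[of _ \<one>])
  show "\<ominus> x \<in> ?H" if "x \<in> ?H" for x
  proof -
    from that obtain s where s: "s \<in> S" "s \<otimes> x \<in> G" and x: "x \<in> carrier R" by blast
    have "s \<otimes> \<ominus> x \<in> G" using E(5)[OF s(2)] Sc(1)[OF s(1)] x by (simp add: r_minus)
    then show ?thesis using s(1) x by auto
  qed
  fix x y assume "x \<in> ?H" "y \<in> ?H"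
  then obtain s u where s: "s \<in> S" "s \<otimes> x \<in> G" and u: "u \<in> S" "u \<otimes> y \<in> G"
    and c: "x \<in> carrier R" "y \<in> carrier R" by blast
  have eq: "s \<otimes> u \<otimes> (x \<otimes> y) = (s \<otimes> x) \<otimes> (u \<otimes> y)"
    "s \<otimes> u \<otimes> (x \<oplus> y) = u \<otimes> (s \<otimes> x) \<oplus> s \<otimes> (u \<otimes> y)"
    using Sc(1)[OF s(1)] Sc(1)[OF u(1)] c by (simp_all add: r_distr m_ac)
  have "s \<otimes> u \<otimes> (x \<otimes> y) \<in> G" "s \<otimes> u \<otimes> (x \<oplus> y) \<in> G"
    unfolding eq using E(6,7) s u Sc(2) by auto
  then show "x \<otimes> y \<in> ?H" "x \<oplus> y \<in> ?H" using S(3)[OF s(1) u(1)] c by auto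
qed auto

text \<open>
  The graph is localized at its elements with nonzero first component. Computing in the dual numbers
  makes the quotient rule superfluous, except for the inverse of \<open>a\<close> itself.
\<close>

lemma (in domain) derivation_graph_localize:
  assumes G: "derivation_graph G" and a: "a \<in> G" "fst a \<noteq> \<zero>" "fst a \<in> Units R"
  shows "\<exists>G'. derivation_graph G' \<and> G \<subseteq> G' \<and> inv (fst a) \<in> fst ` G'"
proof -
  interpret D: cring "dual_numbers R" by (rule dual_numbers_cring)
  have s: "subring G (dual_numbers R)" using G by (simp add: derivation_graph_def)
  note GE = subringE[OF s]
  have Gc: "x \<in> carrier (dual_numbers R)" if "x \<in> G" for x using GE(1) that by blast
  let ?S = "{s \<in> G. fst s \<noteq> \<zero>}"
  define G' where "G' = {x \<in> carrier (dual_numbers R). \<exists>s\<in>?S. s \<otimes>\<^bsub>dual_numbers R\<^esub> x \<in> G}"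
  have one: "\<one>\<^bsub>dual_numbers R\<^esub> \<in> ?S" using GE(3) by auto
  have "subring G' (dual_numbers R)"
    unfolding G'_def
  proof (rule D.localization_subring[OF s _ one])
    fix x y assume xy: "x \<in> ?S" "y \<in> ?S"
    then have "fst x \<otimes> fst y \<noteq> \<zero>" using Gc[of x] Gc[of y] integral[of "fst x" "fst y"] by auto
    then show "x \<otimes>\<^bsub>dual_numbers R\<^esub> y \<in> ?S" using xy GE(6)[of x y] by simp
  qed auto
  moreover have incl: "G \<subseteq> G'"
  proof
    fix x assume x: "x \<in> G"
    then have "\<one>\<^bsub>dual_numbers R\<^esub> \<otimes>\<^bsub>dual_numbers R\<^esub> x \<in> G" by (simp only: D.l_one[OF Gc])
    then show "x \<in> G'" using one Gc[OF x] unfolding G'_def by blast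
  qed
  moreover have "w = \<zero>" if w: "(\<zero>, w) \<in> G'" for w
  proof -
    obtain s where s: "s \<in> G" "fst s \<noteq> \<zero>" "s \<otimes>\<^bsub>dual_numbers R\<^esub> (\<zero>, w) \<in> G" "s \<in> carrier (dual_numbers R)" and wc: "w \<in> carrier R"
      using w Gc unfolding G'_def by auto
    have "(\<zero>, fst s \<otimes> w) \<in> G" using s wc by auto
    then have "fst s \<otimes> w = \<zero>" using G by (simp add: derivation_graph_def)
    then show ?thesis using s wc integral[of "fst s" w] by auto
  qed
  moreover have "inv (fst a) \<in> fst ` G'"
  proof -
    let ?i = "inv (fst a)"
    \<comment> \<open>The quotient rule for \<open>1 / a\<close>.\<close>
    let ?b = "(?i, \<ominus> (?i \<otimes> (?i \<otimes> snd a)))"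
    have ac: "fst a \<in> carrier R" "snd a \<in> carrier R" using Gc[OF a(1)] by auto
    have ic: "?i \<in> carrier R" using a by simp
    have "fst a \<otimes> (?i \<otimes> (?i \<otimes> snd a)) = ?i \<otimes> snd a"
      using Units_r_inv[OF a(3)] ac ic by (simp add: m_assoc[symmetric])
    then have "a \<otimes>\<^bsub>dual_numbers R\<^esub> ?b = \<one>\<^bsub>dual_numbers R\<^esub>"
      using ac ic Units_r_inv[OF a(3)] by (simp add: r_minus l_neg m_comm)
    then have "a \<otimes>\<^bsub>dual_numbers R\<^esub> ?b \<in> G" using GE(3) by (simp only:)
    moreover have "?b \<in> carrier (dual_numbers R)" using ac ic by simp
    ultimately have "?b \<in> G'" using a(1,2) unfolding G'_def by blast
    then show ?thesis by force
  qed
  ultimately show ?thesis using incl unfolding derivation_graph_def by blast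
qed

text \<open>
  A maximal graph exists by Zorn's lemma. Its domain is closed under inverses by localization, and
  contains every \<open>t\<close>, because \<open>t\<close> can be adjoined whether it is transcendental or algebraic.
\<close>

theorem (in field) derivation_graph_extends:
  assumes G: "derivation_graph G" and ch: "char_zero"
  shows "\<exists>\<delta>. derivation \<delta> \<and> (\<forall>(a, b)\<in>G. \<delta> a = b)"
proof -
  interpret D: cring "dual_numbers R" by (rule dual_numbers_cring)
  define AA where "AA = {H. derivation_graph H \<and> G \<subseteq> H}"
  have "\<exists>M\<in>AA. \<forall>Xa\<in>AA. M \<subseteq> Xa \<longrightarrow> Xa = M"
  proof (rule subset_Zorn_nonempty)
    show "AA \<noteq> {}" using G unfolding AA_def by blast
    fix CC assume ne: "CC \<noteq> {}" and ch: "subset.chain AA CC"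
    have sub: "CC \<subseteq> AA" and cmp: "Xa \<subseteq> Y \<or> Y \<subseteq> Xa" if "Xa \<in> CC" "Y \<in> CC" for Xa Y
      using ch that unfolding subset_chain_def by auto
    have CA: "subring Xa (dual_numbers R)" "G \<subseteq> Xa" "\<And>w. (\<zero>, w) \<in> Xa \<Longrightarrow> w = \<zero>" if "Xa \<in> CC" for Xa
      using ch that unfolding subset_chain_def AA_def derivation_graph_def by auto
    have "subring (\<Union>CC) (dual_numbers R)"
    proof (rule D.subringI)
      show "\<Union>CC \<subseteq> carrier (dual_numbers R)" using CA(1) subringE(1) by blast
      show "\<one>\<^bsub>dual_numbers R\<^esub> \<in> \<Union>CC" using CA(1) subringE(3) ne by blast
      show "\<ominus>\<^bsub>dual_numbers R\<^esub> x \<in> \<Union>CC" if "x \<in> \<Union>CC" for x using that subringE(5)[OF CA(1)] by blast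
      fix x y assume "x \<in> \<Union>CC" "y \<in> \<Union>CC"
      then obtain Xa Y where "x \<in> Xa" "Xa \<in> CC" "y \<in> Y" "Y \<in> CC" by blast
      then obtain Z where Z: "Z \<in> CC" "x \<in> Z" "y \<in> Z" using cmp by blast
      show "x \<otimes>\<^bsub>dual_numbers R\<^esub> y \<in> \<Union>CC" using subringE(6)[OF CA(1)[OF Z(1)] Z(2,3)] Z(1) by blast
      show "x \<oplus>\<^bsub>dual_numbers R\<^esub> y \<in> \<Union>CC" using subringE(7)[OF CA(1)[OF Z(1)] Z(2,3)] Z(1) by blast
    qed
    then show "\<Union>CC \<in> AA" using CA ne unfolding AA_def derivation_graph_def by blast
  qed
  then obtain M where MA: "M \<in> AA" and MX: "\<forall>H\<in>AA. M \<subseteq> H \<longrightarrow> H = M" by (rule bexE)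
  have M: "derivation_graph M" "G \<subseteq> M" using MA unfolding AA_def by auto
  have max: "H = M" if "derivation_graph H" "M \<subseteq> H" for H
    using MX that M(2) unfolding AA_def by auto
  have s: "subring M (dual_numbers R)" using M by (simp add: derivation_graph_def)
  note ME = subringE[OF s]
  have Mc: "fst x \<in> carrier R" "snd x \<in> carrier R" if "x \<in> M" for x using ME(1) that by auto
  have inv: "inv a \<in> fst ` M" if "a \<in> fst ` M" "a \<noteq> \<zero>" for a
  proof -
    from that obtain x where x: "x \<in> M" "fst x = a" by blast
    then have "fst x \<in> Units R" using Mc that field_Units by auto
    then show ?thesis using derivation_graph_localize[OF M(1) x(1)] max x that by blast
  qed
  have full: "t \<in> fst ` M" if t: "t \<in> carrier R" for t
  proof -
    have "\<exists>v\<in>carrier R. derivation_graph (D.adjoin M (t, v))"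
      using derivation_graph_adjoin_algebraic[OF M(1) t ch inv]
        derivation_graph_adjoin_transcendental[OF M(1) t zero_closed] by blast
    then obtain v where v: "v \<in> carrier R" "derivation_graph (D.adjoin M (t, v))" by blast
    then have "D.adjoin M (t, v) = M" using max D.adjoin_base by blast
    then have "(t, v) \<in> M" using D.adjoin_gen[OF s, of "(t, v)"] t v by auto
    then show ?thesis by force
  qed
  define \<delta> where "\<delta> a = (SOME b. (a, b) \<in> M)" for a
  have \<delta>M: "(a, \<delta> a) \<in> M" if "a \<in> carrier R" for a
    unfolding \<delta>_def by (rule someI_ex) (use full[OF that] in force)
  have \<delta>u: "\<delta> a = b" if "(a, b) \<in> M" for a b
    using derivation_graph_unique[OF M(1) _ that] \<delta>M Mc[OF that] by simp
  have "derivation \<delta>"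
    unfolding derivation_def
  proof (intro conjI ballI)
    show "\<delta> x \<in> carrier R" if "x \<in> carrier R" for x using Mc(2)[OF \<delta>M[OF that]] by simp
    fix x y assume "x \<in> carrier R" "y \<in> carrier R"
    then show "\<delta> (x \<oplus> y) = \<delta> x \<oplus> \<delta> y" "\<delta> (x \<otimes> y) = x \<otimes> \<delta> y \<oplus> \<delta> x \<otimes> y"
      using \<delta>u ME(6,7)[OF \<delta>M \<delta>M, of x y] by auto
  qed
  then show ?thesis using \<delta>u M(2) by blast
qed

section \<open>Zeros of polynomials in one element\<close>

text \<open>
  Comparing \<open>f(2s)\<close> with \<open>2\<^sup>m f(s)\<close> eliminates the leading term and multiplies each lower coefficient by
  a nonzero number, which makes induction on the degree possible.
\<close>

lemma (in domain) poly_sum_all_zero: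
  assumes ch: "char_zero" and f: "\<And>i. f i \<in> carrier R"
    and z: "\<And>s. s \<in> carrier R \<Longrightarrow> poly_sum f s m = \<zero>" and i: "i \<le> m"
  shows "f i = \<zero>"
  using f z i
proof (induction m arbitrary: f i)
  case 0
  then show ?case using 0(2)[of \<zero>] by simp
next
  case (Suc m)
  define c where "c = [(2::nat)] \<cdot> \<one>"
  have c: "c \<in> carrier R" by (simp add: c_def)
  have cpow: "c [^] k = [(2 ^ k :: nat)] \<cdot> \<one>" for k :: nat
  proof (induction k)
    case (Suc k)
    have "([(2 ^ k :: nat)] \<cdot> \<one>) \<otimes> ([(2::nat)] \<cdot> \<one>) = [(2 * 2 ^ k :: nat)] \<cdot> \<one>"
      by (simp add: add_pow_ldistr add_pow_rdistr add.nat_pow_pow mult.commute)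
    then show ?case using Suc by (simp add: c_def)
  qed simp
  have fc: "f j \<otimes> c [^] k = [(2 ^ k :: nat)] \<cdot> f j" for j k
    using Suc.prems(1) by (simp add: cpow add_pow_rdistr)
  define e where "e = \<ominus> ([(2 ^ Suc m :: nat)] \<cdot> \<one>)"
  have e: "e \<in> carrier R" by (simp add: e_def)
  have ef: "e \<otimes> f j = \<ominus> ([(2 ^ Suc m :: nat)] \<cdot> f j)" for j
  proof -
    have "e \<otimes> f j = \<ominus> (([(2 ^ Suc m :: nat)] \<cdot> \<one>) \<otimes> f j)"
      unfolding e_def using Suc.prems(1) by (intro l_minus) auto
    then show ?thesis using Suc.prems(1) by (simp add: add_pow_ldistr del: power_Suc)
  qed
  let ?g = "\<lambda>j. f j \<otimes> c [^] j \<oplus> e \<otimes> f j"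
  have gc: "?g j \<in> carrier R" for j using Suc.prems(1) c e by simp
  have gz: "poly_sum ?g s (Suc m) = \<zero>" if s: "s \<in> carrier R" for s
  proof -
    have "poly_sum ?g s (Suc m) = poly_sum (\<lambda>j. f j \<otimes> c [^] j) s (Suc m) \<oplus> poly_sum (\<lambda>j. e \<otimes> f j) s (Suc m)"
      using Suc.prems(1) c e s by (intro poly_sum_add) auto
    also have "poly_sum (\<lambda>j. f j \<otimes> c [^] j) s (Suc m) = poly_sum f (c \<otimes> s) (Suc m)"
      using poly_sum_scale_arg[of f c s "Suc m"] Suc.prems(1) c s by simp
    also have "poly_sum (\<lambda>j. e \<otimes> f j) s (Suc m) = e \<otimes> poly_sum f s (Suc m)"
      using poly_sum_scale[of f e s "Suc m"] Suc.prems(1) e s by simp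
    finally show ?thesis using Suc.prems(2)[of s] Suc.prems(2)[of "c \<otimes> s"] s c e
      by (simp del: poly_sum.simps)
  qed
  \<comment> \<open>The coefficients of \<open>f(2s) - 2\<^sup>m\<^sup>+\<^sup>1 f(s)\<close> are \<open>(2\<^sup>j - 2\<^sup>m\<^sup>+\<^sup>1) f\<^sub>j\<close>.\<close>
  have gtop: "?g (Suc m) = \<zero>" using fc[of "Suc m" "Suc m"] ef[of "Suc m"] Suc.prems(1)
    by (simp add: r_neg del: nat_pow_Suc power_Suc)
  have "poly_sum ?g s m = \<zero>" if "s \<in> carrier R" for s
    using poly_sum_drop[of ?g s m] gc gtop gz[OF that] that by metis
  then have g0: "?g j = \<zero>" if "j \<le> m" for j using Suc.IH[of ?g j] gc that by blast
  have low: "f j = \<zero>" if j: "j \<le> m" for j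
  proof -
    have le: "(2::nat) ^ j < 2 ^ Suc m" using j by (intro power_strict_increasing) auto
    define k where "k = (2::nat) ^ Suc m - 2 ^ j"
    have k: "0 < k" "(2::nat) ^ Suc m = 2 ^ j + k" using le by (auto simp: k_def)
    have fj: "f j \<in> carrier R" by (rule Suc.prems)
    have "[(2 ^ j :: nat)] \<cdot> f j = [(2 ^ Suc m :: nat)] \<cdot> f j"
      using g0[OF j] unfolding fc ef using fj by (simp flip: minus_eq del: power_Suc)
    also have "\<dots> = [(2 ^ j :: nat)] \<cdot> f j \<oplus> [k] \<cdot> f j"
      unfolding k(2) using fj by (simp add: add.nat_pow_mult)
    finally have "[k] \<cdot> f j = \<zero>" using fj
      by (simp add: add.l_cancel_one' del: power_Suc)
    then show ?thesis using nat_mult_eq_zero[OF ch fj] k(1) by blast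
  qed
  have "poly_sum f \<one> (Suc m) = poly_sum (\<lambda>i. if i < Suc m then \<zero> else f (Suc m)) \<one> (Suc m + 0)"
    using low by (simp del: poly_sum.simps) (intro poly_sum_cong, auto simp: less_Suc_eq_le le_Suc_eq)
  also have "\<dots> = \<one> [^] Suc m \<otimes> poly_sum (\<lambda>i. f (Suc m)) \<one> 0"
    using poly_sum_shift[of "\<lambda>_. f (Suc m)" \<one> "Suc m" 0] Suc.prems(1) by simp
  finally have "f (Suc m) = \<zero>" using Suc.prems by (simp del: poly_sum.simps(2) nat_pow_Suc)
  then show ?case using low Suc.prems(3) by (metis le_Suc_eq)
qed

lemma (in cring) poly_sum_mult:
  assumes "\<And>i. a i \<in> carrier R" "\<And>i. b i \<in> carrier R"
  shows "\<exists>c. (\<forall>i. c i \<in> carrier R) \<and> c (m + n) = a m \<otimes> b n \<and>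
    (\<forall>s\<in>carrier R. poly_sum a s m \<otimes> poly_sum b s n = poly_sum c s (m + n))"
  using assms(1)
proof (induction m arbitrary: a)
  case 0
  show ?case using 0 assms(2) poly_sum_scale[of b "a 0" _ n]
    by (intro exI[of _ "\<lambda>i. a 0 \<otimes> b i"]) simp
next
  case (Suc m)
  obtain c where c: "\<And>i. c i \<in> carrier R" "c (m + n) = a (Suc m) \<otimes> b n"
    and cs: "\<And>s. s \<in> carrier R \<Longrightarrow> poly_sum (\<lambda>i. a (Suc i)) s m \<otimes> poly_sum b s n = poly_sum c s (m + n)"
    using Suc.IH[of "\<lambda>i. a (Suc i)"] Suc.prems by auto
  let ?p = "\<lambda>i. if i \<le> n then a 0 \<otimes> b i else \<zero>" and ?q = "\<lambda>i. if i < 1 then \<zero> else c (i - 1)"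
  have "poly_sum a s (Suc m) \<otimes> poly_sum b s n = poly_sum (\<lambda>i. ?p i \<oplus> ?q i) s (Suc m + n)" if s: "s \<in> carrier R" for s
  proof -
    have "poly_sum (\<lambda>i. ?p i \<oplus> ?q i) s (Suc m + n) = poly_sum ?p s (n + Suc m) \<oplus> poly_sum ?q s (1 + (m + n))"
      using s c Suc.prems assms by (subst poly_sum_add) (auto simp: add.commute)
    also have "poly_sum ?p s (n + Suc m) = a 0 \<otimes> poly_sum b s n"
      using poly_sum_pad[of "\<lambda>i. a 0 \<otimes> b i" s n "Suc m"] poly_sum_scale[of b "a 0" s n] s Suc.prems assms(2)
      by (simp del: poly_sum.simps)
    also have "poly_sum ?q s (1 + (m + n)) = s \<otimes> poly_sum c s (m + n)"
      using poly_sum_shift[of c s 1 "m + n"] c(1) s by (simp del: poly_sum.simps)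
    finally show ?thesis using cs[OF s] s Suc.prems assms(2) by (simp add: l_distr m_assoc)
  qed
  then show ?case using c Suc.prems assms(2)
    by (intro exI[of _ "\<lambda>i. ?p i \<oplus> ?q i"]) (simp del: poly_sum.simps)
qed

lemma (in cring) poly_sum_normalize:
  assumes "\<And>i. f i \<in> carrier R" "s0 \<in> carrier R" "poly_sum f s0 m \<noteq> \<zero>"
  shows "\<exists>k. f k \<noteq> \<zero> \<and> (\<forall>s\<in>carrier R. poly_sum f s m = poly_sum f s k)"
  using assms(3)
proof (induction m)
  case 0 then show ?case by (intro exI[of _ 0]) auto
next
  case (Suc m)
  show ?case
  proof (cases "f (Suc m) = \<zero>")
    case True
    then have "\<forall>s\<in>carrier R. poly_sum f s (Suc m) = poly_sum f s m" using poly_sum_drop assms by blast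
    then show ?thesis using Suc assms(2) by metis
  qed blast
qed

lemma (in domain) poly_sum_prod_nonzero:
  assumes ch: "char_zero" and a: "\<And>i. a i \<in> carrier R" and b: "\<And>i. b i \<in> carrier R"
    and s: "s1 \<in> carrier R" "poly_sum a s1 m \<noteq> \<zero>" "s2 \<in> carrier R" "poly_sum b s2 n \<noteq> \<zero>"
  shows "\<exists>s\<in>carrier R. poly_sum a s m \<noteq> \<zero> \<and> poly_sum b s n \<noteq> \<zero>"
proof -
  obtain k where k: "a k \<noteq> \<zero>" "\<forall>s\<in>carrier R. poly_sum a s m = poly_sum a s k" using poly_sum_normalize[of a, OF a s(1,2)] by blast
  obtain l where l: "b l \<noteq> \<zero>" "\<forall>s\<in>carrier R. poly_sum b s n = poly_sum b s l" using poly_sum_normalize[of b, OF b s(3,4)] by blast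
  obtain c where c: "\<forall>i. c i \<in> carrier R" "c (k + l) = a k \<otimes> b l"
    "\<forall>s\<in>carrier R. poly_sum a s k \<otimes> poly_sum b s l = poly_sum c s (k + l)" using poly_sum_mult[of a b k l] a b by blast
  have "c (k + l) \<noteq> \<zero>" using c(2) k(1) l(1) a b integral[of "a k" "b l"] by auto
  then obtain s where "s \<in> carrier R" "poly_sum c s (k + l) \<noteq> \<zero>" using poly_sum_all_zero[OF ch, of c "k + l" "k + l"] c(1) by blast
  then show ?thesis using c(3) k(2) l(2) a b by (metis l_null r_null poly_sum_closed)
qed

section \<open>Polynomial functions\<close>

definition (in ring) points :: "(nat \<Rightarrow> 'a) set" where
  "points = {w. \<forall>i. w i \<in> carrier R}"

text \<open>
  Polynomial functions in the coordinates with index in \<open>C\<close>, on points with infinitely many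
  coordinates. The last rule identifies functions that agree on all points over the field: the
  argument type contains further sequences, for which the ring laws may fail.
\<close>

inductive_set (in ring) poly_fun :: "nat set \<Rightarrow> ((nat \<Rightarrow> 'a) \<Rightarrow> 'a) set" for C where
  poly_fun_const: "a \<in> carrier R \<Longrightarrow> (\<lambda>_. a) \<in> poly_fun C"
| poly_fun_add: "\<lbrakk>f \<in> poly_fun C; g \<in> poly_fun C\<rbrakk> \<Longrightarrow> (\<lambda>w. f w \<oplus> g w) \<in> poly_fun C"
| poly_fun_var_mult: "\<lbrakk>f \<in> poly_fun C; i \<in> C\<rbrakk> \<Longrightarrow> (\<lambda>w. f w \<otimes> w i) \<in> poly_fun C"
| poly_fun_ext: "\<lbrakk>f \<in> poly_fun C; \<And>w. w \<in> points \<Longrightarrow> f w = g w\<rbrakk> \<Longrightarrow> g \<in> poly_fun C"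

context cring
begin

lemma points_upd: "\<lbrakk>w \<in> points; s \<in> carrier R\<rbrakk> \<Longrightarrow> w(i := s) \<in> points"
  by (simp add: points_def)

lemma poly_fun_closed: "f \<in> poly_fun C \<Longrightarrow> w \<in> points \<Longrightarrow> f w \<in> carrier R"
  by (induction rule: poly_fun.induct) (auto simp: points_def)

lemma poly_fun_mono: "f \<in> poly_fun C \<Longrightarrow> C \<subseteq> C' \<Longrightarrow> f \<in> poly_fun C'"
  by (induction rule: poly_fun.induct) (auto intro: poly_fun.intros)

lemma poly_fun_cong: "\<lbrakk>f \<in> poly_fun C; w \<in> points; w' \<in> points; \<And>i. i \<in> C \<Longrightarrow> w i = w' i\<rbrakk> \<Longrightarrow> f w = f w'"
proof (induction rule: poly_fun.induct)
  case (poly_fun_ext f g)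
  then show ?case by metis
qed auto

lemma poly_fun_const_mult:
  assumes "f \<in> poly_fun C" "c \<in> carrier R" shows "(\<lambda>w. c \<otimes> f w) \<in> poly_fun C"
  using assms(1)
proof (induction rule: poly_fun.induct)
  case (poly_fun_const a)
  then show ?case using assms(2) by (intro poly_fun.poly_fun_const) auto
next
  case (poly_fun_add f g)
  show ?case by (rule poly_fun.poly_fun_ext[OF poly_fun.poly_fun_add[OF poly_fun_add(3,4)]])
      (use poly_fun_add poly_fun_closed assms in \<open>simp add: r_distr\<close>)
next
  case (poly_fun_var_mult f i)
  show ?case by (rule poly_fun.poly_fun_ext[OF poly_fun.poly_fun_var_mult[OF poly_fun_var_mult(3,2)]])
      (use poly_fun_var_mult poly_fun_closed assms in \<open>simp add: m_assoc points_def\<close>)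
next
  case (poly_fun_ext f g)
  then show ?case using poly_fun.poly_fun_ext[OF poly_fun_ext(3)] by metis
qed

lemma poly_fun_mult:
  assumes "f \<in> poly_fun C" "g \<in> poly_fun C" shows "(\<lambda>w. f w \<otimes> g w) \<in> poly_fun C"
  using assms(2)
proof (induction rule: poly_fun.induct)
  case (poly_fun_const a)
  show ?case by (rule poly_fun.poly_fun_ext[OF poly_fun_const_mult[OF assms(1) poly_fun_const]])
    (use poly_fun_const poly_fun_closed assms in \<open>simp add: m_comm\<close>)
next
  case (poly_fun_add h g)
  show ?case by (rule poly_fun.poly_fun_ext[OF poly_fun.poly_fun_add[OF poly_fun_add(3,4)]])
      (use poly_fun_add poly_fun_closed assms in \<open>simp add: r_distr\<close>)
next
  case (poly_fun_var_mult h i)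
  show ?case by (rule poly_fun.poly_fun_ext[OF poly_fun.poly_fun_var_mult[OF poly_fun_var_mult(3,2)]])
      (use poly_fun_var_mult poly_fun_closed assms in \<open>simp add: m_assoc points_def\<close>)
next
  case (poly_fun_ext h g)
  show ?case by (rule poly_fun.poly_fun_ext[OF poly_fun_ext(3)]) (use poly_fun_ext(2) in simp)
qed

lemma poly_fun_var: "i \<in> C \<Longrightarrow> (\<lambda>w. w i) \<in> poly_fun C"
  by (rule poly_fun.poly_fun_ext[OF poly_fun.poly_fun_var_mult[OF poly_fun.poly_fun_const[OF one_closed]]]) (auto simp: points_def)

lemma poly_fun_subst:
  assumes "f \<in> poly_fun C" "\<And>i. h i \<in> poly_fun C'"
  shows "(\<lambda>w. f (\<lambda>i. h i w)) \<in> poly_fun C'"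
  using assms(1)
proof (induction rule: poly_fun.induct)
  case (poly_fun_ext f g)
  show ?case by (rule poly_fun.poly_fun_ext[OF poly_fun_ext(3)], rule poly_fun_ext(2)) (use poly_fun_closed[OF assms(2)] in \<open>auto simp: points_def\<close>)
next
  case (poly_fun_var_mult f i)
  show ?case by (rule poly_fun_mult[OF poly_fun_var_mult(3) assms(2)])
qed (auto intro: poly_fun.intros)

lemma poly_fun_poly_sum:
  assumes "\<And>i. a i \<in> poly_fun C" "h \<in> poly_fun C"
  shows "(\<lambda>w. poly_sum (\<lambda>i. a i w) (h w) m) \<in> poly_fun C"
  using assms(1)
proof (induction m arbitrary: a)
  case (Suc m)
  show ?case
    unfolding poly_sum.simps using Suc assms(2) by (intro poly_fun.poly_fun_add poly_fun_mult) auto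
qed simp

lemma poly_fun_decompose:
  assumes "g \<in> poly_fun (insert j B)"
  shows "\<exists>a m. (\<forall>i. a i \<in> poly_fun B) \<and> (\<forall>w\<in>points. g w = poly_sum (\<lambda>i. a i w) (w j) m)"
  using assms
proof (induction rule: poly_fun.induct)
  case (poly_fun_const a)
  then show ?case by (intro exI[of _ "\<lambda>_ _. a"] exI[of _ 0]) (auto intro: poly_fun.intros)
next
  case (poly_fun_add f g)
  from poly_fun_add(3) obtain a m where a: "\<And>i. a i \<in> poly_fun B" "\<And>w. w \<in> points \<Longrightarrow> f w = poly_sum (\<lambda>i. a i w) (w j) m" by auto
  from poly_fun_add(4) obtain b n where b: "\<And>i. b i \<in> poly_fun B" "\<And>w. w \<in> points \<Longrightarrow> g w = poly_sum (\<lambda>i. b i w) (w j) n" by auto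
  let ?c = "\<lambda>i w. (if i \<le> m then a i w else \<zero>) \<oplus> (if i \<le> n then b i w else \<zero>)"
  have "?c i \<in> poly_fun B" for i
    using a b by (cases "i \<le> m"; cases "i \<le> n") (auto intro!: poly_fun.poly_fun_add intro: poly_fun.poly_fun_const)
  moreover have "f w \<oplus> g w = poly_sum (\<lambda>i. ?c i w) (w j) (m + n)" if w: "w \<in> points" for w
  proof -
    have wj: "w j \<in> carrier R" using w by (simp add: points_def)
    have ac: "a i w \<in> carrier R" "b i w \<in> carrier R" for i using poly_fun_closed[OF a(1) w] poly_fun_closed[OF b(1) w] by auto
    show ?thesis
      using poly_sum_pad[of "\<lambda>i. a i w" "w j" m n] poly_sum_pad[of "\<lambda>i. b i w" "w j" n m] ac wj a(2)[OF w] b(2)[OF w]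
      by (subst poly_sum_add) (auto simp: add.commute)
  qed
  ultimately show ?case by (intro exI[of _ ?c] exI[of _ "m + n"]) blast
next
  case (poly_fun_var_mult f i)
  from poly_fun_var_mult(3) obtain a m where a: "\<And>i. a i \<in> poly_fun B" "\<And>w. w \<in> points \<Longrightarrow> f w = poly_sum (\<lambda>i. a i w) (w j) m" by auto
  have ac: "a i w \<in> carrier R" "w i \<in> carrier R" if w: "w \<in> points" for i w using poly_fun_closed[OF a(1) w] w by (auto simp: points_def)
  show ?case
  proof (cases "i = j")
    case True
    let ?c = "\<lambda>i w. if i < 1 then \<zero> else a (i - 1) w"
    have "?c i \<in> poly_fun B" for i using a by (cases "i < 1") (auto intro: poly_fun.poly_fun_const)
    moreover have "f w \<otimes> w i = poly_sum (\<lambda>i. ?c i w) (w j) (1 + m)" if w: "w \<in> points" for w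
      using poly_sum_shift[of "\<lambda>i. a i w" "w j" 1 m] ac[OF w] a(2)[OF w] True by (simp add: m_comm del: poly_sum.simps)
    ultimately show ?thesis by (intro exI[of _ ?c] exI[of _ "1 + m"]) blast
  next
    case False
    then have "i \<in> B" using poly_fun_var_mult by simp
    let ?c = "\<lambda>k w. w i \<otimes> a k w"
    have "?c k \<in> poly_fun B" for k using a \<open>i \<in> B\<close> by (intro poly_fun_mult poly_fun_var) auto
    moreover have "f w \<otimes> w i = poly_sum (\<lambda>k. ?c k w) (w j) m" if w: "w \<in> points" for w
      using poly_sum_scale[of "\<lambda>i. a i w" "w i" "w j" m] ac[OF w] a(2)[OF w] by (simp add: m_comm)
    ultimately show ?thesis by (intro exI[of _ ?c] exI[of _ m]) blast
  qed
next
  case (poly_fun_ext f g)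
  then show ?case by metis
qed

text \<open>
  The parameter of the line is treated as a coordinate, so that restriction to the line is a
  substitution.
\<close>

lemma poly_fun_on_line:
  assumes f: "f \<in> poly_fun C" and w: "w1 \<in> points" "w2 \<in> points"
  shows "\<exists>a m. (\<forall>i. a i \<in> carrier R) \<and>
    (\<forall>s\<in>carrier R. f (\<lambda>i. w1 i \<oplus> s \<otimes> w2 i) = poly_sum a s m)"
proof -
  let ?h = "\<lambda>i w. w1 i \<oplus> w (0::nat) \<otimes> w2 i"
  have "?h i \<in> poly_fun (insert 0 {})" for i
    using w by (intro poly_fun.poly_fun_add poly_fun_mult poly_fun_var poly_fun.poly_fun_const) (auto simp: points_def)
  then have "(\<lambda>w. f (\<lambda>i. ?h i w)) \<in> poly_fun (insert 0 {})" by (rule poly_fun_subst[OF f])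
  then obtain a m where a: "\<And>i. a i \<in> poly_fun {}" and
    am: "\<And>w. w \<in> points \<Longrightarrow> f (\<lambda>i. ?h i w) = poly_sum (\<lambda>i. a i w) (w 0) m"
    using poly_fun_decompose[of "\<lambda>w. f (\<lambda>i. ?h i w)" 0 "{}"] by auto
  let ?z = "\<lambda>_::nat. \<zero>"
  have z: "?z \<in> points" by (simp add: points_def)
  have "f (\<lambda>i. w1 i \<oplus> s \<otimes> w2 i) = poly_sum (\<lambda>i. a i ?z) s m" if "s \<in> carrier R" for s
  proof -
    have s: "(\<lambda>_::nat. s) \<in> points" using that by (simp add: points_def)
    have "a i (\<lambda>_. s) = a i ?z" for i by (rule poly_fun_cong[OF a s z]) simp
    then show ?thesis using am[OF s] by simp
  qed
  then show ?thesis using poly_fun_closed[OF a z] by (intro exI[of _ "\<lambda>i. a i ?z"] exI[of _ m]) blast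
qed

end

section \<open>Evaluation of indexed polynomials\<close>

text \<open>
  The monomial factor in the definition of \<open>mpoly_eval\<close>.
\<close>

definition (in ring) monomial_value :: "('c \<Rightarrow> 'a) \<Rightarrow> 'c multiset \<Rightarrow> 'a" where
  "monomial_value a \<mu> = (\<Otimes>i \<in> set_mset \<mu>. a i [^] count \<mu> i)"

context cring
begin

lemma monomial_value_closed [simp]: "(\<And>i. a i \<in> carrier R) \<Longrightarrow> monomial_value a \<mu> \<in> carrier R"
  by (simp add: monomial_value_def)

lemma monomial_value_empty [simp]: "monomial_value a {#} = \<one>"
  by (simp add: monomial_value_def)

lemma monomial_value_add_mset:
  assumes a: "\<And>i. a i \<in> carrier R"
  shows "monomial_value a (add_mset i \<mu>) = monomial_value a \<mu> \<otimes> a i"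
proof -
  let ?S = "set_mset \<mu> - {i}"
  have fin: "finite ?S" by simp
  have eq: "(\<Otimes>k\<in>?S. a k [^] count (add_mset i \<mu>) k) = (\<Otimes>k\<in>?S. a k [^] count \<mu> k)"
    by (rule finprod_cong') (use a in auto)
  have ins: "insert i ?S = set_mset (add_mset i \<mu>)" by auto
  have "monomial_value a (add_mset i \<mu>) = (\<Otimes>k\<in>insert i ?S. a k [^] count (add_mset i \<mu>) k)"
    unfolding monomial_value_def ins ..
  also have "\<dots> = a i [^] Suc (count \<mu> i) \<otimes> (\<Otimes>k\<in>?S. a k [^] count \<mu> k)"
    using a fin count_add_mset[of i \<mu> i] by (subst finprod_insert) (auto simp: eq simp del: count_add_mset nat_pow_Suc)
  also have "\<dots> = (a i [^] count \<mu> i \<otimes> (\<Otimes>k\<in>?S. a k [^] count \<mu> k)) \<otimes> a i"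
    using a by (simp add: m_ac)
  also have "a i [^] count \<mu> i \<otimes> (\<Otimes>k\<in>?S. a k [^] count \<mu> k) = monomial_value a \<mu>"
  proof (cases "i \<in># \<mu>")
    case True
    then have "monomial_value a \<mu> = (\<Otimes>k\<in>insert i ?S. a k [^] count \<mu> k)" by (simp add: monomial_value_def insert_absorb)
    then show ?thesis using a fin by (subst (asm) finprod_insert) auto
  next
    case False
    then have "count \<mu> i = 0" by (simp add: count_eq_zero_iff)
    then show ?thesis using False a by (simp add: monomial_value_def)
  qed
  finally show ?thesis .
qed

lemma mpoly_eval_superset:
  assumes "finite A" "{\<mu>. P \<mu> \<noteq> \<zero>} \<subseteq> A" "\<And>\<mu>. P \<mu> \<in> carrier R" "\<And>i. a i \<in> carrier R"
  shows "mpoly_eval P a = (\<Oplus>\<mu>\<in>A. P \<mu> \<otimes> monomial_value a \<mu>)"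
  unfolding mpoly_eval_def monomial_value_def[symmetric]
  by (rule add.finprod_mono_neutral_cong_left) (use assms in auto)

lemma indexed_pset_support:
  assumes "P \<in> indexed_pset I (carrier R)"
  shows "P \<mu> \<in> carrier R" "finite {\<mu>. P \<mu> \<noteq> \<zero>}" "P \<mu> \<noteq> \<zero> \<Longrightarrow> set_mset \<mu> \<subseteq> I"
proof -
  show "P \<mu> \<in> carrier R" using indexed_pset_in_carrier[OF subset_refl assms] by (simp add: carrier_coeff_def)
  show "finite {\<mu>. P \<mu> \<noteq> \<zero>}"
    using assms
  proof (induction rule: indexed_pset.induct)
    case (indexed_const k)
    show ?case by (rule finite_subset[of _ "{{#}}"]) (auto simp: indexed_const_def)
  next
    case (indexed_padd P Q)
    show ?case by (rule finite_subset[of _ "{\<mu>. P \<mu> \<noteq> \<zero>} \<union> {\<mu>. Q \<mu> \<noteq> \<zero>}"])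
        (use indexed_padd in \<open>auto simp: indexed_padd_def\<close>)
  next
    case (indexed_pmult P i)
    show ?case
    proof (rule finite_subset[of _ "add_mset i ` {\<mu>. P \<mu> \<noteq> \<zero>}"])
      show "{\<mu>. (P \<Otimes> i) \<mu> \<noteq> \<zero>} \<subseteq> add_mset i ` {\<mu>. P \<mu> \<noteq> \<zero>}"
        by (auto simp: indexed_pmult_def image_iff split: if_splits intro!: exI[of _ "_ - {#i#}"])
    qed (use indexed_pmult in simp)
  qed
  show "set_mset \<mu> \<subseteq> I" if "P \<mu> \<noteq> \<zero>"
    using assms that
  proof (induction arbitrary: \<mu> rule: indexed_pset.induct)
    case (indexed_const k)
    then show ?case by (auto simp: indexed_const_def split: if_splits)
  next
    case (indexed_padd P Q)
    then have "P \<mu> \<noteq> \<zero> \<or> Q \<mu> \<noteq> \<zero>" by (auto simp: indexed_padd_def)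
    then show ?case using indexed_padd by blast
  next
    case (indexed_pmult P i)
    then have i: "i \<in># \<mu>" "P (\<mu> - {#i#}) \<noteq> \<zero>" by (auto simp: indexed_pmult_def split: if_splits)
    then have "set_mset (\<mu> - {#i#}) \<subseteq> I" using indexed_pmult by blast
    then show ?case using indexed_pmult(2) i(1) by (metis insert_DiffM insert_subset set_mset_add_mset_insert)
  qed
qed

lemma mpoly_eval_cong:
  assumes P: "P \<in> indexed_pset I (carrier R)" and ab: "\<And>i. i \<in> I \<Longrightarrow> a i = b i" "\<And>i. i \<in> I \<Longrightarrow> a i \<in> carrier R"
  shows "mpoly_eval P a = mpoly_eval P b"
proof -
  have *: "(\<Otimes>i\<in>set_mset \<mu>. a i [^] count \<mu> i) = (\<Otimes>i\<in>set_mset \<mu>. b i [^] count \<mu> i)"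
    and **: "(\<Otimes>i\<in>set_mset \<mu>. b i [^] count \<mu> i) \<in> carrier R" if "P \<mu> \<noteq> \<zero>" for \<mu>
  proof -
    have s: "set_mset \<mu> \<subseteq> I" by (rule indexed_pset_support(3)[OF P that])
    show "(\<Otimes>i\<in>set_mset \<mu>. b i [^] count \<mu> i) \<in> carrier R"
      using s ab by (intro finprod_closed) (auto simp flip: ab(1))
    show "(\<Otimes>i\<in>set_mset \<mu>. a i [^] count \<mu> i) = (\<Otimes>i\<in>set_mset \<mu>. b i [^] count \<mu> i)"
      by (rule finprod_cong') (use s ab in \<open>auto simp flip: ab(1)\<close>)
  qed
  show ?thesis unfolding mpoly_eval_def
    by (rule finsum_cong') (use * ** indexed_pset_support(1)[OF P] in auto)
qed

lemma mpoly_eval_const: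
  assumes "k \<in> carrier R" "\<And>i. a i \<in> carrier R"
  shows "mpoly_eval (indexed_const k) a = k"
proof -
  have "mpoly_eval (indexed_const k) a = (\<Oplus>\<mu>\<in>{{#}}. indexed_const k \<mu> \<otimes> monomial_value a \<mu>)"
    by (rule mpoly_eval_superset) (use assms in \<open>auto simp: indexed_const_def\<close>)
  also have "\<dots> = k" using assms by (simp add: indexed_const_def)
  finally show ?thesis .
qed

lemma mpoly_eval_padd:
  assumes P: "P \<in> indexed_pset I (carrier R)" and Q: "Q \<in> indexed_pset I (carrier R)" and a: "\<And>i. a i \<in> carrier R"
  shows "mpoly_eval (P \<Oplus> Q) a = mpoly_eval P a \<oplus> mpoly_eval Q a"
proof -
  let ?A = "{\<mu>. P \<mu> \<noteq> \<zero>} \<union> {\<mu>. Q \<mu> \<noteq> \<zero>}"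
  note p = indexed_pset_support[OF P] and q = indexed_pset_support[OF Q]
  have fin: "finite ?A" using p(2) q(2) by simp
  have "mpoly_eval (P \<Oplus> Q) a = (\<Oplus>\<mu>\<in>?A. (P \<Oplus> Q) \<mu> \<otimes> monomial_value a \<mu>)"
    by (rule mpoly_eval_superset[OF fin]) (use a p(1) q(1) in \<open>auto simp: indexed_padd_def\<close>)
  also have "\<dots> = (\<Oplus>\<mu>\<in>?A. P \<mu> \<otimes> monomial_value a \<mu> \<oplus> Q \<mu> \<otimes> monomial_value a \<mu>)"
    by (rule finsum_cong') (use a p(1) q(1) in \<open>auto simp: indexed_padd_def l_distr\<close>)
  also have "\<dots> = (\<Oplus>\<mu>\<in>?A. P \<mu> \<otimes> monomial_value a \<mu>) \<oplus> (\<Oplus>\<mu>\<in>?A. Q \<mu> \<otimes> monomial_value a \<mu>)"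
    by (rule finsum_addf) (use a p(1) q(1) in auto)
  also have "(\<Oplus>\<mu>\<in>?A. P \<mu> \<otimes> monomial_value a \<mu>) = mpoly_eval P a"
    by (rule mpoly_eval_superset[symmetric, OF fin]) (use a p(1) in auto)
  also have "(\<Oplus>\<mu>\<in>?A. Q \<mu> \<otimes> monomial_value a \<mu>) = mpoly_eval Q a"
    by (rule mpoly_eval_superset[symmetric, OF fin]) (use a q(1) in auto)
  finally show ?thesis .
qed

lemma mpoly_eval_pmult:
  assumes P: "P \<in> indexed_pset I (carrier R)" and a: "\<And>i. a i \<in> carrier R"
  shows "mpoly_eval (P \<Otimes> i) a = mpoly_eval P a \<otimes> a i"
proof -
  let ?A = "{\<mu>. P \<mu> \<noteq> \<zero>}"
  note p = indexed_pset_support[OF P]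
  have "mpoly_eval (P \<Otimes> i) a = (\<Oplus>\<mu>\<in>add_mset i ` ?A. (P \<Otimes> i) \<mu> \<otimes> monomial_value a \<mu>)"
  proof (rule mpoly_eval_superset)
    show "{\<mu>. (P \<Otimes> i) \<mu> \<noteq> \<zero>} \<subseteq> add_mset i ` {\<mu>. P \<mu> \<noteq> \<zero>}"
      by (auto simp: indexed_pmult_def image_iff split: if_splits intro!: exI[of _ "_ - {#i#}"])
  qed (use a p(1,2) in \<open>auto simp: indexed_pmult_def\<close>)
  also have "\<dots> = (\<Oplus>\<mu>\<in>?A. (P \<Otimes> i) (add_mset i \<mu>) \<otimes> monomial_value a (add_mset i \<mu>))"
    by (rule finsum_reindex) (use a p(1) in \<open>auto simp: indexed_pmult_def inj_on_def\<close>)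
  also have "\<dots> = (\<Oplus>\<mu>\<in>?A. (P \<mu> \<otimes> monomial_value a \<mu>) \<otimes> a i)"
    by (rule finsum_cong') (use a p(1) in \<open>auto simp: indexed_pmult_def monomial_value_add_mset m_assoc\<close>)
  also have "\<dots> = (\<Oplus>\<mu>\<in>?A. P \<mu> \<otimes> monomial_value a \<mu>) \<otimes> a i"
    by (rule finsum_ldistr[symmetric]) (use a p in auto)
  also have "(\<Oplus>\<mu>\<in>?A. P \<mu> \<otimes> monomial_value a \<mu>) = mpoly_eval P a"
    by (rule mpoly_eval_superset[symmetric]) (use a p in auto)
  finally show ?thesis .
qed

lemma mpoly_eval_closed:
  assumes P: "P \<in> indexed_pset I (carrier R)" and a: "\<And>i. a i \<in> carrier R"
  shows "mpoly_eval P a \<in> carrier R"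
  using P by (induction rule: indexed_pset.induct)
    (use a in \<open>simp_all add: mpoly_eval_const mpoly_eval_padd mpoly_eval_pmult\<close>)

end

lemma ring_hom_indexed:
  assumes "ring R" "ring S" "h \<in> ring_hom R S"
  shows "k \<in> carrier R \<Longrightarrow> h \<circ> ring.indexed_const R k = ring.indexed_const S (h k)"
    and "\<lbrakk>P \<in> ring.indexed_pset R I (carrier R); Q \<in> ring.indexed_pset R I (carrier R)\<rbrakk> \<Longrightarrow>
      h \<circ> ring.indexed_padd R P Q = ring.indexed_padd S (h \<circ> P) (h \<circ> Q)"
    and "h \<circ> ring.indexed_pmult R P i = ring.indexed_pmult S (h \<circ> P) i"
proof -
  interpret R: ring R by fact
  interpret S: ring S by fact
  have h0: "h \<zero>\<^bsub>R\<^esub> = \<zero>\<^bsub>S\<^esub>" using ring_hom_zero[OF assms(3,1,2)] .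
  show "h \<circ> R.indexed_const k = S.indexed_const (h k)" if "k \<in> carrier R"
    using that h0 by (auto simp: R.indexed_const_def S.indexed_const_def)
  show "h \<circ> R.indexed_padd P Q = S.indexed_padd (h \<circ> P) (h \<circ> Q)"
    if "P \<in> R.indexed_pset I (carrier R)" "Q \<in> R.indexed_pset I (carrier R)"
    using R.indexed_pset_in_carrier[OF subset_refl that(1)] R.indexed_pset_in_carrier[OF subset_refl that(2)]
      ring_hom_add[OF assms(3)]
    by (auto simp: R.indexed_padd_def S.indexed_padd_def R.carrier_coeff_def)
  show "h \<circ> R.indexed_pmult P i = S.indexed_pmult (h \<circ> P) i"
    using h0 by (auto simp: R.indexed_pmult_def S.indexed_pmult_def)
qed

lemma ring_hom_indexed_pset:
  assumes "ring R" "ring S" "h \<in> ring_hom R S" "P \<in> ring.indexed_pset R I (carrier R)"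
  shows "h \<circ> P \<in> ring.indexed_pset S I (carrier S)"
proof -
  interpret R: ring R by fact
  interpret S: ring S by fact
  show ?thesis using assms(4)
  proof (induction rule: R.indexed_pset.induct)
    case (indexed_const k)
    show ?case unfolding ring_hom_indexed(1)[OF assms(1-3) indexed_const]
      using ring_hom_closed[OF assms(3) indexed_const] by (rule S.indexed_pset.indexed_const)
  next
    case (indexed_padd P Q)
    show ?case unfolding ring_hom_indexed(2)[OF assms(1-3) indexed_padd(1,2)]
      using indexed_padd(3,4) by (rule S.indexed_pset.indexed_padd)
  next
    case (indexed_pmult P i)
    show ?case unfolding ring_hom_indexed(3)[OF assms(1-3)]
      using indexed_pmult(3,2) by (rule S.indexed_pset.indexed_pmult)
  qed
qed

lemma ring_hom_mpoly_eval:
  assumes "cring R" "cring S" "h \<in> ring_hom R S" "P \<in> ring.indexed_pset R I (carrier R)"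
    and "\<And>i. i \<in> I \<Longrightarrow> a i \<in> carrier R"
  shows "h (ring.mpoly_eval R P a) = ring.mpoly_eval S (h \<circ> P) (\<lambda>i. h (a i))"
proof -
  interpret R: cring R by fact
  interpret S: cring S by fact
  note r = R.ring_axioms S.ring_axioms assms(3)
  define b where "b = (\<lambda>i. if i \<in> I then a i else \<zero>\<^bsub>R\<^esub>)"
  have b: "b i \<in> carrier R" for i using assms(5) by (simp add: b_def)
  have hb: "h (b i) \<in> carrier S" for i using b ring_hom_closed[OF assms(3)] by blast
  have "h (R.mpoly_eval P b) = S.mpoly_eval (h \<circ> P) (\<lambda>i. h (b i))"
    using assms(4)
  proof (induction rule: R.indexed_pset.induct)
    case (indexed_const k)
    then show ?case using ring_hom_closed[OF assms(3)] b hb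
      by (simp add: ring_hom_indexed(1)[OF r] R.mpoly_eval_const S.mpoly_eval_const)
  next
    case (indexed_padd P Q)
    have "h \<circ> P \<in> S.indexed_pset I (carrier S)" "h \<circ> Q \<in> S.indexed_pset I (carrier S)"
      using ring_hom_indexed_pset[OF r] indexed_padd by auto
    then show ?case using indexed_padd b hb R.mpoly_eval_closed[OF indexed_padd(1) b] R.mpoly_eval_closed[OF indexed_padd(2) b] ring_hom_add[OF assms(3)]
      by (simp add: ring_hom_indexed(2)[OF r indexed_padd(1,2)] R.mpoly_eval_padd[of P I Q] S.mpoly_eval_padd[of _ I] del: o_apply)
  next
    case (indexed_pmult P i)
    have "h \<circ> P \<in> S.indexed_pset I (carrier S)"
      using ring_hom_indexed_pset[OF r] indexed_pmult by auto
    then show ?case using indexed_pmult b hb R.mpoly_eval_closed[OF indexed_pmult(1) b] ring_hom_mult[OF assms(3)]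
      by (simp add: ring_hom_indexed(3)[OF r] R.mpoly_eval_pmult[of P I] S.mpoly_eval_pmult[of _ I] del: o_apply)
  qed
  moreover have "R.mpoly_eval P b = R.mpoly_eval P a"
    by (rule R.mpoly_eval_cong[OF assms(4)]) (use assms(5) in \<open>auto simp: b_def\<close>)
  moreover have "S.mpoly_eval (h \<circ> P) (\<lambda>i. h (b i)) = S.mpoly_eval (h \<circ> P) (\<lambda>i. h (a i))"
    by (rule S.mpoly_eval_cong[OF ring_hom_indexed_pset[OF r assms(4)]])
      (use assms(5) ring_hom_closed[OF assms(3)] in \<open>auto simp: b_def\<close>)
  ultimately show ?thesis by simp
qed

lemma (in cring) mpoly_eval_poly_fun:
  assumes "P \<in> indexed_pset I (carrier R)"
  shows "mpoly_eval P \<in> poly_fun I"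
  using assms
proof (induction rule: indexed_pset.induct)
  case (indexed_const k)
  show ?case by (rule poly_fun.poly_fun_ext[OF poly_fun.poly_fun_const[OF indexed_const]])
     (use indexed_const in \<open>simp add: mpoly_eval_const points_def\<close>)
next
  case (indexed_padd P Q)
  show ?case by (rule poly_fun.poly_fun_ext[OF poly_fun.poly_fun_add[OF indexed_padd(3,4)]])
     (use indexed_padd in \<open>simp add: mpoly_eval_padd points_def\<close>)
next
  case (indexed_pmult P i)
  show ?case by (rule poly_fun.poly_fun_ext[OF poly_fun.poly_fun_var_mult[OF indexed_pmult(3,2)]])
     (use indexed_pmult in \<open>simp add: mpoly_eval_pmult points_def\<close>)
qed

lemma (in cring) poly_fun_mpoly_eval:
  assumes "f \<in> poly_fun I"
  shows "\<exists>P\<in>indexed_pset I (carrier R). \<forall>w\<in>points. mpoly_eval P w = f w"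
  using assms
proof (induction rule: poly_fun.induct)
  case (poly_fun_const a)
  then show ?case by (intro bexI[of _ "indexed_const a"])
    (auto simp: mpoly_eval_const points_def intro: indexed_pset.intros)
next
  case (poly_fun_add f g)
  then obtain P Q where P: "P \<in> indexed_pset I (carrier R)" "\<forall>w\<in>points. mpoly_eval P w = f w"
    and Q: "Q \<in> indexed_pset I (carrier R)" "\<forall>w\<in>points. mpoly_eval Q w = g w" by blast
  have "P \<Oplus> Q \<in> indexed_pset I (carrier R)" using P Q by (auto intro: indexed_pset.intros)
  moreover have "\<forall>w\<in>points. mpoly_eval (P \<Oplus> Q) w = f w \<oplus> g w"
    using P Q by (auto simp: mpoly_eval_padd[of P I Q] points_def)
  ultimately show ?case by blast
next
  case (poly_fun_var_mult f i)
  then obtain P where P: "P \<in> indexed_pset I (carrier R)" "\<forall>w\<in>points. mpoly_eval P w = f w" by blast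
  have "P \<Otimes> i \<in> indexed_pset I (carrier R)" using P poly_fun_var_mult by (auto intro: indexed_pset.intros)
  moreover have "\<forall>w\<in>points. mpoly_eval (P \<Otimes> i) w = f w \<otimes> w i"
    using P by (auto simp: mpoly_eval_pmult[of P I] points_def)
  ultimately show ?case by blast
next
  case (poly_fun_ext f g)
  then show ?case by metis
qed

section \<open>Derivations of a field\<close>

context cring
begin

lemma derivation_closed: "\<lbrakk>derivation \<delta>; x \<in> carrier R\<rbrakk> \<Longrightarrow> \<delta> x \<in> carrier R"
  and derivation_add: "\<lbrakk>derivation \<delta>; x \<in> carrier R; y \<in> carrier R\<rbrakk> \<Longrightarrow> \<delta> (x \<oplus> y) = \<delta> x \<oplus> \<delta> y"
  and derivation_mult: "\<lbrakk>derivation \<delta>; x \<in> carrier R; y \<in> carrier R\<rbrakk> \<Longrightarrow> \<delta> (x \<otimes> y) = x \<otimes> \<delta> y \<oplus> \<delta> x \<otimes> y"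
  by (auto simp: derivation_def)

lemma derivation_zero: assumes "derivation \<delta>" shows "\<delta> \<zero> = \<zero>"
proof -
  have "\<delta> \<zero> = \<delta> \<zero> \<oplus> \<delta> \<zero>" using derivation_add[OF assms zero_closed zero_closed] by simp
  then show ?thesis using derivation_closed[OF assms zero_closed] by simp
qed

text \<open>
  If \<open>f\<close> has constant coefficients, only the chain rule term remains.
\<close>

lemma derivation_poly_sum:
  assumes d: "derivation \<delta>" and f: "\<And>i. f i \<in> carrier R" "\<And>i. \<delta> (f i) = \<zero>" and t: "t \<in> carrier R"
  shows "\<delta> (poly_sum f t m) = poly_deriv_sum f t m \<otimes> \<delta> t"
  using f
proof (induction m arbitrary: f)
  case 0
  then show ?case using derivation_closed[OF d t] by simp
next
  case (Suc m)
  have "\<delta> (poly_sum f t (Suc m)) = t \<otimes> (poly_deriv_sum (\<lambda>i. f (Suc i)) t m \<otimes> \<delta> t) \<oplus> \<delta> t \<otimes> poly_sum (\<lambda>i. f (Suc i)) t m"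
    using Suc t derivation_closed[OF d t] by (simp add: derivation_add[OF d] derivation_mult[OF d])
  then show ?case using Suc.prems t derivation_closed[OF d t]
    by (simp add: l_distr r_distr m_ac a_ac)
qed

lemma partial_derivation_graph:
  assumes A: "subring A R" and d: "\<And>x. x \<in> A \<Longrightarrow> d x \<in> carrier R"
    and add: "\<And>x y. \<lbrakk>x \<in> A; y \<in> A\<rbrakk> \<Longrightarrow> d (x \<oplus> y) = d x \<oplus> d y"
    and mult: "\<And>x y. \<lbrakk>x \<in> A; y \<in> A\<rbrakk> \<Longrightarrow> d (x \<otimes> y) = x \<otimes> d y \<oplus> d x \<otimes> y"
  shows "derivation_graph ((\<lambda>x. (x, d x)) ` A)"
proof -
  interpret D: cring "dual_numbers R" by (rule dual_numbers_cring)
  note E = subringE[OF A]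
  have Ac: "x \<in> carrier R" if "x \<in> A" for x using E(1) that by auto
  have d0: "d \<zero> = \<zero>"
    using add[OF E(2,2)] d[OF E(2)] by simp
  have d1: "d \<one> = \<zero>"
    using mult[OF E(3,3)] d[OF E(3)] by simp
  have neg: "d (\<ominus> x) = \<ominus> d x" if "x \<in> A" for x
  proof -
    have "d (\<ominus> x) \<oplus> d x = \<zero>"
      using add[OF E(5)[OF that] that] Ac[OF that] d0 by (simp add: l_neg)
    then show ?thesis using minus_equality d[OF that] d[OF E(5)[OF that]] by metis
  qed
  have "subring ((\<lambda>x. (x, d x)) ` A) (dual_numbers R)"
  proof (rule D.subringI)
    show "\<one>\<^bsub>dual_numbers R\<^esub> \<in> (\<lambda>x. (x, d x)) ` A" using E(3) d1 by auto
    show "\<ominus>\<^bsub>dual_numbers R\<^esub> h \<in> (\<lambda>x. (x, d x)) ` A" if "h \<in> (\<lambda>x. (x, d x)) ` A" for h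
    proof -
      from that obtain x where x: "x \<in> A" "h = (x, d x)" by auto
      then have "\<ominus>\<^bsub>dual_numbers R\<^esub> h = (\<ominus> x, d (\<ominus> x))" using dual_numbers_minus[of h] Ac d neg by simp
      then show ?thesis using E(5)[OF x(1)] by auto
    qed
    fix h1 h2 assume "h1 \<in> (\<lambda>x. (x, d x)) ` A" "h2 \<in> (\<lambda>x. (x, d x)) ` A"
    then obtain x y where xy: "x \<in> A" "y \<in> A" "h1 = (x, d x)" "h2 = (y, d y)" by auto
    then have "h1 \<otimes>\<^bsub>dual_numbers R\<^esub> h2 = (x \<otimes> y, d (x \<otimes> y))" "h1 \<oplus>\<^bsub>dual_numbers R\<^esub> h2 = (x \<oplus> y, d (x \<oplus> y))"
      using add mult by simp_all
    then show "h1 \<otimes>\<^bsub>dual_numbers R\<^esub> h2 \<in> (\<lambda>x. (x, d x)) ` A" "h1 \<oplus>\<^bsub>dual_numbers R\<^esub> h2 \<in> (\<lambda>x. (x, d x)) ` A"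
      using E(6,7)[OF xy(1,2)] by auto
  qed (use Ac d in auto)
  then show ?thesis using d0 by (auto simp: derivation_graph_def)
qed

end

context field
begin

text \<open>
  Differentiating a minimal relation \<open>p(t) = 0\<close> gives \<open>p'(t) \<delta>(t) = 0\<close>, where \<open>p'(t) \<noteq> 0\<close>. Together with the
  next lemmas this makes algebraic dependence a matter of linear algebra over the derivations.
\<close>

lemma derivation_kills_algebraic:
  assumes d: "derivation \<delta>" and A: "subring A R" "\<And>x. x \<in> A \<Longrightarrow> \<delta> x = \<zero>"
    and t: "t \<in> carrier R" "\<not> transcendental_over A t" and ch: "char_zero"
  shows "\<delta> t = \<zero>"
proof -
  obtain p d where p: "\<And>i. p i \<in> A" "poly_sum p t (Suc d) = \<zero>" "poly_deriv_sum p t (Suc d) \<noteq> \<zero>"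
    by (rule not_transcendental_separable[OF A(1) t(1) ch t(2)]) (rule that; simp only:)
  have pc: "p i \<in> carrier R" for i using p(1) subringE(1)[OF A(1)] by blast
  have "\<delta> (poly_sum p t (Suc d)) = poly_deriv_sum p t (Suc d) \<otimes> \<delta> t"
    by (rule derivation_poly_sum[OF d pc _ t(1)]) (use p A in auto)
  then have eq: "poly_deriv_sum p t (Suc d) \<otimes> \<delta> t = \<zero>"
    unfolding p(2) using derivation_zero[OF d] by (rule trans[OF sym])
  have "poly_deriv_sum p t (Suc d) \<in> carrier R" by (rule poly_deriv_sum_closed[OF pc t(1)])
  from integral[OF eq this derivation_closed[OF d t(1)]] show ?thesis using p(3) by (simp only: simp_thms)
qed

lemma derivation_extend:
  assumes ch: "char_zero" and A: "subring A R" and d: "\<And>x. x \<in> A \<Longrightarrow> d x \<in> carrier R"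
    and add: "\<And>x y. \<lbrakk>x \<in> A; y \<in> A\<rbrakk> \<Longrightarrow> d (x \<oplus> y) = d x \<oplus> d y"
    and mult: "\<And>x y. \<lbrakk>x \<in> A; y \<in> A\<rbrakk> \<Longrightarrow> d (x \<otimes> y) = x \<otimes> d y \<oplus> d x \<otimes> y"
  shows "\<exists>\<delta>. derivation \<delta> \<and> (\<forall>x\<in>A. \<delta> x = d x)"
  using derivation_graph_extends[OF partial_derivation_graph[OF A d add mult] ch] by auto

lemma derivation_prescribe:
  assumes ch: "char_zero" and A: "subring A R" and d: "derivation d"
    and t: "t \<in> carrier R" "transcendental_over A t" and v: "v \<in> carrier R"
  shows "\<exists>\<delta>. derivation \<delta> \<and> (\<forall>x\<in>A. \<delta> x = d x) \<and> \<delta> t = v"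
proof -
  interpret D: cring "dual_numbers R" by (rule dual_numbers_cring)
  let ?G = "(\<lambda>x. (x, d x)) ` A"
  have Ac: "x \<in> carrier R" if "x \<in> A" for x using subringE(1)[OF A] that by auto
  have G: "derivation_graph ?G"
    by (rule partial_derivation_graph[OF A])
      (use Ac derivation_closed[OF d] derivation_add[OF d] derivation_mult[OF d] in auto)
  have "fst ` ?G = A" by (auto simp: image_image)
  then have H: "derivation_graph (D.adjoin ?G (t, v))"
    using derivation_graph_adjoin_transcendental[OF G t(1) v] t(2) by simp
  obtain \<delta> where \<delta>: "derivation \<delta>" "\<forall>(a, b)\<in>D.adjoin ?G (t, v). \<delta> a = b"
    using derivation_graph_extends[OF H ch] by blast
  have "(t, v) \<in> D.adjoin ?G (t, v)"
    using G t v by (intro D.adjoin_gen) (auto simp: derivation_graph_def)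
  moreover have "?G \<subseteq> D.adjoin ?G (t, v)" by (rule D.adjoin_base)
  ultimately show ?thesis using \<delta> by (intro exI[of _ \<delta>]) auto
qed

end

section \<open>Generic points\<close>

text \<open>
  A field \<open>L\<close> containing a generic point of \<open>W\<close>: polynomial functions have values in \<open>L\<close>, and these values
  satisfy exactly the relations that hold on all of \<open>W\<close>. The points of \<open>W\<close> have infinitely many
  coordinates; if \<open>W\<close> is the cylinder over a variety in \<open>m\<close>-space, the coordinates with index at least
  \<open>m\<close> provide independent transcendental elements.
\<close>

locale generic_point = R?: field R + L: field L for R :: "('a, 'm) ring_scheme" (structure) and L :: "('l, 'n) ring_scheme" (structure) +
  fixes W :: "(nat \<Rightarrow> 'a) set" and \<Phi> :: "((nat \<Rightarrow> 'a) \<Rightarrow> 'a) \<Rightarrow> 'l"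
  assumes W_points: "W \<subseteq> points" and ch: "char_zero"
    and \<Phi>_closed: "f \<in> poly_fun UNIV \<Longrightarrow> \<Phi> f \<in> carrier L"
    and \<Phi>_add: "\<lbrakk>f \<in> poly_fun UNIV; g \<in> poly_fun UNIV\<rbrakk> \<Longrightarrow> \<Phi> (\<lambda>w. f w \<oplus> g w) = \<Phi> f \<oplus>\<^bsub>L\<^esub> \<Phi> g"
    and \<Phi>_mult: "\<lbrakk>f \<in> poly_fun UNIV; g \<in> poly_fun UNIV\<rbrakk> \<Longrightarrow> \<Phi> (\<lambda>w. f w \<otimes> g w) = \<Phi> f \<otimes>\<^bsub>L\<^esub> \<Phi> g"
    and \<Phi>_one: "\<Phi> (\<lambda>_. \<one>) = \<one>\<^bsub>L\<^esub>"
    and \<Phi>_zero_iff: "f \<in> poly_fun UNIV \<Longrightarrow> \<Phi> f = \<zero>\<^bsub>L\<^esub> \<longleftrightarrow> (\<forall>w\<in>W. f w = \<zero>)"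
begin

definition \<kappa> where "\<kappa> a = \<Phi> (\<lambda>_. a)"
definition \<xi> where "\<xi> i = \<Phi> (\<lambda>w. w i)"

lemma poly_fun_UNIV: "f \<in> poly_fun C \<Longrightarrow> f \<in> poly_fun UNIV" by (erule poly_fun_mono) simp

lemma \<kappa>_closed: "a \<in> carrier R \<Longrightarrow> \<kappa> a \<in> carrier L"
  unfolding \<kappa>_def by (intro \<Phi>_closed poly_fun.poly_fun_const)

lemma \<kappa>_hom: "\<kappa> \<in> ring_hom R L"
proof (rule ring_hom_memI)
  fix x y assume "x \<in> carrier R" "y \<in> carrier R"
  then have "(\<lambda>_. x) \<in> poly_fun UNIV" "(\<lambda>_. y) \<in> poly_fun UNIV" by (auto intro: poly_fun.poly_fun_const)
  then show "\<kappa> (x \<oplus> y) = \<kappa> x \<oplus>\<^bsub>L\<^esub> \<kappa> y" "\<kappa> (x \<otimes> y) = \<kappa> x \<otimes>\<^bsub>L\<^esub> \<kappa> y"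
    unfolding \<kappa>_def by (simp_all flip: \<Phi>_add \<Phi>_mult)
next
  show "\<kappa> \<one> = \<one>\<^bsub>L\<^esub>" by (simp add: \<kappa>_def \<Phi>_one)
qed (rule \<kappa>_closed)

lemma \<xi>_closed: "\<xi> i \<in> carrier L"
  unfolding \<xi>_def by (intro \<Phi>_closed poly_fun_var) simp

lemma \<Phi>_minus: "f \<in> poly_fun UNIV \<Longrightarrow> (\<lambda>w. \<ominus> \<one> \<otimes> f w) \<in> poly_fun UNIV \<and> \<Phi> (\<lambda>w. \<ominus> \<one> \<otimes> f w) = \<ominus>\<^bsub>L\<^esub> \<Phi> f"
proof -
  assume f: "f \<in> poly_fun UNIV"
  have m: "(\<lambda>w. \<ominus> \<one> \<otimes> f w) \<in> poly_fun UNIV" using f by (intro poly_fun_const_mult) auto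
  have s: "(\<lambda>w. \<ominus> \<one> \<otimes> f w \<oplus> f w) \<in> poly_fun UNIV" using m f by (rule poly_fun.poly_fun_add)
  have "\<Phi> (\<lambda>w. \<ominus> \<one> \<otimes> f w \<oplus> f w) = \<zero>\<^bsub>L\<^esub>"
    unfolding \<Phi>_zero_iff[OF s] using W_points poly_fun_closed[OF f] by (auto simp: l_minus l_neg)
  then have "\<Phi> (\<lambda>w. \<ominus> \<one> \<otimes> f w) \<oplus>\<^bsub>L\<^esub> \<Phi> f = \<zero>\<^bsub>L\<^esub>" using \<Phi>_add[OF m f] by simp
  then have "\<Phi> (\<lambda>w. \<ominus> \<one> \<otimes> f w) = \<ominus>\<^bsub>L\<^esub> \<Phi> f" using L.minus_equality \<Phi>_closed m f by metis
  then show ?thesis using m by blast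
qed

lemma \<Phi>_eq_iff:
  assumes f: "f \<in> poly_fun UNIV" and g: "g \<in> poly_fun UNIV"
  shows "\<Phi> f = \<Phi> g \<longleftrightarrow> (\<forall>w\<in>W. f w = g w)"
proof -
  let ?h = "\<lambda>w. f w \<oplus> \<ominus> \<one> \<otimes> g w"
  note m = \<Phi>_minus[OF g]
  have h: "?h \<in> poly_fun UNIV" using m f by (auto intro: poly_fun.poly_fun_add)
  have "\<Phi> ?h = \<Phi> f \<ominus>\<^bsub>L\<^esub> \<Phi> g" using \<Phi>_add[OF f, of "\<lambda>w. \<ominus> \<one> \<otimes> g w"] m by (simp add: L.minus_eq)
  then have "\<Phi> f = \<Phi> g \<longleftrightarrow> \<Phi> ?h = \<zero>\<^bsub>L\<^esub>" using \<Phi>_closed[OF f] \<Phi>_closed[OF g] by simp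
  also have "\<dots> \<longleftrightarrow> (\<forall>w\<in>W. f w = g w)"
    unfolding \<Phi>_zero_iff[OF h]
  proof (rule ball_cong[OF refl])
    fix w assume "w \<in> W"
    then have "f w \<in> carrier R" "g w \<in> carrier R" using poly_fun_closed[OF f] poly_fun_closed[OF g] W_points by blast+
    then show "?h w = \<zero> \<longleftrightarrow> f w = g w" by (simp add: l_minus flip: minus_eq)
  qed
  finally show ?thesis .
qed

lemma \<Phi>_cong: "\<lbrakk>f \<in> poly_fun UNIV; g \<in> poly_fun UNIV; \<And>w. w \<in> W \<Longrightarrow> f w = g w\<rbrakk> \<Longrightarrow> \<Phi> f = \<Phi> g"
  using \<Phi>_eq_iff by blast

lemma \<Phi>_poly_sum:
  assumes "\<And>i. a i \<in> poly_fun UNIV" "h \<in> poly_fun UNIV"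
  shows "\<Phi> (\<lambda>w. poly_sum (\<lambda>i. a i w) (h w) m) = L.poly_sum (\<lambda>i. \<Phi> (a i)) (\<Phi> h) m"
  using assms(1)
proof (induction m arbitrary: a)
  case 0 then show ?case by simp
next
  case (Suc m)
  have p: "(\<lambda>w. poly_sum (\<lambda>i. a (Suc i) w) (h w) m) \<in> poly_fun UNIV"
    using Suc.prems assms(2) by (intro poly_fun_poly_sum)
  show ?case
    using Suc.prems assms(2) p Suc.IH[of "\<lambda>i. a (Suc i)"]
    by (simp add: \<Phi>_add[OF Suc.prems poly_fun_mult[OF assms(2) p]] \<Phi>_mult)
qed

lemma subring_poly_fun: "subring (\<Phi> ` poly_fun C) L"
proof (rule L.subringI)
  show "\<Phi> ` poly_fun C \<subseteq> carrier L" using \<Phi>_closed poly_fun_UNIV by blast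
  show "\<one>\<^bsub>L\<^esub> \<in> \<Phi> ` poly_fun C" using \<Phi>_one poly_fun.poly_fun_const[OF one_closed] by (metis imageI)
  show "\<ominus>\<^bsub>L\<^esub> h \<in> \<Phi> ` poly_fun C" if "h \<in> \<Phi> ` poly_fun C" for h
  proof -
    from that obtain f where f: "f \<in> poly_fun C" "h = \<Phi> f" by blast
    have "(\<lambda>w. \<ominus> \<one> \<otimes> f w) \<in> poly_fun C" using f by (intro poly_fun_const_mult) auto
    then show ?thesis using \<Phi>_minus[OF poly_fun_UNIV[OF f(1)]] f(2) by (metis imageI)
  qed
  fix x y assume "x \<in> \<Phi> ` poly_fun C" "y \<in> \<Phi> ` poly_fun C"
  then obtain f g where fg: "f \<in> poly_fun C" "x = \<Phi> f" "g \<in> poly_fun C" "y = \<Phi> g" by blast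
  have "x \<otimes>\<^bsub>L\<^esub> y = \<Phi> (\<lambda>w. f w \<otimes> g w)" "x \<oplus>\<^bsub>L\<^esub> y = \<Phi> (\<lambda>w. f w \<oplus> g w)"
    using \<Phi>_mult[OF poly_fun_UNIV poly_fun_UNIV] \<Phi>_add[OF poly_fun_UNIV poly_fun_UNIV] fg by simp_all
  then show "x \<otimes>\<^bsub>L\<^esub> y \<in> \<Phi> ` poly_fun C" "x \<oplus>\<^bsub>L\<^esub> y \<in> \<Phi> ` poly_fun C"
    using poly_fun_mult[OF fg(1,3)] poly_fun.poly_fun_add[OF fg(1,3)] by auto
qed

lemma L_char_zero: "L.char_zero"
  unfolding L.char_zero_def
proof (intro allI impI notI)
  fix k :: nat assume k: "0 < k" "[k] \<cdot>\<^bsub>L\<^esub> \<one>\<^bsub>L\<^esub> = \<zero>\<^bsub>L\<^esub>"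
  have W: "W \<noteq> {}" using \<Phi>_zero_iff[OF poly_fun.poly_fun_const[OF one_closed]] \<Phi>_one L.one_not_zero by auto
  have "\<kappa> ([n] \<cdot> \<one>) = [n] \<cdot>\<^bsub>L\<^esub> \<one>\<^bsub>L\<^esub>" for n :: nat
    using ring_hom_zero[OF \<kappa>_hom R.ring_axioms L.ring_axioms] ring_hom_add[OF \<kappa>_hom] ring_hom_one[OF \<kappa>_hom]
    by (induction n) simp_all
  then have "\<Phi> (\<lambda>_. [k] \<cdot> \<one>) = \<zero>\<^bsub>L\<^esub>" using k by (simp add: \<kappa>_def)
  then have "[k] \<cdot> \<one> = \<zero>" using \<Phi>_zero_iff[of "\<lambda>_. [k] \<cdot> \<one>"] W by (auto intro: poly_fun.poly_fun_const)
  then show False using ch k(1) by (simp add: char_zero_def)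
qed

text \<open>
  A relation of the \<open>j\<close>-th coordinate over the others is a function that vanishes on \<open>W\<close>. If such functions
  keep vanishing when the \<open>j\<close>-th coordinate is changed at will, then all their coefficients
  vanish on \<open>W\<close>.
\<close>

lemma \<xi>_transcendental:
  assumes j: "j \<notin> C"
    and free: "\<And>g w s. \<lbrakk>g \<in> poly_fun (insert j C); \<And>w. w \<in> W \<Longrightarrow> g w = \<zero>; w \<in> W; s \<in> carrier R\<rbrakk> \<Longrightarrow> g (w(j := s)) = \<zero>"
  shows "L.transcendental_over (\<Phi> ` poly_fun C) (\<xi> j)"
  unfolding L.transcendental_over_def
proof (intro allI impI, elim conjE)
  fix f m i assume f: "\<forall>i. f i \<in> \<Phi> ` poly_fun C" "L.poly_sum f (\<xi> j) m = \<zero>\<^bsub>L\<^esub>" and i: "i \<le> m"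
  from f(1) have "\<exists>a. a \<in> poly_fun C \<and> \<Phi> a = f i" for i by (metis imageE)
  then obtain a where a: "\<And>i. a i \<in> poly_fun C" "\<And>i. \<Phi> (a i) = f i" by metis
  let ?g = "\<lambda>w. poly_sum (\<lambda>i. a i w) (w j) m"
  have g: "?g \<in> poly_fun (insert j C)"
    by (intro poly_fun_poly_sum poly_fun_var poly_fun_mono[OF a(1)]) auto
  have "\<Phi> ?g = \<zero>\<^bsub>L\<^esub>" using \<Phi>_poly_sum[of a "\<lambda>w. w j" m] poly_fun_UNIV[OF a(1)] poly_fun_var[of j UNIV] a(2) f(2)
    by (simp add: \<xi>_def)
  then have gz: "?g w = \<zero>" if "w \<in> W" for w using \<Phi>_zero_iff[OF poly_fun_UNIV[OF g]] that by blast
  have "a i w = \<zero>" if w: "w \<in> W" for w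
  proof (rule poly_sum_all_zero[OF ch _ _ i])
    have wp: "w \<in> points" using w W_points by blast
    show "a i w \<in> carrier R" for i by (rule poly_fun_closed[OF a(1) wp])
    fix s assume s: "s \<in> carrier R"
    have "?g (w(j := s)) = \<zero>" by (rule free[OF g gz w s])
    moreover have "a i (w(j := s)) = a i w" for i
      by (rule poly_fun_cong[OF a(1) points_upd[OF wp s] wp]) (use j in auto)
    ultimately show "poly_sum (\<lambda>i. a i w) s m = \<zero>" by simp
  qed
  then show "f i = \<zero>\<^bsub>L\<^esub>" using \<Phi>_zero_iff[OF poly_fun_UNIV[OF a(1)]] a(2) by metis
qed

lemma derivation_poly_fun_zero:
  assumes d: "L.derivation \<delta>" and k: "\<And>a. a \<in> carrier R \<Longrightarrow> \<delta> (\<kappa> a) = \<zero>\<^bsub>L\<^esub>"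
    and x: "\<And>j. j \<in> C \<Longrightarrow> \<delta> (\<xi> j) = \<zero>\<^bsub>L\<^esub>" and f: "f \<in> poly_fun C"
  shows "\<delta> (\<Phi> f) = \<zero>\<^bsub>L\<^esub>"
  using f
proof (induction rule: poly_fun.induct)
  case (poly_fun_const a)
  then show ?case using k by (simp add: \<kappa>_def)
next
  case (poly_fun_add f g)
  then show ?case using \<Phi>_add[OF poly_fun_UNIV poly_fun_UNIV, of f C g C] L.derivation_add[OF d] \<Phi>_closed poly_fun_UNIV by simp
next
  case (poly_fun_var_mult f i)
  have "\<Phi> (\<lambda>w. f w \<otimes> w i) = \<Phi> f \<otimes>\<^bsub>L\<^esub> \<xi> i"
    using \<Phi>_mult[OF poly_fun_UNIV[OF poly_fun_var_mult(1)] poly_fun_var[of i UNIV]] by (simp add: \<xi>_def)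
  then show ?case using L.derivation_mult[OF d] \<Phi>_closed[OF poly_fun_UNIV[OF poly_fun_var_mult(1)]] \<xi>_closed x poly_fun_var_mult by simp
next
  case (poly_fun_ext f g)
  have "\<Phi> g = \<Phi> f" using poly_fun_ext W_points by (intro \<Phi>_cong) (auto intro: poly_fun_UNIV poly_fun.poly_fun_ext)
  then show ?case using poly_fun_ext by simp
qed

end

section \<open>Algebraically independent coordinates\<close>

text \<open>
  Algebraic independence of the coordinates with index in \<open>B\<close> on the closure of \<open>W\<close>.
\<close>

definition (in ring) alg_indep :: "nat set \<Rightarrow> (nat \<Rightarrow> 'a) set \<Rightarrow> bool" where
  "alg_indep B W \<longleftrightarrow> (\<forall>g\<in>poly_fun B. (\<forall>w\<in>W. g w = \<zero>) \<longrightarrow> (\<forall>w\<in>points. g w = \<zero>))"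

lemma (in cring) alg_indep_subset: "\<lbrakk>alg_indep B W; B' \<subseteq> B\<rbrakk> \<Longrightarrow> alg_indep B' W"
  unfolding alg_indep_def using poly_fun_mono by blast

text \<open>
  The dimension drops when passing to a proper closed subset \<open>W'\<close> of an irreducible \<open>W\<close>, here in the
  form that an independent set of coordinates on \<open>W'\<close> can be enlarged on \<open>W\<close>. Otherwise all coordinates in
  \<open>I\<close> are algebraic over those in \<open>B\<close> at the generic point of \<open>W\<close>; a derivation that kills the latter
  kills everything, so the function \<open>f\<close> that vanishes on \<open>W'\<close> but not on \<open>W\<close> is algebraic as well.
  The constant term of its minimal relation is not zero, but it must vanish on \<open>W'\<close>, where \<open>f\<close> does,
  contrary to the independence of \<open>B\<close> on \<open>W'\<close>.
\<close>

lemma (in generic_point) alg_indep_insert: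
  assumes W': "W' \<subseteq> W" and ind: "alg_indep B W'" and B: "B \<subseteq> I"
    and f: "f \<in> poly_fun I" "\<And>w. w \<in> W' \<Longrightarrow> f w = \<zero>" "\<exists>w\<in>W. f w \<noteq> \<zero>"
  shows "\<exists>j\<in>I - B. alg_indep (insert j B) W"
proof (rule ccontr)
  assume neg: "\<not> ?thesis"
  let ?A = "\<Phi> ` poly_fun B" and ?t = "\<Phi> f"
  have t: "?t \<in> carrier L" "?t \<noteq> \<zero>\<^bsub>L\<^esub>" using \<Phi>_closed \<Phi>_zero_iff poly_fun_UNIV[OF f(1)] f(3) by auto
  \<comment> \<open>Dependence of \<open>B\<close> and \<open>j\<close> on \<open>W\<close> yields a relation for the \<open>j\<close>-th coordinate. It is nontrivial because
    some coefficient is not identically zero, hence does not vanish on \<open>W'\<close> by independence of \<open>B\<close>.\<close>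
  have dep: "\<not> L.transcendental_over ?A (\<xi> j)" if j: "j \<in> I - B" for j
  proof
    assume tr: "L.transcendental_over ?A (\<xi> j)"
    obtain g w0 where g: "g \<in> poly_fun (insert j B)" "\<forall>w\<in>W. g w = \<zero>" and w0: "w0 \<in> points" "g w0 \<noteq> \<zero>"
      using neg j unfolding alg_indep_def by blast
    obtain a m where a: "\<And>i. a i \<in> poly_fun B" "\<And>w. w \<in> points \<Longrightarrow> g w = poly_sum (\<lambda>i. a i w) (w j) m"
      using poly_fun_decompose[OF g(1)] by blast
    have "\<exists>i\<le>m. a i w0 \<noteq> \<zero>"
    proof (rule ccontr)
      assume "\<not> ?thesis"
      then have "poly_sum (\<lambda>i. a i w0) (w0 j) m = poly_sum (\<lambda>_. \<zero>) (w0 j) m" by (intro poly_sum_cong) auto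
      then show False using a(2)[OF w0(1)] w0 poly_sum_zero[of "w0 j" m] by (auto simp: points_def)
    qed
    then obtain i where i: "i \<le> m" "a i w0 \<noteq> \<zero>" by blast
    then obtain w where w: "w \<in> W'" "a i w \<noteq> \<zero>" using ind a(1) w0 unfolding alg_indep_def by blast
    then have nz: "\<Phi> (a i) \<noteq> \<zero>\<^bsub>L\<^esub>" using \<Phi>_zero_iff[OF poly_fun_UNIV[OF a(1)]] W' by blast
    have pp: "(\<lambda>w. poly_sum (\<lambda>i. a i w) (w j) m) \<in> poly_fun UNIV"
      by (intro poly_fun_poly_sum poly_fun_var poly_fun_UNIV[OF a(1)]) simp
    have "L.poly_sum (\<lambda>i. \<Phi> (a i)) (\<xi> j) m = \<Phi> (\<lambda>w. poly_sum (\<lambda>i. a i w) (w j) m)"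
      using \<Phi>_poly_sum[of a "\<lambda>w. w j" m] poly_fun_UNIV[OF a(1)] poly_fun_var[of j UNIV] by (simp add: \<xi>_def)
    also have "\<dots> = \<zero>\<^bsub>L\<^esub>"
    proof -
      have "poly_sum (\<lambda>i. a i w) (w j) m = \<zero>" if "w \<in> W" for w
      using a(2)[of w] g(2) W_points that by (metis subsetD)
      then show ?thesis using \<Phi>_zero_iff[OF pp] by blast
    qed
    finally have z: "L.poly_sum (\<lambda>i. \<Phi> (a i)) (\<xi> j) m = \<zero>\<^bsub>L\<^esub>" .
    have "\<forall>i. \<Phi> (a i) \<in> ?A" using a(1) by simp
    with z i(1) nz tr show False unfolding L.transcendental_over_def by metis
  qed
  have nt: "\<not> L.transcendental_over ?A ?t"
  proof
    assume tr: "L.transcendental_over ?A ?t"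
    have d0: "L.derivation (\<lambda>_. \<zero>\<^bsub>L\<^esub>)" by (simp add: L.derivation_def)
    obtain \<delta> where \<delta>: "L.derivation \<delta>" "\<forall>x\<in>?A. \<delta> x = \<zero>\<^bsub>L\<^esub>" "\<delta> ?t = \<one>\<^bsub>L\<^esub>"
      using L.derivation_prescribe[OF L_char_zero subring_poly_fun d0 t(1) tr L.one_closed] by blast
    have "\<delta> ?t = \<zero>\<^bsub>L\<^esub>"
    proof (rule derivation_poly_fun_zero[OF \<delta>(1) _ _ f(1)])
      show "\<delta> (\<kappa> a) = \<zero>\<^bsub>L\<^esub>" if "a \<in> carrier R" for a
        using \<delta>(2) poly_fun.poly_fun_const[OF that] by (simp add: \<kappa>_def)
      show "\<delta> (\<xi> j) = \<zero>\<^bsub>L\<^esub>" if "j \<in> I" for j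
      proof (cases "j \<in> B")
        case True
        then show ?thesis using \<delta>(2) poly_fun_var by (simp add: \<xi>_def)
      next
        case False
        then show ?thesis using \<delta>(2) that
          by (intro L.derivation_kills_algebraic[OF \<delta>(1) subring_poly_fun _ \<xi>_closed dep L_char_zero]) auto
      qed
    qed
    then show False using \<delta>(3) by simp
  qed
  show False
  proof (rule L.not_transcendental_separable[OF subring_poly_fun t(1) L_char_zero nt])
    fix p d
    assume p: "\<And>i. p i \<in> ?A" "p (Suc d) \<noteq> \<zero>\<^bsub>L\<^esub>" "L.poly_sum p ?t (Suc d) = \<zero>\<^bsub>L\<^esub>"
      and min: "\<And>g m i. \<lbrakk>m \<le> d; \<And>i. g i \<in> ?A; L.poly_sum g ?t m = \<zero>\<^bsub>L\<^esub>; i \<le> m\<rbrakk> \<Longrightarrow> g i = \<zero>\<^bsub>L\<^esub>"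
    have pc: "p i \<in> carrier L" for i using p(1) subringE(1)[OF subring_poly_fun] by blast
    \<comment> \<open>Otherwise the relation could be divided by \<open>f\<close>.\<close>
    have p0: "p 0 \<noteq> \<zero>\<^bsub>L\<^esub>"
    proof
      assume z: "p 0 = \<zero>\<^bsub>L\<^esub>"
      have q: "L.poly_sum (\<lambda>i. p (Suc i)) ?t d \<in> carrier L" using pc t by auto
      have "?t \<otimes>\<^bsub>L\<^esub> L.poly_sum (\<lambda>i. p (Suc i)) ?t d = \<zero>\<^bsub>L\<^esub>" using p(3) z q t by simp
      then have "L.poly_sum (\<lambda>i. p (Suc i)) ?t d = \<zero>\<^bsub>L\<^esub>" using L.integral[OF _ t(1) q] t(2) by blast
      then show False using min[OF le_refl p(1) _ le_refl] p(2) by blast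
    qed
    have "\<exists>a. a \<in> poly_fun B \<and> \<Phi> a = p i" for i using p(1)[of i] by (metis imageE)
    then obtain a where a: "\<And>i. a i \<in> poly_fun B" "\<And>i. \<Phi> (a i) = p i" by metis
    have pp: "(\<lambda>w. poly_sum (\<lambda>i. a i w) (f w) (Suc d)) \<in> poly_fun UNIV"
      using poly_fun_UNIV[OF a(1)] poly_fun_UNIV[OF f(1)] by (intro poly_fun_poly_sum)
    have "\<Phi> (\<lambda>w. poly_sum (\<lambda>i. a i w) (f w) (Suc d)) = \<zero>\<^bsub>L\<^esub>"
      using \<Phi>_poly_sum[of a f "Suc d"] poly_fun_UNIV[OF a(1)] poly_fun_UNIV[OF f(1)] a(2) p(3) by (simp del: poly_sum.simps L.poly_sum.simps)
    then have v: "poly_sum (\<lambda>i. a i w) (f w) (Suc d) = \<zero>" if "w \<in> W" for w using \<Phi>_zero_iff[OF pp] that by blast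
    have "a 0 w = \<zero>" if w: "w \<in> W'" for w
    proof -
      have wp: "w \<in> points" using w W' W_points by blast
      have c: "a i w \<in> carrier R" for i using poly_fun_closed[OF a(1) wp] .
      have "poly_sum (\<lambda>i. a i w) \<zero> (Suc d) = \<zero>" using v[of w] f(2)[OF w] w W' by auto
      then show ?thesis using c by simp
    qed
    then have "\<forall>w\<in>points. a 0 w = \<zero>" using ind a(1) unfolding alg_indep_def by blast
    then have "\<Phi> (a 0) = \<zero>\<^bsub>L\<^esub>" using \<Phi>_zero_iff[OF poly_fun_UNIV[OF a(1)]] W_points by blast
    then show False using p0 a(2) by simp
  qed
qed

section \<open>Cylinders over varieties\<close>

text \<open>
  Varieties are lifted to a space with infinitely many coordinates. Polynomial functions need no
  dimension there, and a generic point comes with independent transcendental elements.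
\<close>

definition (in ring) cylinder :: "nat \<Rightarrow> 'a list set \<Rightarrow> (nat \<Rightarrow> 'a) set" where
  "cylinder m Z = {w \<in> points. map w [0..<m] \<in> Z}"

definition (in ring) ext_pt :: "nat \<Rightarrow> 'a list \<Rightarrow> nat \<Rightarrow> 'a" where
  "ext_pt m p = (\<lambda>i. if i < m then p ! i else \<zero>)"

context cring
begin

lemma cylinder_points: "cylinder m Z \<subseteq> points" by (auto simp: cylinder_def)

lemma ext_pt_points: "p \<in> affine_space m \<Longrightarrow> ext_pt m p \<in> points"
  by (auto simp: ext_pt_def affine_space_def points_def subset_iff)

lemma map_ext_pt: "p \<in> affine_space m \<Longrightarrow> map (ext_pt m p) [0..<m] = p"
  by (auto simp: ext_pt_def affine_space_def intro!: nth_equalityI)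

lemma ext_pt_cylinder: "\<lbrakk>p \<in> Z; p \<in> affine_space m\<rbrakk> \<Longrightarrow> ext_pt m p \<in> cylinder m Z"
  by (simp add: cylinder_def ext_pt_points map_ext_pt)

lemma cylinder_mono: "Z \<subseteq> Z' \<Longrightarrow> cylinder m Z \<subseteq> cylinder m Z'"
  by (auto simp: cylinder_def)

lemma cylinder_upd: "\<lbrakk>w \<in> cylinder m Z; u \<in> points; \<And>i. i < m \<Longrightarrow> u i = w i\<rbrakk> \<Longrightarrow> u \<in> cylinder m Z"
proof -
  assume w: "w \<in> cylinder m Z" and u: "u \<in> points" and eq: "\<And>i. i < m \<Longrightarrow> u i = w i"
  have "map u [0..<m] = map w [0..<m]" using eq by simp
  then show ?thesis using w u unfolding cylinder_def by (simp only: mem_Collect_eq)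
qed

lemma map_points_affine: "w \<in> points \<Longrightarrow> map w [0..<m] \<in> affine_space m"
  by (auto simp: affine_space_def points_def)

lemma poly_fun_ext_pt: "\<lbrakk>f \<in> poly_fun {..<m}; w \<in> points\<rbrakk> \<Longrightarrow> f (ext_pt m (map w [0..<m])) = f w"
  by (rule poly_fun_cong) (auto simp: ext_pt_points map_points_affine, simp add: ext_pt_def)

lemma mpoly_eval_nth:
  assumes "P \<in> indexed_pset {..<m} (carrier R)" "w \<in> points"
  shows "mpoly_eval P (\<lambda>i. map w [0..<m] ! i) = mpoly_eval P w"
  by (rule mpoly_eval_cong[OF assms(1)]) (use assms(2) in \<open>auto simp: points_def\<close>)

lemma mpoly_eval_ext_pt:
  assumes "P \<in> indexed_pset {..<m} (carrier R)" "p \<in> affine_space m"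
  shows "mpoly_eval P (\<lambda>i. p ! i) = mpoly_eval P (ext_pt m p)"
  by (rule mpoly_eval_cong[OF assms(1)]) (use assms(2) in \<open>auto simp: ext_pt_def affine_space_def subset_iff\<close>)

lemma zariski_closed_affine: "zariski_closed m Z \<Longrightarrow> Z \<subseteq> affine_space m"
  by (auto simp: zariski_closed_def zero_locus_def)

lemma zariski_closed_poly_fun:
  assumes "f \<in> poly_fun {..<m}"
  shows "zariski_closed m {p \<in> affine_space m. f (ext_pt m p) = \<zero>}"
proof -
  obtain P where P: "P \<in> indexed_pset {..<m} (carrier R)" "\<forall>w\<in>points. mpoly_eval P w = f w"
    using poly_fun_mpoly_eval[OF assms] by blast
  have "{p \<in> affine_space m. f (ext_pt m p) = \<zero>} = zero_locus m {P}"
    using P(2) mpoly_eval_ext_pt[OF P(1)] ext_pt_points by (auto simp: zero_locus_def)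
  then show ?thesis using P(1) unfolding zariski_closed_def by blast
qed

lemma zariski_closed_separates:
  assumes "zariski_closed m Z" "w \<in> points" "w \<notin> cylinder m Z"
  shows "\<exists>f\<in>poly_fun {..<m}. f w \<noteq> \<zero> \<and> (\<forall>u\<in>cylinder m Z. f u = \<zero>)"
proof -
  obtain S where S: "S \<subseteq> indexed_pset {..<m} (carrier R)" "Z = zero_locus m S"
    using assms(1) unfolding zariski_closed_def by blast
  have "map w [0..<m] \<notin> Z" using assms(2,3) by (simp add: cylinder_def)
  then obtain P where P: "P \<in> S" "mpoly_eval P (\<lambda>i. map w [0..<m] ! i) \<noteq> \<zero>"
    using map_points_affine[OF assms(2), of m] unfolding S(2) zero_locus_def by blast
  have P': "P \<in> indexed_pset {..<m} (carrier R)" using P S by blast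
  show ?thesis
  proof (rule bexI[OF _ mpoly_eval_poly_fun[OF P']], intro conjI ballI)
    show "mpoly_eval P w \<noteq> \<zero>" using P(2) mpoly_eval_nth[OF P' assms(2)] by simp
    fix u assume u: "u \<in> cylinder m Z"
    then have "u \<in> points" "map u [0..<m] \<in> zero_locus m S" by (auto simp: cylinder_def S(2))
    then show "mpoly_eval P u = \<zero>" using P(1) mpoly_eval_nth[OF P' \<open>u \<in> points\<close>] by (simp add: zero_locus_def)
  qed
qed

lemma irreducible_affine: "irreducible_variety m Z \<Longrightarrow> Z \<subseteq> affine_space m"
  unfolding irreducible_variety_def using zariski_closed_affine by blast

lemma irreducible_cylinder_nonempty: "irreducible_variety m Z \<Longrightarrow> cylinder m Z \<noteq> {}"
  using irreducible_affine[of m Z] ext_pt_cylinder[of _ Z m] unfolding irreducible_variety_def by blast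

text \<open>
  Irreducibility in terms of functions: the zero sets of \<open>f\<close> and \<open>g\<close> do not contain \<open>Z\<close>, so their
  union does not either.
\<close>

lemma irreducible_poly_fun:
  assumes Z: "irreducible_variety m Z" and f: "f \<in> poly_fun {..<m}" "w1 \<in> cylinder m Z" "f w1 \<noteq> \<zero>"
    and g: "g \<in> poly_fun {..<m}" "w2 \<in> cylinder m Z" "g w2 \<noteq> \<zero>"
  shows "\<exists>w\<in>cylinder m Z. f w \<noteq> \<zero> \<and> g w \<noteq> \<zero>"
proof (rule ccontr)
  assume neg: "\<not> ?thesis"
  let ?A = "\<lambda>f. {p \<in> affine_space m. f (ext_pt m p) = \<zero>}"
  have aff: "Z \<subseteq> affine_space m" by (rule irreducible_affine[OF Z])
  have "Z \<subseteq> ?A f \<union> ?A g"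
  proof
    fix p assume p: "p \<in> Z"
    then have "ext_pt m p \<in> cylinder m Z" using aff ext_pt_cylinder by blast
    then show "p \<in> ?A f \<union> ?A g" using neg p aff by blast
  qed
  then have "Z \<subseteq> ?A f \<or> Z \<subseteq> ?A g"
    using Z zariski_closed_poly_fun[OF f(1)] zariski_closed_poly_fun[OF g(1)] unfolding irreducible_variety_def by blast
  moreover have "h w = \<zero>" if "Z \<subseteq> ?A h" "h \<in> poly_fun {..<m}" "w \<in> cylinder m Z" for h w
    using that poly_fun_ext_pt[OF that(2), of w] by (auto simp: cylinder_def)
  ultimately show False using f g by blast
qed

end

text \<open>
  The product of an irreducible set with an affine space is irreducible. Fixing the additional
  coordinates as in \<open>w1\<close> for \<open>f\<close> and as in \<open>w2\<close> for \<open>g\<close>, a common point \<open>u\<close> of \<open>Z\<close> is found where neither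
  vanishes; on the line that joins the two points over \<open>u\<close>, both are nonzero polynomials in the
  parameter.
\<close>

lemma (in field) irreducible_cylinder_domain:
  assumes ch: "char_zero" and Z: "irreducible_variety m Z"
    and f: "f \<in> poly_fun UNIV" "w1 \<in> cylinder m Z" "f w1 \<noteq> \<zero>"
    and g: "g \<in> poly_fun UNIV" "w2 \<in> cylinder m Z" "g w2 \<noteq> \<zero>"
  shows "\<exists>w\<in>cylinder m Z. f w \<noteq> \<zero> \<and> g w \<noteq> \<zero>"
proof -
  have w12: "w1 \<in> points" "w2 \<in> points" using f g cylinder_points by blast+
  define merge where "merge u w = (\<lambda>i. if i < m then u i else w i)" for u w :: "nat \<Rightarrow> 'a"
  have mp: "merge u w \<in> points" if "u \<in> points" "w \<in> points" for u w using that by (simp add: merge_def points_def)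
  have pfm: "(\<lambda>u. h (merge u w)) \<in> poly_fun {..<m}" if "h \<in> poly_fun UNIV" "w \<in> points" for h w
  proof -
    have "(\<lambda>u. h (\<lambda>i. (if i < m then (\<lambda>u. u i) else (\<lambda>_. w i)) u)) \<in> poly_fun {..<m}"
      by (rule poly_fun_subst[OF that(1)]) (use that(2) in \<open>auto intro: poly_fun_var poly_fun.poly_fun_const simp: points_def\<close>)
    moreover have "(\<lambda>u. h (\<lambda>i. (if i < m then (\<lambda>u. u i) else (\<lambda>_. w i)) u)) = (\<lambda>u. h (merge u w))"
      by (rule ext, rule arg_cong[of _ _ h]) (auto simp: merge_def)
    ultimately show ?thesis by simp
  qed
  have mm: "merge w w = w" for w by (auto simp: merge_def)
  obtain u where u: "u \<in> cylinder m Z" "f (merge u w1) \<noteq> \<zero>" "g (merge u w2) \<noteq> \<zero>"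
    using irreducible_poly_fun[OF Z pfm[OF f(1) w12(1)] f(2) _ pfm[OF g(1) w12(2)] g(2)] f(3) g(3) mm by auto
  have up: "u \<in> points" using u cylinder_points by blast
  let ?q1 = "merge u w1" and ?q2 = "merge u w2"
  have qp: "?q1 \<in> points" "?q2 \<in> points" using mp up w12 by auto
  let ?d = "\<lambda>i. ?q2 i \<ominus> ?q1 i"
  have dp: "?d \<in> points" using qp by (simp add: points_def)
  let ?l = "\<lambda>s i. ?q1 i \<oplus> s \<otimes> ?d i"
  have qc: "?q1 i \<in> carrier R" "?q2 i \<in> carrier R" for i using qp by (auto simp: points_def)
  have l0: "?l \<zero> = ?q1" using qc by auto
  have l1: "?l \<one> = ?q2"
  proof
    fix i
    have "?q1 i \<oplus> (?q2 i \<oplus> \<ominus> ?q1 i) = ?q2 i" using qc[of i] by (metis a_lcomm a_inv_closed r_neg r_zero)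
    then show "?l \<one> i = ?q2 i" using qc[of i] by (simp add: minus_eq)
  qed
  obtain a M where a: "\<forall>i. a i \<in> carrier R" "\<forall>s\<in>carrier R. f (?l s) = poly_sum a s M" using poly_fun_on_line[OF f(1) qp(1) dp] by blast
  obtain b N where b: "\<forall>i. b i \<in> carrier R" "\<forall>s\<in>carrier R. g (?l s) = poly_sum b s N" using poly_fun_on_line[OF g(1) qp(1) dp] by blast
  have "poly_sum a \<zero> M \<noteq> \<zero>" using a(2) l0 u(2) by (metis zero_closed)
  moreover have "poly_sum b \<one> N \<noteq> \<zero>" using b(2) l1 u(3) by (metis one_closed)
  ultimately obtain s where s: "s \<in> carrier R" "poly_sum a s M \<noteq> \<zero>" "poly_sum b s N \<noteq> \<zero>"
    using poly_sum_prod_nonzero[OF ch, of a b \<zero> M \<one> N] a(1) b(1) by auto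
  have "?l s \<in> cylinder m Z"
  proof (rule cylinder_upd[OF u(1)])
    show "?l s \<in> points" using qc s(1) by (simp add: points_def)
    fix i assume "i < m"
    then show "?l s i = u i" using up s(1) by (simp add: merge_def points_def minus_eq r_neg)
  qed
  then show ?thesis using s a b by (intro bexI[of _ "?l s"]) auto
qed

section \<open>Existence of generic points\<close>

lemma (in cring) exists_maximalideal:
  assumes I: "ideal I R" and one: "\<one> \<notin> I"
  shows "\<exists>M. maximalideal M R \<and> I \<subseteq> M"
proof -
  define AA where "AA = {J. ideal J R \<and> I \<subseteq> J \<and> \<one> \<notin> J}"
  have "\<exists>M\<in>AA. \<forall>H\<in>AA. M \<subseteq> H \<longrightarrow> H = M"
  proof (rule subset_Zorn_nonempty)
    show "AA \<noteq> {}" using I one unfolding AA_def by blast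
    fix CC assume ne: "CC \<noteq> {}" and ch: "subset.chain AA CC"
    have cmp: "H \<subseteq> J \<or> J \<subseteq> H" if "H \<in> CC" "J \<in> CC" for H J
      using ch that unfolding subset_chain_def by auto
    have CA: "ideal H R" "I \<subseteq> H" "\<one> \<notin> H" if "H \<in> CC" for H
      using ch that unfolding subset_chain_def AA_def by auto
    have "ideal (\<Union>CC) R"
    proof (rule idealI)
      show "subgroup (\<Union>CC) (add_monoid R)"
      proof (rule add.subgroupI)
        show "\<Union>CC \<subseteq> carrier R" using ideal.Icarr[OF CA(1)] by blast
        show "\<Union>CC \<noteq> {}" using ne additive_subgroup.zero_closed[OF ideal.axioms(1)[OF CA(1)]] by blast
        show "\<ominus> x \<in> \<Union>CC" if "x \<in> \<Union>CC" for x
          using that additive_subgroup.a_inv_closed[OF ideal.axioms(1)[OF CA(1)]] by blast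
        fix x y assume "x \<in> \<Union>CC" "y \<in> \<Union>CC"
        then obtain H J where "x \<in> H" "H \<in> CC" "y \<in> J" "J \<in> CC" by blast
        then obtain K where K: "K \<in> CC" "x \<in> K" "y \<in> K" using cmp by blast
        then show "x \<oplus> y \<in> \<Union>CC"
          using additive_subgroup.a_closed[OF ideal.axioms(1)[OF CA(1)[OF K(1)]] K(2,3)] by blast
      qed
      show "x \<otimes> a \<in> \<Union>CC" if "a \<in> \<Union>CC" "x \<in> carrier R" for a x
        using that ideal.I_l_closed[OF CA(1)] by blast
      show "a \<otimes> x \<in> \<Union>CC" if "a \<in> \<Union>CC" "x \<in> carrier R" for a x
        using that ideal.I_r_closed[OF CA(1)] by blast
    qed (rule ring_axioms)
    then show "\<Union>CC \<in> AA" using CA ne unfolding AA_def by blast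
  qed
  then obtain M where MA: "M \<in> AA" and MX: "\<forall>H\<in>AA. M \<subseteq> H \<longrightarrow> H = M" by (rule bexE)
  have M: "ideal M R" "I \<subseteq> M" "\<one> \<notin> M" using MA unfolding AA_def by auto
  have "maximalideal M R"
  proof (rule maximalidealI[OF M(1)])
    show "carrier R \<noteq> M" using M(3) one_closed by blast
    fix J assume J: "ideal J R" "M \<subseteq> J" "J \<subseteq> carrier R"
    show "J = M \<or> J = carrier R"
    proof (cases "\<one> \<in> J")
      case True
      then show ?thesis using ideal.one_imp_carrier[OF J(1)] by blast
    next
      case False
      then show ?thesis using MX J M(2) unfolding AA_def by blast
    qed
  qed
  then show ?thesis using M(2) by blast
qed

definition function_ring :: "('a, 'm) ring_scheme \<Rightarrow> ('w \<Rightarrow> 'a) ring" where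
  "function_ring R = \<lparr>carrier = {f. \<forall>w. f w \<in> carrier R}, monoid.mult = (\<lambda>f g w. f w \<otimes>\<^bsub>R\<^esub> g w),
     one = (\<lambda>_. \<one>\<^bsub>R\<^esub>), zero = (\<lambda>_. \<zero>\<^bsub>R\<^esub>), add = (\<lambda>f g w. f w \<oplus>\<^bsub>R\<^esub> g w)\<rparr>"

lemma function_ring_simps [simp]:
  "f \<in> carrier (function_ring R) \<longleftrightarrow> (\<forall>w. f w \<in> carrier R)"
  "f \<otimes>\<^bsub>function_ring R\<^esub> g = (\<lambda>w. f w \<otimes>\<^bsub>R\<^esub> g w)"
  "\<one>\<^bsub>function_ring R\<^esub> = (\<lambda>_. \<one>\<^bsub>R\<^esub>)" "\<zero>\<^bsub>function_ring R\<^esub> = (\<lambda>_. \<zero>\<^bsub>R\<^esub>)"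
  "f \<oplus>\<^bsub>function_ring R\<^esub> g = (\<lambda>w. f w \<oplus>\<^bsub>R\<^esub> g w)"
  by (simp_all add: function_ring_def)

lemma (in cring) function_ring_cring: "cring (function_ring R)"
proof (rule cringI)
  show "abelian_group (function_ring R)"
  proof (rule abelian_groupI)
    fix f assume "f \<in> carrier (function_ring R)"
    then show "\<exists>g\<in>carrier (function_ring R). g \<oplus>\<^bsub>function_ring R\<^esub> f = \<zero>\<^bsub>function_ring R\<^esub>"
      by (intro bexI[of _ "\<lambda>w. \<ominus> f w"]) (auto simp: l_neg)
  qed (auto simp: a_ac)
  show "comm_monoid (function_ring R)"
    by (rule comm_monoidI) (auto simp: m_ac)
qed (auto simp: l_distr)

lemma (in cring) function_ring_minus: "f \<in> carrier (function_ring R) \<Longrightarrow> \<ominus>\<^bsub>function_ring R\<^esub> f = (\<lambda>w. \<ominus> f w)"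
proof -
  assume f: "f \<in> carrier (function_ring R)"
  interpret A: cring "function_ring R" by (rule function_ring_cring)
  show ?thesis by (rule A.minus_equality) (use f in \<open>auto simp: l_neg\<close>)
qed

text \<open>
  In the ring of all functions on the points, the functions that are annihilated on the cylinder by a
  polynomial function not vanishing identically on it form a proper ideal \<open>N\<close>. Modulo a
  maximal ideal that contains \<open>N\<close>, a polynomial function \<open>f\<close> not vanishing identically is
  invertible: if \<open>h\<close> is its inverse where it is not zero, then \<open>1 - h f\<close> is annihilated by \<open>f\<close>. This
  takes the place of the function field and avoids fractions.
\<close>

theorem (in field) generic_point_exists:
  assumes ch: "char_zero" and Z: "irreducible_variety m Z"
  shows "\<exists>(L :: ((nat \<Rightarrow> 'a) \<Rightarrow> 'a) set ring) \<Phi>. generic_point R L (cylinder m Z) \<Phi>"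
proof -
  interpret A: cring "function_ring R :: ((nat \<Rightarrow> 'a) \<Rightarrow> 'a) ring" by (rule function_ring_cring)
  let ?A = "function_ring R :: ((nat \<Rightarrow> 'a) \<Rightarrow> 'a) ring"
  let ?W = "cylinder m Z"
  have W: "?W \<subseteq> points" by (rule cylinder_points)
  obtain w0 where w0: "w0 \<in> ?W" using irreducible_cylinder_nonempty[OF Z] by blast
  define nz where "nz g \<longleftrightarrow> g \<in> poly_fun UNIV \<and> (\<exists>w\<in>?W. g w \<noteq> \<zero>)" for g
  have nz_mult: "nz (\<lambda>w. g w \<otimes> h w)" if gh: "nz g" "nz h" for g h
  proof -
    obtain w where w: "w \<in> ?W" "g w \<noteq> \<zero>" "h w \<noteq> \<zero>"
      using gh irreducible_cylinder_domain[OF ch Z] unfolding nz_def by blast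
    have p: "g \<in> poly_fun UNIV" "h \<in> poly_fun UNIV" using gh by (auto simp: nz_def)
    then have "g w \<in> carrier R" "h w \<in> carrier R" using poly_fun_closed w(1) W by blast+
    then have "g w \<otimes> h w \<noteq> \<zero>" using w integral by blast
    then show ?thesis using w(1) poly_fun_mult[OF p] unfolding nz_def by blast
  qed
  define N where "N = {f \<in> carrier ?A. \<exists>g. nz g \<and> (\<forall>w\<in>?W. g w \<otimes> f w = \<zero>)}"
  have gc: "g w \<in> carrier R" if "nz g" "w \<in> ?W" for g w using that poly_fun_closed W unfolding nz_def by blast
  have idN: "ideal N ?A"
  proof (rule idealI)
    show "subgroup N (add_monoid ?A)"
    proof (rule A.add.subgroupI)
      show "N \<subseteq> carrier ?A" by (auto simp: N_def)
      have "nz (\<lambda>_. \<one>)" using w0 by (auto simp: nz_def intro: poly_fun.poly_fun_const)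
      then have "(\<lambda>_. \<zero>) \<in> N" by (auto simp: N_def)
      then show "N \<noteq> {}" by blast
      show "\<ominus>\<^bsub>?A\<^esub> f \<in> N" if fN: "f \<in> N" for f
      proof -
        obtain g where g: "nz g" "\<forall>w\<in>?W. g w \<otimes> f w = \<zero>" and f: "f \<in> carrier ?A" using fN by (auto simp: N_def)
        have "\<forall>w\<in>?W. g w \<otimes> \<ominus> f w = \<zero>" using g gc f by (auto simp: r_minus)
        then show ?thesis unfolding function_ring_minus[OF f] using g(1) f by (auto simp: N_def)
      qed
      fix f1 f2 assume "f1 \<in> N" "f2 \<in> N"
      then obtain g1 g2 where g: "nz g1" "\<forall>w\<in>?W. g1 w \<otimes> f1 w = \<zero>" "f1 \<in> carrier ?A"
         "nz g2" "\<forall>w\<in>?W. g2 w \<otimes> f2 w = \<zero>" "f2 \<in> carrier ?A" by (auto simp: N_def)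
      have "(g1 w \<otimes> g2 w) \<otimes> (f1 w \<oplus> f2 w) = \<zero>" if w: "w \<in> ?W" for w
      proof -
        have c: "g1 w \<in> carrier R" "g2 w \<in> carrier R" "f1 w \<in> carrier R" "f2 w \<in> carrier R" using g gc w by auto
        have "(g1 w \<otimes> g2 w) \<otimes> (f1 w \<oplus> f2 w) = g2 w \<otimes> (g1 w \<otimes> f1 w) \<oplus> g1 w \<otimes> (g2 w \<otimes> f2 w)"
          using c by (simp add: r_distr m_ac)
        then show ?thesis using g(2,5) w c by simp
      qed
      then show "f1 \<oplus>\<^bsub>?A\<^esub> f2 \<in> N" using nz_mult[OF g(1,4)] g(3,6) by (auto simp: N_def)
    qed
    have mN: "(\<lambda>w. x w \<otimes> f w) \<in> N" if fN: "f \<in> N" and x: "x \<in> carrier ?A" for f x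
    proof -
      obtain g where g: "nz g" "\<forall>w\<in>?W. g w \<otimes> f w = \<zero>" and f: "f \<in> carrier ?A" using fN by (auto simp: N_def)
      have "g w \<otimes> (x w \<otimes> f w) = \<zero>" if w: "w \<in> ?W" for w
      proof -
        have "g w \<otimes> (x w \<otimes> f w) = x w \<otimes> (g w \<otimes> f w)" using gc[OF g(1) w] x f by (simp add: m_ac)
        then show ?thesis using g(2) w x by simp
      qed
      then show ?thesis using g(1) f x by (auto simp: N_def)
    qed
    show "x \<otimes>\<^bsub>?A\<^esub> f \<in> N" if "f \<in> N" "x \<in> carrier ?A" for f x using mN[OF that] by simp
    show "f \<otimes>\<^bsub>?A\<^esub> x \<in> N" if "f \<in> N" "x \<in> carrier ?A" for f x
    proof -
      have "f \<otimes>\<^bsub>?A\<^esub> x = (\<lambda>w. x w \<otimes> f w)" using that by (auto simp: m_comm N_def)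
      then show ?thesis using mN[OF that] by simp
    qed
  qed (rule A.ring_axioms)
  have "\<one>\<^bsub>?A\<^esub> \<notin> N"
  proof
    assume "\<one>\<^bsub>?A\<^esub> \<in> N"
    then obtain g where g: "nz g" "\<forall>w\<in>?W. g w \<otimes> \<one> = \<zero>" by (auto simp: N_def)
    then show False using gc by (auto simp: nz_def)
  qed
  then obtain M where M: "maximalideal M ?A" "N \<subseteq> M" using A.exists_maximalideal[OF idN] by blast
  interpret M: maximalideal M ?A by (rule M(1))
  let ?L = "?A Quot M"
  have L: "field ?L" by (rule M.quotient_is_field[OF A.is_cring])
  interpret L: field ?L by (rule L)
  \<comment> \<open>Polynomial functions have values outside of the field at sequences that are not points;
    composing with a retraction to the cylinder avoids these without disturbing ring operations.\<close>
  define \<rho> where "\<rho> w = (if w \<in> ?W then w else w0)" for w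
  have \<rho>W: "\<rho> w \<in> ?W" for w using w0 by (simp add: \<rho>_def)
  define \<Phi> where "\<Phi> f = M +>\<^bsub>?A\<^esub> (\<lambda>w. f (\<rho> w))" for f
  have fA: "(\<lambda>w. f (\<rho> w)) \<in> carrier ?A" if "f \<in> poly_fun UNIV" for f
    using poly_fun_closed[OF that] \<rho>W W by auto
  have "generic_point R ?L ?W \<Phi>"
  proof (intro generic_point.intro generic_point_axioms.intro)
    show "field R" by (rule field_axioms)
    show "field ?L" by (rule L)
    show "?W \<subseteq> points" by (rule W)
    show "char_zero" by (rule ch)
    show "\<Phi> f \<in> carrier ?L" if "f \<in> poly_fun UNIV" for f
      unfolding \<Phi>_def using ring_hom_closed[OF M.rcos_ring_hom fA[OF that]] .
    show "\<Phi> (\<lambda>w. f w \<oplus> g w) = \<Phi> f \<oplus>\<^bsub>?L\<^esub> \<Phi> g" if "f \<in> poly_fun UNIV" "g \<in> poly_fun UNIV" for f g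
      unfolding \<Phi>_def using ring_hom_add[OF M.rcos_ring_hom fA[OF that(1)] fA[OF that(2)]] by simp
    show "\<Phi> (\<lambda>w. f w \<otimes> g w) = \<Phi> f \<otimes>\<^bsub>?L\<^esub> \<Phi> g" if "f \<in> poly_fun UNIV" "g \<in> poly_fun UNIV" for f g
      unfolding \<Phi>_def using ring_hom_mult[OF M.rcos_ring_hom fA[OF that(1)] fA[OF that(2)]] by simp
    show "\<Phi> (\<lambda>_. \<one>) = \<one>\<^bsub>?L\<^esub>"
      unfolding \<Phi>_def using ring_hom_one[OF M.rcos_ring_hom] by simp
    fix f assume f: "f \<in> poly_fun UNIV"
    have z: "\<zero>\<^bsub>?L\<^esub> = M" by (simp add: FactRing_def)
    have mem: "\<Phi> f = \<zero>\<^bsub>?L\<^esub> \<longleftrightarrow> (\<lambda>w. f (\<rho> w)) \<in> M"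
      unfolding z \<Phi>_def
      by (rule iffI, erule M.rcos_const_imp_mem[OF fA[OF f]], erule M.a_rcos_const)
    show "\<Phi> f = \<zero>\<^bsub>?L\<^esub> \<longleftrightarrow> (\<forall>w\<in>?W. f w = \<zero>)"
    proof
      assume "\<forall>w\<in>?W. f w = \<zero>"
      then have "(\<lambda>w. f (\<rho> w)) = \<zero>\<^bsub>?A\<^esub>" using \<rho>W by auto
      then show "\<Phi> f = \<zero>\<^bsub>?L\<^esub>" using mem M.zero_closed by simp
    next
      assume "\<Phi> f = \<zero>\<^bsub>?L\<^esub>"
      then have fM: "(\<lambda>w. f (\<rho> w)) \<in> M" using mem by simp
      show "\<forall>w\<in>?W. f w = \<zero>"
      proof (rule ccontr)
        assume "\<not> ?thesis"
        then have nzf: "nz f" using f by (auto simp: nz_def)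
        define h where "h w = (if f (\<rho> w) = \<zero> then \<zero> else inv (f (\<rho> w)))" for w
        have fc: "f (\<rho> w) \<in> carrier R" for w using fA[OF f] by auto
        have hA: "h \<in> carrier ?A" using fc field_Units by (auto simp: h_def)
        have hM: "h \<otimes>\<^bsub>?A\<^esub> (\<lambda>w. f (\<rho> w)) \<in> M" by (rule M.I_l_closed[OF fM hA])
        have hN: "(\<lambda>w. \<one> \<oplus> \<ominus> (h w \<otimes> f (\<rho> w))) \<in> N"
        proof -
          have "f w \<otimes> (\<one> \<oplus> \<ominus> (h w \<otimes> f (\<rho> w))) = \<zero>" if w: "w \<in> ?W" for w
          proof (cases "f w = \<zero>")
            case True
            then show ?thesis using fc[of w] hA by auto
          next
            case False
            have "\<rho> w = w" using w by (simp add: \<rho>_def)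
            moreover from this have "f w \<in> Units R" using False fc[of w] field_Units by auto
            ultimately show ?thesis using False Units_closed[of "f w"] by (simp add: h_def r_neg)
          qed
          then show ?thesis using nzf fc hA by (auto simp: N_def)
        qed
        have "(\<lambda>w. \<one> \<oplus> \<ominus> (h w \<otimes> f (\<rho> w))) \<oplus>\<^bsub>?A\<^esub> (\<lambda>w. h w \<otimes> f (\<rho> w)) \<in> M"
          by (rule M.a_closed[OF subsetD[OF M(2) hN] hM[unfolded function_ring_simps(2)]])
        moreover have "(\<lambda>w. \<one> \<oplus> \<ominus> (h w \<otimes> f (\<rho> w))) \<oplus>\<^bsub>?A\<^esub> (\<lambda>w. h w \<otimes> f (\<rho> w)) = \<one>\<^bsub>?A\<^esub>"
          using fc hA by (auto simp: a_assoc l_neg)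
        ultimately have "\<one>\<^bsub>?A\<^esub> \<in> M" by simp
        then show False using M.one_imp_carrier M.I_notcarr by simp
      qed
    qed
  qed
  then show ?thesis by blast
qed

section \<open>Dimension and independent coordinates\<close>

lemma (in field) chain_alg_indep:
  assumes ch: "char_zero" and irr: "\<And>i. i \<le> k \<Longrightarrow> irreducible_variety m (Z i)"
    and str: "\<And>i. i < k \<Longrightarrow> Z i \<subset> Z (Suc i)"
  shows "\<exists>B\<subseteq>{..<m}. card B = k \<and> alg_indep B (cylinder m (Z k))"
  using irr str
proof (induction k)
  case 0
  obtain w where w: "w \<in> cylinder m (Z 0)" using irreducible_cylinder_nonempty 0 by blast
  have "alg_indep {} (cylinder m (Z 0))"
    unfolding alg_indep_def
  proof (intro ballI impI)
    fix g u assume "g \<in> poly_fun {}" "\<forall>w\<in>cylinder m (Z 0). g w = \<zero>" "u \<in> points"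
    then show "g u = \<zero>" using poly_fun_cong[of g "{}" u w] w cylinder_points by auto
  qed
  then show ?case by (intro exI[of _ "{}"]) auto
next
  case (Suc k)
  then obtain B where B: "B \<subseteq> {..<m}" "card B = k" "alg_indep B (cylinder m (Z k))" by auto
  have Zk: "irreducible_variety m (Z k)" "irreducible_variety m (Z (Suc k))" "Z k \<subset> Z (Suc k)" using Suc.prems by auto
  obtain L :: "((nat \<Rightarrow> 'a) \<Rightarrow> 'a) set ring" and \<Phi> where G: "generic_point R L (cylinder m (Z (Suc k))) \<Phi>"
    using generic_point_exists[OF ch Zk(2)] by blast
  interpret G: generic_point R L "cylinder m (Z (Suc k))" \<Phi> by (rule G)
  obtain p where p: "p \<in> Z (Suc k)" "p \<notin> Z k" using Zk(3) by blast
  have pa: "p \<in> affine_space m" using irreducible_affine[OF Zk(2)] p by blast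
  have c: "ext_pt m p \<in> cylinder m (Z (Suc k))" "ext_pt m p \<notin> cylinder m (Z k)"
    using ext_pt_cylinder[OF p(1) pa] p(2) map_ext_pt[OF pa] by (auto simp: cylinder_def)
  obtain f where f: "f \<in> poly_fun {..<m}" "f (ext_pt m p) \<noteq> \<zero>" "\<forall>u\<in>cylinder m (Z k). f u = \<zero>"
    using zariski_closed_separates[OF _ ext_pt_points[OF pa] c(2)] Zk(1) unfolding irreducible_variety_def by blast
  obtain j where j: "j \<in> {..<m} - B" "alg_indep (insert j B) (cylinder m (Z (Suc k)))"
    using G.alg_indep_insert[OF cylinder_mono B(3,1) f(1)] Zk(3) f c(1) by blast
  have "finite B" using B(1) finite_subset by blast
  then show ?case using j B by (intro exI[of _ "insert j B"]) auto
qed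

text \<open>
  A chain of irreducible closed sets of length at least \<open>k\<close> in the closure gives at least \<open>k\<close>
  independent coordinates on its largest member; independence passes from there to the closure of
  \<open>W\<close> and so to \<open>W\<close>.
\<close>

lemma (in field) zariski_dim_alg_indep:
  assumes ch: "char_zero" and k: "k > 0" and dim: "enat k \<le> zariski_dim m W" and W: "W \<subseteq> affine_space m"
  shows "\<exists>B\<subseteq>{..<m}. card B = k \<and> alg_indep B (cylinder m W)"
proof -
  have "\<exists>l\<ge>k. \<exists>Z. (\<forall>i\<le>l. irreducible_variety m (Z i) \<and> Z i \<subseteq> zariski_closure m W) \<and> (\<forall>i<l. Z i \<subset> Z (Suc i))"
  proof (rule ccontr)
    assume neg: "\<not> ?thesis"
    have "zariski_dim m W \<le> enat (k - 1)"
      unfolding zariski_dim_def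
    proof (rule SUP_least, elim CollectE)
      fix l assume "\<exists>Z. (\<forall>i\<le>l. irreducible_variety m (Z i) \<and> Z i \<subseteq> zariski_closure m W) \<and> (\<forall>i<l. Z i \<subset> Z (Suc i))"
      then have "\<not> k \<le> l" using neg by blast
      then show "enat l \<le> enat (k - 1)" by simp
    qed
    then show False using dim k order.trans[OF dim, of "enat (k - 1)"] by simp
  qed
  moreover have "\<exists>B\<subseteq>{..<m}. card B = k \<and> alg_indep B (cylinder m W)" if l: "l \<ge> k"
    and Z: "\<forall>i\<le>l. irreducible_variety m (Z i) \<and> Z i \<subseteq> zariski_closure m W" "\<forall>i<l. Z i \<subset> Z (Suc i)" for l Z
  proof -
    obtain B where B: "B \<subseteq> {..<m}" "card B = l" "alg_indep B (cylinder m (Z l))" using chain_alg_indep[OF ch, of l m Z] Z by auto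
    obtain C where C: "C \<subseteq> B" "card C = k" using obtain_subset_with_card_n[of k B] l B(2) by metis
    have "alg_indep C (cylinder m W)"
      unfolding alg_indep_def
    proof (intro ballI impI)
      fix g u assume g: "g \<in> poly_fun C" "\<forall>w\<in>cylinder m W. g w = \<zero>" and u: "u \<in> points"
      have gm: "g \<in> poly_fun {..<m}" using poly_fun_mono[OF g(1)] C(1) B(1) by blast
      let ?H = "{p \<in> affine_space m. g (ext_pt m p) = \<zero>}"
      have "W \<subseteq> ?H" using W g(2) ext_pt_cylinder by blast
      then have "zariski_closure m W \<subseteq> ?H" unfolding zariski_closure_def using zariski_closed_poly_fun[OF gm] by blast
      then have "Z l \<subseteq> ?H" using Z(1) by blast
      then have "\<forall>w\<in>cylinder m (Z l). g w = \<zero>" using poly_fun_ext_pt[OF gm] by (auto simp: cylinder_def)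
      then show "g u = \<zero>" using alg_indep_subset[OF B(3) C(1)] g(1) u unfolding alg_indep_def by blast
    qed
    then show ?thesis using C B(1) by blast
  qed
  ultimately show ?thesis by blast
qed

section \<open>Linear algebra over a field\<close>

context field
begin

text \<open>
  Gaussian elimination of one column, with a pivot row \<open>a0\<close>.
\<close>

lemma relation_if_more_rows:
  assumes "finite C" "finite A" "card C < card A" "\<And>a c. M a c \<in> carrier R"
  shows "\<exists>\<beta>. (\<forall>a. \<beta> a \<in> carrier R) \<and> (\<exists>a\<in>A. \<beta> a \<noteq> \<zero>) \<and> (\<forall>c\<in>C. (\<Oplus>a\<in>A. \<beta> a \<otimes> M a c) = \<zero>)"
  using assms
proof (induction C arbitrary: A M rule: finite_induct)
  case empty
  then have "A \<noteq> {}" by auto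
  then show ?case by (intro exI[of _ "\<lambda>_. \<one>"]) auto
next
  case (insert c C)
  show ?case
  proof (cases "\<forall>a\<in>A. M a c = \<zero>")
    case True
    have cC: "card C < card A" using insert.prems(2) insert.hyps by simp
    then obtain \<beta> where \<beta>: "\<forall>a. \<beta> a \<in> carrier R" "\<exists>a\<in>A. \<beta> a \<noteq> \<zero>" "\<forall>c\<in>C. (\<Oplus>a\<in>A. \<beta> a \<otimes> M a c) = \<zero>"
      using insert.IH[OF insert.prems(1) cC, of M, OF insert.prems(3)] by (elim exE conjE) (rule that)
    have "(\<Oplus>a\<in>A. \<beta> a \<otimes> M a c) = (\<Oplus>a\<in>A. \<zero>)" by (rule finsum_cong') (use True \<beta>(1) in auto)
    then show ?thesis using \<beta> by (intro exI[of _ \<beta>]) auto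
  next
    case False
    then obtain a0 where a0: "a0 \<in> A" "M a0 c \<noteq> \<zero>" by blast
    define A' where "A' = A - {a0}"
    have A': "A = insert a0 A'" "a0 \<notin> A'" "finite A'" using a0 insert.prems(1) by (auto simp: A'_def)
    have Mc: "M a c \<in> carrier R" for a c by (rule insert.prems(3))
    have u: "M a0 c \<in> Units R" using a0(2) Mc field_Units by auto
    define s where "s a = \<ominus> (M a c \<otimes> inv (M a0 c))" for a
    have sc: "s a \<in> carrier R" for a using Mc u by (simp add: s_def)
    define M' where "M' a c' = M a c' \<oplus> s a \<otimes> M a0 c'" for a c'
    have M'c: "M' a c' \<in> carrier R" for a c' using Mc sc by (simp add: M'_def)
    have M'0: "M' a c = \<zero>" for a
    proof -
      have "s a \<otimes> M a0 c = \<ominus> (M a c \<otimes> (inv (M a0 c) \<otimes> M a0 c))"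
        unfolding s_def using Mc u by (simp add: l_minus m_assoc)
      then show ?thesis using Mc Units_l_inv[OF u] by (simp add: M'_def r_neg)
    qed
    have cC: "card C < card A'" using insert.prems(2) insert.hyps A' by simp
    then obtain \<beta> where \<beta>: "\<forall>a. \<beta> a \<in> carrier R" "\<exists>a\<in>A'. \<beta> a \<noteq> \<zero>" "\<forall>c\<in>C. (\<Oplus>a\<in>A'. \<beta> a \<otimes> M' a c) = \<zero>"
      using insert.IH[OF A'(3) cC, of M', OF M'c] by (elim exE conjE) (rule that)
    have \<beta>c: "\<beta> a \<in> carrier R" for a using \<beta>(1) by blast
    define \<gamma> where "\<gamma> a = (if a = a0 then (\<Oplus>a\<in>A'. \<beta> a \<otimes> s a) else \<beta> a)" for a
    have \<gamma>c: "\<gamma> a \<in> carrier R" for a using \<beta>c sc by (auto simp: \<gamma>_def intro!: finsum_closed)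
    have eq: "(\<Oplus>a\<in>A. \<gamma> a \<otimes> M a c') = (\<Oplus>a\<in>A'. \<beta> a \<otimes> M' a c')" for c'
    proof -
      have "(\<Oplus>a\<in>A. \<gamma> a \<otimes> M a c') = \<gamma> a0 \<otimes> M a0 c' \<oplus> (\<Oplus>a\<in>A'. \<gamma> a \<otimes> M a c')"
        unfolding A'(1) using A' \<gamma>c Mc by (subst finsum_insert) auto
      also have "(\<Oplus>a\<in>A'. \<gamma> a \<otimes> M a c') = (\<Oplus>a\<in>A'. \<beta> a \<otimes> M a c')"
        by (rule finsum_cong') (use A'(2) \<beta>c Mc in \<open>auto simp: \<gamma>_def\<close>)
      also have "\<gamma> a0 \<otimes> M a0 c' = (\<Oplus>a\<in>A'. (\<beta> a \<otimes> s a) \<otimes> M a0 c')"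
        unfolding \<gamma>_def using A' \<beta>c sc Mc by (simp add: finsum_ldistr)
      also have "(\<Oplus>a\<in>A'. (\<beta> a \<otimes> s a) \<otimes> M a0 c') \<oplus> (\<Oplus>a\<in>A'. \<beta> a \<otimes> M a c') =
          (\<Oplus>a\<in>A'. (\<beta> a \<otimes> s a) \<otimes> M a0 c' \<oplus> \<beta> a \<otimes> M a c')"
        by (rule finsum_addf[symmetric]) (use \<beta>c sc Mc in auto)
      also have "\<dots> = (\<Oplus>a\<in>A'. \<beta> a \<otimes> M' a c')"
        by (rule finsum_cong') (use \<beta>c sc Mc in \<open>auto simp: M'_def r_distr m_assoc a_comm\<close>)
      finally show ?thesis .
    qed
    have "(\<Oplus>a\<in>A'. \<beta> a \<otimes> M' a c) = (\<Oplus>a\<in>A'. \<zero>)" by (rule finsum_cong') (use M'0 \<beta>c in auto)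
    then have z: "\<forall>c'\<in>insert c C. (\<Oplus>a\<in>A. \<gamma> a \<otimes> M a c') = \<zero>" unfolding eq using \<beta>(3) by auto
    obtain a where "a \<in> A'" "\<beta> a \<noteq> \<zero>" using \<beta>(2) by blast
    then have "a \<in> A" "\<gamma> a \<noteq> \<zero>" using A' by (auto simp: \<gamma>_def)
    then show ?thesis using z \<gamma>c by blast
  qed
qed

lemma subspace_combination:
  assumes "finite I" and T: "\<And>t u c. \<lbrakk>t \<in> T; u \<in> T; c \<in> carrier R\<rbrakk> \<Longrightarrow> (\<lambda>k. t k \<oplus> c \<otimes> u k) \<in> T"
    and Tc: "\<And>t k. t \<in> T \<Longrightarrow> t k \<in> carrier R"
    and "t \<in> T" "\<And>i. i \<in> I \<Longrightarrow> e i \<in> T" "\<And>i. c i \<in> carrier R"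
  shows "(\<lambda>k. t k \<oplus> (\<Oplus>i\<in>I. c i \<otimes> e i k)) \<in> T"
  using assms(1,5)
proof (induction I rule: finite_induct)
  case empty
  then show ?case using assms(4) Tc by simp
next
  case (insert i I)
  let ?u = "\<lambda>k. t k \<oplus> (\<Oplus>i\<in>I. c i \<otimes> e i k)"
  have u: "?u \<in> T" using insert by auto
  have ec: "e j k \<in> carrier R" if "j \<in> insert i I" for j k using insert.prems that Tc by blast
  have "(\<lambda>k. ?u k \<oplus> c i \<otimes> e i k) \<in> T" using T[OF u] insert.prems assms(6) by blast
  moreover have "?u k \<oplus> c i \<otimes> e i k = t k \<oplus> (\<Oplus>i\<in>insert i I. c i \<otimes> e i k)" for k
  proof -
    have s: "(\<Oplus>i\<in>I. c i \<otimes> e i k) \<in> carrier R" using ec assms(6) by (intro finsum_closed) auto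
    have "(\<Oplus>i\<in>insert i I. c i \<otimes> e i k) = c i \<otimes> e i k \<oplus> (\<Oplus>i\<in>I. c i \<otimes> e i k)"
      using insert.hyps ec assms(6) by (intro finsum_insert) auto
    then show ?thesis using s ec assms(6) Tc[OF assms(4)] by (simp add: a_ac)
  qed
  ultimately show ?case by simp
qed

text \<open>
  If the components with index in \<open>I\<close> satisfy no linear relation on the space \<open>T\<close>, then they take all
  values. By induction there are vectors \<open>e i\<close> in \<open>T\<close> that behave as unit vectors on \<open>I\<close>; were the new component
  zero whenever those in \<open>I\<close> are, it would be a fixed linear combination of them.
\<close>

lemma surjective_if_no_relation:
  assumes "finite I" and T: "\<And>t u c. \<lbrakk>t \<in> T; u \<in> T; c \<in> carrier R\<rbrakk> \<Longrightarrow> (\<lambda>k. t k \<oplus> c \<otimes> u k) \<in> T"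
    and Tc: "\<And>t k. t \<in> T \<Longrightarrow> t k \<in> carrier R" and ne: "T \<noteq> {}"
    and norel: "\<And>l i. \<lbrakk>\<And>i. l i \<in> carrier R; \<And>t. t \<in> T \<Longrightarrow> (\<Oplus>i\<in>I. l i \<otimes> t i) = \<zero>; i \<in> I\<rbrakk> \<Longrightarrow> l i = \<zero>"
    and g: "\<And>i. g i \<in> carrier R"
  shows "\<exists>t\<in>T. \<forall>i\<in>I. t i = g i"
  using assms(1) norel g
proof (induction I arbitrary: g rule: finite_induct)
  case empty
  then show ?case using ne by auto
next
  case (insert j I)
  have norelI: "l i = \<zero>" if "\<And>i. l i \<in> carrier R" "\<And>t. t \<in> T \<Longrightarrow> (\<Oplus>i\<in>I. l i \<otimes> t i) = \<zero>" "i \<in> I" for l i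
  proof -
    let ?l = "\<lambda>i. if i = j then \<zero> else l i"
    have "(\<Oplus>i\<in>insert j I. ?l i \<otimes> t i) = \<zero>" if t: "t \<in> T" for t
    proof -
      have "(\<Oplus>i\<in>insert j I. ?l i \<otimes> t i) = ?l j \<otimes> t j \<oplus> (\<Oplus>i\<in>I. ?l i \<otimes> t i)"
        using insert.hyps Tc[OF t] \<open>\<And>i. l i \<in> carrier R\<close> by (intro finsum_insert) auto
      also have "(\<Oplus>i\<in>I. ?l i \<otimes> t i) = (\<Oplus>i\<in>I. l i \<otimes> t i)"
        by (rule finsum_cong') (use insert.hyps Tc[OF t] \<open>\<And>i. l i \<in> carrier R\<close> in auto)
      finally show ?thesis using \<open>\<And>t. t \<in> T \<Longrightarrow> (\<Oplus>i\<in>I. l i \<otimes> t i) = \<zero>\<close>[OF t] Tc[OF t] by simp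
    qed
    then have "?l i = \<zero>" using insert.prems(1)[of ?l i] that(1,3) by auto
    then show ?thesis using that(3) insert.hyps by (auto split: if_splits)
  qed
  have IH: "\<exists>t\<in>T. \<forall>i\<in>I. t i = h i" if "\<And>i. h i \<in> carrier R" for h
    using insert.IH[of h] norelI that by blast
  have "\<exists>t\<in>T. (\<forall>i\<in>I. t i = \<zero>) \<and> t j \<noteq> \<zero>"
  proof (rule ccontr)
    assume neg: "\<not> ?thesis"
    then have neg': "t j = \<zero>" if "t \<in> T" "\<And>i. i \<in> I \<Longrightarrow> t i = \<zero>" for t using that by blast
    have "\<exists>t\<in>T. \<forall>k\<in>I. t k = (if k = i then \<one> else \<zero>)" for i by (rule IH) auto
    then obtain e where e: "\<And>i. e i \<in> T" "\<And>i k. k \<in> I \<Longrightarrow> e i k = (if k = i then \<one> else \<zero>)" by metis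
    have ec: "e i k \<in> carrier R" for i k using e(1) Tc by blast
    let ?l = "\<lambda>i. if i = j then \<one> else \<ominus> e i j"
    have "(\<Oplus>i\<in>insert j I. ?l i \<otimes> t i) = \<zero>" if t: "t \<in> T" for t
    proof -
      have tc: "t k \<in> carrier R" for k using Tc[OF t] .
      let ?u = "\<lambda>k. t k \<oplus> (\<Oplus>i\<in>I. \<ominus> t i \<otimes> e i k)"
      have u: "?u \<in> T" by (rule subspace_combination[of I T t e "\<lambda>i. \<ominus> t i"])
          (use insert.hyps(1) T Tc t e(1) tc in \<open>simp_all\<close>)
      have "?u k = \<zero>" if k: "k \<in> I" for k
      proof -
        have "(\<Oplus>i\<in>I. \<ominus> t i \<otimes> e i k) = (\<Oplus>i\<in>I. if k = i then \<ominus> t i else \<zero>)"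
          by (rule finsum_cong') (use e(2)[OF k] tc in auto)
        also have "\<dots> = \<ominus> t k" using finsum_singleton[OF k insert.hyps(1), of "\<lambda>i. \<ominus> t i"] tc by auto
        finally show ?thesis using tc by (simp add: r_neg)
      qed
      then have uj: "?u j = \<zero>" by (rule neg'[OF u])
      have "(\<Oplus>i\<in>insert j I. ?l i \<otimes> t i) = ?l j \<otimes> t j \<oplus> (\<Oplus>i\<in>I. ?l i \<otimes> t i)"
        using insert.hyps tc ec by (intro finsum_insert) auto
      also have "(\<Oplus>i\<in>I. ?l i \<otimes> t i) = (\<Oplus>i\<in>I. \<ominus> t i \<otimes> e i j)"
        by (rule finsum_cong') (use insert.hyps tc ec in \<open>auto simp: l_minus r_minus m_comm\<close>)
      finally show ?thesis using uj tc by simp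
    qed
    note rel = this
    have lc: "?l i \<in> carrier R" for i using ec by simp
    have "?l j = \<zero>" by (rule insert.prems(1)[of ?l j, OF lc rel]) auto
    then show False by simp
  qed
  then obtain t where t: "t \<in> T" "\<forall>i\<in>I. t i = \<zero>" "t j \<noteq> \<zero>" by blast
  obtain u where u: "u \<in> T" "\<forall>i\<in>I. u i = g i" using IH[of g] insert.prems(2) by blast
  have tU: "t j \<in> Units R" using t Tc field_Units by auto
  have uc: "u i \<in> carrier R" and tc: "t i \<in> carrier R" and gc: "g i \<in> carrier R" for i using u t Tc insert.prems(2) by auto
  define c where "c = (g j \<oplus> \<ominus> u j) \<otimes> inv (t j)"
  have c: "c \<in> carrier R" using uc gc tU by (simp add: c_def)
  have "c \<otimes> t j = g j \<oplus> \<ominus> u j" using uc gc tc tU Units_l_inv[OF tU] by (simp add: c_def m_assoc)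
  then have "u j \<oplus> c \<otimes> t j = u j \<oplus> (\<ominus> u j \<oplus> g j)" using uc gc by (simp add: a_comm)
  also have "\<dots> = g j" using uc gc by (simp add: a_assoc[symmetric] r_neg)
  finally have "u j \<oplus> c \<otimes> t j = g j" .
  moreover have "u i \<oplus> c \<otimes> t i = g i" if "i \<in> I" for i using t(2) u(2) that c uc gc by simp
  ultimately show ?case using T[OF u(1) t(1) c] by (intro bexI[of _ "\<lambda>k. u k \<oplus> c \<otimes> t k"]) auto
qed

section \<open>The Lie algebra of derivations\<close>

lemma derivation_combine:
  assumes "derivation \<delta>" "derivation \<epsilon>" "c \<in> carrier R"
  shows "derivation (\<lambda>x. \<delta> x \<oplus> c \<otimes> \<epsilon> x)"
proof -
  note d = derivation_closed[OF assms(1)] derivation_closed[OF assms(2)]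
  show ?thesis unfolding derivation_def
    using d assms(3)
    by (auto simp: derivation_add[OF assms(1)] derivation_add[OF assms(2)]
      derivation_mult[OF assms(1)] derivation_mult[OF assms(2)] r_distr l_distr a_ac m_ac)
qed

lemma derivation_finsum:
  assumes d: "derivation \<delta>" and "finite I" and f: "\<And>i. i \<in> I \<Longrightarrow> f i \<in> carrier R"
  shows "\<delta> (\<Oplus>i\<in>I. f i) = (\<Oplus>i\<in>I. \<delta> (f i))"
  using assms(2) f
proof (induction I rule: finite_induct)
  case empty
  then show ?case using derivation_zero[OF d] by simp
next
  case (insert i I)
  have "\<delta> (\<Oplus>i\<in>insert i I. f i) = \<delta> (f i \<oplus> (\<Oplus>i\<in>I. f i))"
    using insert by (subst finsum_insert) auto
  also have "\<dots> = \<delta> (f i) \<oplus> \<delta> (\<Oplus>i\<in>I. f i)"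
    using insert.prems by (intro derivation_add[OF d]) (auto intro: finsum_closed)
  also have "\<dots> = (\<Oplus>i\<in>insert i I. \<delta> (f i))"
    using insert derivation_closed[OF d] by (subst finsum_insert) auto
  finally show ?case .
qed

lemma derivation_minus: 
  assumes d: "derivation \<delta>" and x: "x \<in> carrier R"
  shows "\<delta> (\<ominus> x) = \<ominus> \<delta> x"
proof -
  have "\<delta> (\<ominus> x) \<oplus> \<delta> x = \<delta> (\<ominus> x \<oplus> x)" using x derivation_add[OF d, of "\<ominus> x" x] by simp
  also have "\<dots> = \<zero>" using x derivation_zero[OF d] by (simp add: l_neg)
  finally have "\<delta> (\<ominus> x) \<oplus> \<delta> x = \<zero>" .
  from minus_equality[OF this] show ?thesis using x derivation_closed[OF d] by simp
qed

lemma derivation_one: 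
  assumes d: "derivation \<delta>" shows "\<delta> \<one> = \<zero>"
proof -
  have "\<delta> \<one> = \<delta> \<one> \<oplus> \<delta> \<one>" using derivation_mult[OF d one_closed one_closed] derivation_closed[OF d] by simp
  then show ?thesis using derivation_closed[OF d one_closed] by simp
qed

lemma derivation_commutator:
  assumes d: "derivation \<delta>" and e: "derivation \<epsilon>"
  shows "derivation (\<lambda>x. \<delta> (\<epsilon> x) \<oplus> \<ominus> \<epsilon> (\<delta> x))"
  unfolding derivation_def
proof (intro conjI ballI)
  note c = derivation_closed[OF d] derivation_closed[OF e]
  show "\<delta> (\<epsilon> x) \<oplus> \<ominus> \<epsilon> (\<delta> x) \<in> carrier R" if "x \<in> carrier R" for x using that c by simp
  fix x y assume xy: "x \<in> carrier R" "y \<in> carrier R"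
  show "\<delta> (\<epsilon> (x \<oplus> y)) \<oplus> \<ominus> \<epsilon> (\<delta> (x \<oplus> y)) = \<delta> (\<epsilon> x) \<oplus> \<ominus> \<epsilon> (\<delta> x) \<oplus> (\<delta> (\<epsilon> y) \<oplus> \<ominus> \<epsilon> (\<delta> y))"
    using xy c by (simp add: derivation_add[OF d] derivation_add[OF e] minus_add a_ac)
  let ?de = "\<delta> (\<epsilon> x)" and ?ed = "\<epsilon> (\<delta> x)" and ?de' = "\<delta> (\<epsilon> y)" and ?ed' = "\<epsilon> (\<delta> y)"
  have 1: "\<delta> (\<epsilon> (x \<otimes> y)) = (x \<otimes> ?de' \<oplus> ?de \<otimes> y) \<oplus> (\<delta> x \<otimes> \<epsilon> y \<oplus> \<epsilon> x \<otimes> \<delta> y)"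
    using xy c by (simp add: derivation_add[OF d] derivation_mult[OF d] derivation_mult[OF e] a_ac)
  have 2: "\<epsilon> (\<delta> (x \<otimes> y)) = (x \<otimes> ?ed' \<oplus> ?ed \<otimes> y) \<oplus> (\<delta> x \<otimes> \<epsilon> y \<oplus> \<epsilon> x \<otimes> \<delta> y)"
    using xy c by (simp add: derivation_add[OF e] derivation_mult[OF d] derivation_mult[OF e] a_ac)
  have cancel: "(a \<oplus> m) \<oplus> \<ominus> (b \<oplus> m) = a \<oplus> \<ominus> b" if "a \<in> carrier R" "b \<in> carrier R" "m \<in> carrier R" for a b m
  proof -
    have "\<ominus> (b \<oplus> m) = \<ominus> m \<oplus> \<ominus> b" using that by (simp add: minus_add a_comm)
    then show ?thesis using that by (simp add: a_assoc r_neg2)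
  qed
  have "\<delta> (\<epsilon> (x \<otimes> y)) \<oplus> \<ominus> \<epsilon> (\<delta> (x \<otimes> y)) = (x \<otimes> ?de' \<oplus> ?de \<otimes> y) \<oplus> \<ominus> (x \<otimes> ?ed' \<oplus> ?ed \<otimes> y)"
    unfolding 1 2 using xy c by (intro cancel) auto
  also have "\<dots> = x \<otimes> (?de' \<oplus> \<ominus> ?ed') \<oplus> (?de \<oplus> \<ominus> ?ed) \<otimes> y"
    using xy c by (simp add: minus_add r_distr l_distr r_minus l_minus a_ac)
  finally show "\<delta> (\<epsilon> (x \<otimes> y)) \<oplus> \<ominus> \<epsilon> (\<delta> (x \<otimes> y)) = x \<otimes> (?de' \<oplus> \<ominus> ?ed') \<oplus> (?de \<oplus> \<ominus> ?ed) \<otimes> y" .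
qed

end

section \<open>Linear relations between differentials\<close>

text \<open>
  The derivations with constants \<open>K\<close>, and the linear relations between the differentials of the
  elements \<open>z\<close> over \<open>K\<close>: \<open>V\<close> annihilates iff \<open>\<Sum>\<^sub>j V\<^sub>j dz\<^sub>j = 0\<close>.
\<close>

definition (in ring) Der :: "'a set \<Rightarrow> ('a \<Rightarrow> 'a) set" where
  "Der K = {\<delta>. derivation \<delta> \<and> (\<forall>a\<in>K. \<delta> a = \<zero>)}"

definition (in ring) annihilates :: "'a set \<Rightarrow> nat \<Rightarrow> (nat \<Rightarrow> 'a) \<Rightarrow> (nat \<Rightarrow> 'a) \<Rightarrow> bool" where
  "annihilates K N z V \<longleftrightarrow> (\<forall>\<delta>\<in>Der K. (\<Oplus>j\<in>{..<N}. V j \<otimes> \<delta> (z j)) = \<zero>)"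

lemma (in abelian_monoid) finsum_split_double:
  fixes n :: nat
  assumes "\<And>j. f j \<in> carrier G"
  shows "(\<Oplus>j\<in>{..<n + n}. f j) = (\<Oplus>i\<in>{..<n}. f i) \<oplus> (\<Oplus>i\<in>{..<n}. f (n + i))"
proof -
  have "{..<n + n} = {..<n} \<union> (+) n ` {..<n}"
  proof (intro equalityI subsetI)
    fix j assume "j \<in> {..<n + n}"
    then show "j \<in> {..<n} \<union> (+) n ` {..<n}"
      by (cases "j < n") (auto intro!: image_eqI[of _ _ "j - n"])
  qed auto
  moreover have "(\<Oplus>j\<in>(+) n ` {..<n}. f j) = (\<Oplus>i\<in>{..<n}. f (n + i))"
    using assms by (intro finsum_reindex) (auto simp: inj_on_def)
  ultimately show ?thesis using assms
    by (subst \<open>{..<n + n} = _\<close>, subst finsum_Un_disjoint) auto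
qed

context field
begin

text \<open>
  Relations between differentials may be differentiated: applying \<open>\<epsilon>\<close> to \<open>\<Sum>\<^sub>j V\<^sub>j \<delta>(z\<^sub>j) = 0\<close> produces the
  additional terms \<open>V\<^sub>j \<epsilon>(\<delta>(z\<^sub>j))\<close>, and these are \<open>V\<^sub>j [\<epsilon>, \<delta>](z\<^sub>j)\<close> because \<open>\<epsilon>\<close> kills \<open>z\<^sub>j\<close>. As the commutator
  is a derivation with constants \<open>K\<close>, their sum vanishes.
\<close>

lemma annihilates_derivation:
  assumes V: "annihilates K N z V" and e: "\<epsilon> \<in> Der K" "\<And>j. j < N \<Longrightarrow> \<epsilon> (z j) = \<zero>"
    and c: "\<And>j. V j \<in> carrier R" "\<And>j. z j \<in> carrier R" and K: "K \<subseteq> carrier R"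
  shows "annihilates K N z (\<lambda>j. \<epsilon> (V j))"
  unfolding annihilates_def
proof
  fix \<delta> assume d: "\<delta> \<in> Der K"
  have dd: "derivation \<delta>" and ee: "derivation \<epsilon>" using d e by (auto simp: Der_def)
  note dc = derivation_closed[OF dd] derivation_closed[OF ee]
  let ?D = "\<lambda>x. \<epsilon> (\<delta> x) \<oplus> \<ominus> \<delta> (\<epsilon> x)"
  have D: "?D \<in> Der K"
    using derivation_commutator[OF ee dd] d e derivation_zero[OF dd] derivation_zero[OF ee] by (auto simp: Der_def)
  have Dz: "?D (z j) = \<epsilon> (\<delta> (z j))" if "j < N" for j
    using e(2)[OF that] derivation_zero[OF dd] dc c by simp
  have "(\<Oplus>j\<in>{..<N}. V j \<otimes> ?D (z j)) = (\<Oplus>j\<in>{..<N}. V j \<otimes> \<epsilon> (\<delta> (z j)))"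
    by (rule finsum_cong') (use Dz dc c in auto)
  then have 1: "(\<Oplus>j\<in>{..<N}. V j \<otimes> \<epsilon> (\<delta> (z j))) = \<zero>" using V D by (auto simp: annihilates_def)
  have "\<zero> = \<epsilon> (\<Oplus>j\<in>{..<N}. V j \<otimes> \<delta> (z j))"
    using V d derivation_zero[OF ee] by (auto simp: annihilates_def)
  also have "\<dots> = (\<Oplus>j\<in>{..<N}. \<epsilon> (V j \<otimes> \<delta> (z j)))"
    by (rule derivation_finsum[OF ee]) (use dc c in auto)
  also have "\<dots> = (\<Oplus>j\<in>{..<N}. V j \<otimes> \<epsilon> (\<delta> (z j)) \<oplus> \<epsilon> (V j) \<otimes> \<delta> (z j))"
    by (rule finsum_cong') (use dc c derivation_mult[OF ee] in auto)
  also have "\<dots> = (\<Oplus>j\<in>{..<N}. V j \<otimes> \<epsilon> (\<delta> (z j))) \<oplus> (\<Oplus>j\<in>{..<N}. \<epsilon> (V j) \<otimes> \<delta> (z j))"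
    by (rule finsum_addf) (use dc c in auto)
  also have "\<dots> = (\<Oplus>j\<in>{..<N}. \<epsilon> (V j) \<otimes> \<delta> (z j))"
    unfolding 1 using dc c by (intro l_zero finsum_closed) auto
  finally show "(\<Oplus>j\<in>{..<N}. \<epsilon> (V j) \<otimes> \<delta> (z j)) = \<zero>" by simp
qed

lemma annihilates_combination:
  assumes V: "\<And>a. a \<in> A \<Longrightarrow> annihilates K N z (V a)" and "finite A"
    and c: "\<And>a j. V a j \<in> carrier R" "\<And>j. z j \<in> carrier R" "\<And>a. \<beta> a \<in> carrier R"
  shows "annihilates K N z (\<lambda>j. \<Oplus>a\<in>A. \<beta> a \<otimes> V a j)"
  unfolding annihilates_def
proof
  fix \<delta> assume d: "\<delta> \<in> Der K"
  have dd: "derivation \<delta>" using d by (auto simp: Der_def)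
  note dc = derivation_closed[OF dd]
  show "(\<Oplus>j\<in>{..<N}. (\<Oplus>a\<in>A. \<beta> a \<otimes> V a j) \<otimes> \<delta> (z j)) = \<zero>"
    using assms(2) V
  proof (induction A rule: finite_induct)
    case empty
    have "(\<Oplus>j\<in>{..<N}. (\<Oplus>a\<in>{}. \<beta> a \<otimes> V a j) \<otimes> \<delta> (z j)) = (\<Oplus>j\<in>{..<N}. \<zero>)"
      by (rule finsum_cong') (use dc c in auto)
    then show ?case by simp
  next
    case (insert a A)
    have sc: "(\<Oplus>a\<in>A. \<beta> a \<otimes> V a j) \<in> carrier R" for j using c by (intro finsum_closed) auto
    have "(\<Oplus>j\<in>{..<N}. (\<Oplus>a\<in>insert a A. \<beta> a \<otimes> V a j) \<otimes> \<delta> (z j)) =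
      (\<Oplus>j\<in>{..<N}. \<beta> a \<otimes> (V a j \<otimes> \<delta> (z j)) \<oplus> (\<Oplus>a\<in>A. \<beta> a \<otimes> V a j) \<otimes> \<delta> (z j))"
    proof (rule finsum_cong')
      fix j assume "j \<in> {..<N}"
      have "(\<Oplus>a\<in>insert a A. \<beta> a \<otimes> V a j) = \<beta> a \<otimes> V a j \<oplus> (\<Oplus>a\<in>A. \<beta> a \<otimes> V a j)"
        using insert.hyps c by (intro finsum_insert) auto
      then show "(\<Oplus>a\<in>insert a A. \<beta> a \<otimes> V a j) \<otimes> \<delta> (z j) =
        \<beta> a \<otimes> (V a j \<otimes> \<delta> (z j)) \<oplus> (\<Oplus>a\<in>A. \<beta> a \<otimes> V a j) \<otimes> \<delta> (z j)"
        using sc[of j] c dc by (simp add: l_distr m_assoc)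
    qed (use sc c dc in auto)
    also have "\<dots> = (\<Oplus>j\<in>{..<N}. \<beta> a \<otimes> (V a j \<otimes> \<delta> (z j))) \<oplus> (\<Oplus>j\<in>{..<N}. (\<Oplus>a\<in>A. \<beta> a \<otimes> V a j) \<otimes> \<delta> (z j))"
      by (rule finsum_addf) (use sc c dc in auto)
    also have "(\<Oplus>j\<in>{..<N}. (\<Oplus>a\<in>A. \<beta> a \<otimes> V a j) \<otimes> \<delta> (z j)) = \<zero>" using insert by auto
    also have "(\<Oplus>j\<in>{..<N}. \<beta> a \<otimes> (V a j \<otimes> \<delta> (z j))) = \<beta> a \<otimes> (\<Oplus>j\<in>{..<N}. V a j \<otimes> \<delta> (z j))"
      by (rule finsum_rdistr[symmetric]) (use c dc in auto)
    also have "(\<Oplus>j\<in>{..<N}. V a j \<otimes> \<delta> (z j)) = \<zero>" using insert.prems[of a] d by (auto simp: annihilates_def)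
    finally show ?case using c by simp
  qed
qed

lemma finsum_single:
  assumes "finite A" "b \<in> A" "\<And>a. a \<in> A \<Longrightarrow> a \<noteq> b \<Longrightarrow> f a = \<zero>" "f b \<in> carrier R"
  shows "(\<Oplus>a\<in>A. f a) = f b"
proof -
  have "f a \<in> carrier R" if "a \<in> A" for a using assms that by (cases "a = b") auto
  then have "(\<Oplus>a\<in>A. f a) = (\<Oplus>a\<in>{b}. f a)"
    by (intro add.finprod_mono_neutral_cong_right) (use assms in auto)
  then show ?thesis using assms(4) by simp
qed

text \<open>
  Write \<open>x\<^sub>i = z\<^sub>i\<close> and \<open>y\<^sub>i = z\<^sub>n\<^sub>+\<^sub>i\<close>. The hypothesis \<open>broad\<close> says that among the \<open>2|I|\<close> differentials \<open>dx\<^sub>i\<close>, \<open>dy\<^sub>i\<close> with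
  \<open>i \<in> I\<close> there are \<open>|I|\<close> independent ones, and \<open>free\<close> says that the \<open>c\<^sub>i\<close> are independent over the \<open>z\<^sub>j\<close>.
  Suppose that \<open>\<Sum>\<^sub>i \<mu>\<^sub>i (dy\<^sub>i - c\<^sub>i dx\<^sub>i) = 0\<close>, and let \<open>I\<close> be the support of \<open>\<mu>\<close>. Applying the derivations \<open>\<epsilon>\<^sub>a\<close>, \<open>a \<in> I\<close>,
  that kill all \<open>z\<^sub>j\<close> and satisfy \<open>\<epsilon>\<^sub>a(c\<^sub>i) = \<delta>\<^sub>a\<^sub>i\<close>, gives \<open>|I|\<close> more relations between the same \<open>2|I|\<close>
  differentials. The space of these relations has dimension at most \<open>|I|\<close>, so the \<open>|I| + 1\<close>
  relations are dependent, with coefficients \<open>\<beta>\<close>. The component of index \<open>n + i0\<close>, where \<open>\<mu> = 1\<close>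
  is constant, shows that the original relation has coefficient 0. In the other components,
  \<open>\<Sum>\<^sub>a \<beta>\<^sub>a \<epsilon>\<^sub>a(\<mu>\<^sub>i) = 0\<close> and \<open>\<Sum>\<^sub>a \<beta>\<^sub>a \<epsilon>\<^sub>a(\<mu>\<^sub>i c\<^sub>i) = 0\<close> combine to \<open>\<beta>\<^sub>i \<mu>\<^sub>i = 0\<close>.
\<close>

lemma no_normalized_relation:
  fixes n :: nat
  assumes K: "K \<subseteq> carrier R" and zc: "\<And>j. z j \<in> carrier R" and cc: "\<And>i. c i \<in> carrier R"
    and broad: "\<And>I. \<lbrakk>I \<subseteq> {..<n}; I \<noteq> {}\<rbrakk> \<Longrightarrow> \<exists>B\<subseteq>I \<union> (+) n ` I. card B = card I \<and>
      (\<forall>b\<in>B. \<exists>\<delta>\<in>Der K. \<forall>b'\<in>B. \<delta> (z b') = (if b' = b then \<one> else \<zero>))"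
    and free: "\<And>a. a < n \<Longrightarrow> \<exists>\<epsilon>\<in>Der K. (\<forall>j<n + n. \<epsilon> (z j) = \<zero>) \<and> (\<forall>i<n. \<epsilon> (c i) = (if i = a then \<one> else \<zero>))"
    and mc: "\<And>i. \<mu> i \<in> carrier R" and i0: "i0 < n" "\<mu> i0 = \<one>"
    and rel: "annihilates K (n + n) z (\<lambda>j. if j < n then \<ominus> (\<mu> j \<otimes> c j) else \<mu> (j - n))"
  shows False
proof -
  define V where "V j = (if j < n then \<ominus> (\<mu> j \<otimes> c j) else \<mu> (j - n))" for j
  have Vc: "V j \<in> carrier R" for j using mc cc by (simp add: V_def)
  define I where "I = {i. i < n \<and> \<mu> i \<noteq> \<zero>}"
  have I: "I \<subseteq> {..<n}" "finite I" "i0 \<in> I" using i0 by (auto simp: I_def)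
  obtain B where B: "B \<subseteq> I \<union> (+) n ` I" "card B = card I" and
    BD: "\<forall>b\<in>B. \<exists>\<delta>\<in>Der K. \<forall>b'\<in>B. \<delta> (z b') = (if b' = b then \<one> else \<zero>)"
    using broad[OF I(1)] I(3) by blast
  from free obtain \<epsilon> where \<epsilon>: "\<And>a. a < n \<Longrightarrow> \<epsilon> a \<in> Der K" "\<And>a j. \<lbrakk>a < n; j < n + n\<rbrakk> \<Longrightarrow> \<epsilon> a (z j) = \<zero>"
    "\<And>a i. \<lbrakk>a < n; i < n\<rbrakk> \<Longrightarrow> \<epsilon> a (c i) = (if i = a then \<one> else \<zero>)" by metis
  have \<epsilon>d: "derivation (\<epsilon> a)" if "a < n" for a using \<epsilon>(1)[OF that] by (simp add: Der_def)
  define J where "J = I \<union> (+) n ` I"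
  define A where "A = insert n I"
  have fJ: "finite J" and fA: "finite A" using I by (auto simp: J_def A_def)
  have cJ: "card J = card I + card I"
    unfolding J_def using I by (subst card_Un_disjoint) (auto simp: card_image)
  have BJ: "B \<subseteq> J" using B by (simp add: J_def)
  have JN: "J \<subseteq> {..<n + n}" using I by (auto simp: J_def)
  have nI: "n \<notin> I" using I by auto
  have "card (J - B) = card I"
    using card_Diff_subset[OF finite_subset[OF BJ fJ] BJ] cJ B(2) by simp
  then have cc': "card (J - B) < card A" using nI I(2) by (simp add: A_def)
  \<comment> \<open>The index \<open>n\<close>, which is not in \<open>I\<close>, stands for the original relation.\<close>
  define U where "U a = (if a < n then (\<lambda>j. \<epsilon> a (V j)) else V)" for a
  have Uc: "U a j \<in> carrier R" for a j using Vc derivation_closed[OF \<epsilon>d] by (simp add: U_def)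
  have UA: "annihilates K (n + n) z (U a)" for a
    using annihilates_derivation[OF rel[folded V_def] \<epsilon>(1) \<epsilon>(2) Vc zc K] rel[folded V_def]
    by (auto simp: U_def)
  obtain \<beta> where \<beta>: "\<And>a. \<beta> a \<in> carrier R" "\<exists>a\<in>A. \<beta> a \<noteq> \<zero>" "\<forall>j\<in>J - B. (\<Oplus>a\<in>A. \<beta> a \<otimes> U a j) = \<zero>"
    using relation_if_more_rows[of "J - B" A U, OF _ fA cc' Uc] fJ by auto
  define W where "W j = (\<Oplus>a\<in>A. \<beta> a \<otimes> U a j)" for j
  have Wc: "W j \<in> carrier R" for j unfolding W_def using \<beta>(1) Uc by (intro finsum_closed) auto
  have WA: "annihilates K (n + n) z W"
    unfolding W_def by (rule annihilates_combination[OF UA fA Uc zc \<beta>(1)])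
  have V0: "V j = \<zero>" if "j < n + n" "j \<notin> J" for j
  proof (cases "j < n")
    case True
    then have "\<mu> j = \<zero>" using that by (auto simp: J_def I_def)
    then show ?thesis using True cc by (simp add: V_def)
  next
    case False
    then have "j - n < n" "j = n + (j - n)" using that by auto
    then have "\<mu> (j - n) = \<zero>" using that(2) unfolding J_def I_def by blast
    then show ?thesis using False by (simp add: V_def)
  qed
  have W0: "W j = \<zero>" if "j < n + n" "j \<notin> B" for j
  proof (cases "j \<in> J")
    case True
    then show ?thesis using \<beta>(3) that by (simp add: W_def)
  next
    case False
    have "U a j = \<zero>" for a using V0[OF that(1) False] derivation_zero[OF \<epsilon>d] by (simp add: U_def)
    then have "W j = (\<Oplus>a\<in>A. \<zero>)" unfolding W_def using \<beta>(1) by (intro finsum_cong') auto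
    then show ?thesis by simp
  qed
  \<comment> \<open>Only coordinates in \<open>B\<close> are left in \<open>W\<close>, and their differentials are independent.\<close>
  have WB: "W b = \<zero>" if b: "b \<in> B" for b
  proof -
    obtain \<delta> where \<delta>: "\<delta> \<in> Der K" "\<forall>b'\<in>B. \<delta> (z b') = (if b' = b then \<one> else \<zero>)" using BD b by blast
    have dc: "\<delta> (z j) \<in> carrier R" for j using \<delta>(1) zc derivation_closed by (auto simp: Der_def)
    have "(\<Oplus>j\<in>{..<n + n}. W j \<otimes> \<delta> (z j)) = W b \<otimes> \<delta> (z b)"
    proof (rule finsum_single)
      show "b \<in> {..<n + n}" using b BJ JN by blast
      fix j assume j: "j \<in> {..<n + n}" "j \<noteq> b"
      show "W j \<otimes> \<delta> (z j) = \<zero>"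
        using j \<delta>(2) Wc dc W0[of j] by (cases "j \<in> B") auto
    qed (use Wc dc in auto)
    then show ?thesis using WA \<delta> b Wc by (auto simp: annihilates_def)
  qed
  have W00: "W j = \<zero>" if "j < n + n" for j using W0[OF that] WB by (cases "j \<in> B") auto
  have In: "i < n" if "i \<in> I" for i using that I by auto
  have \<beta>n: "\<beta> n = \<zero>"
  proof -
    have "W (n + i0) = \<beta> n \<otimes> U n (n + i0)"
      unfolding W_def
    proof (rule finsum_single[OF fA])
      show "n \<in> A" by (simp add: A_def)
      fix a assume a: "a \<in> A" "a \<noteq> n"
      then have "a < n" using In by (auto simp: A_def)
      then have "U a (n + i0) = \<zero>" using i0 derivation_one[OF \<epsilon>d] by (simp add: U_def V_def)
      then show "\<beta> a \<otimes> U a (n + i0) = \<zero>" using \<beta>(1) by simp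
    qed (use \<beta>(1) Uc in auto)
    then show ?thesis using W00[of "n + i0"] i0 \<beta>(1) by (simp add: U_def V_def)
  qed
  have split: "W j = (\<Oplus>a\<in>I. \<beta> a \<otimes> \<epsilon> a (V j))" for j
  proof -
    have "W j = \<beta> n \<otimes> U n j \<oplus> (\<Oplus>a\<in>I. \<beta> a \<otimes> U a j)"
      unfolding W_def A_def using nI I(2) \<beta>(1) Uc by (intro finsum_insert) auto
    moreover have "(\<Oplus>a\<in>I. \<beta> a \<otimes> U a j) = (\<Oplus>a\<in>I. \<beta> a \<otimes> \<epsilon> a (V j))"
      by (rule finsum_cong') (use In \<beta>(1) Uc derivation_closed[OF \<epsilon>d] Vc in \<open>auto simp: U_def\<close>)
    moreover have "(\<Oplus>a\<in>I. \<beta> a \<otimes> \<epsilon> a (V j)) \<in> carrier R"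
      using In \<beta>(1) derivation_closed[OF \<epsilon>d] Vc by (intro finsum_closed) auto
    ultimately show ?thesis using \<beta>n Uc by simp
  qed
  have \<epsilon>c: "\<epsilon> a x \<in> carrier R" if "a \<in> I" "x \<in> carrier R" for a x using derivation_closed[OF \<epsilon>d[OF In[OF that(1)]] that(2)] .
  have "\<beta> i = \<zero>" if i: "i \<in> I" for i
  proof -
    have p: "(\<Oplus>a\<in>I. \<beta> a \<otimes> \<epsilon> a (\<mu> i)) = \<zero>" using W00[of "n + i"] In[OF i] by (simp add: split V_def)
    have q: "(\<Oplus>a\<in>I. \<beta> a \<otimes> \<epsilon> a (\<ominus> (\<mu> i \<otimes> c i))) = \<zero>" using W00[of i] In[OF i] by (simp add: split V_def)
    have e: "\<beta> a \<otimes> \<epsilon> a (\<ominus> (\<mu> i \<otimes> c i)) = (if a = i then \<beta> i \<otimes> \<ominus> \<mu> i else \<zero>) \<oplus> (\<beta> a \<otimes> \<epsilon> a (\<mu> i)) \<otimes> \<ominus> c i"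
      if a: "a \<in> I" for a
    proof -
      note d = \<epsilon>d[OF In[OF a]]
      have "\<epsilon> a (\<ominus> (\<mu> i \<otimes> c i)) = \<ominus> (\<mu> i \<otimes> (if i = a then \<one> else \<zero>) \<oplus> \<epsilon> a (\<mu> i) \<otimes> c i)"
        using derivation_minus[OF d] derivation_mult[OF d mc cc] mc cc \<epsilon>(3)[OF In[OF a] In[OF i]] by simp
      then show ?thesis using \<epsilon>c[OF a mc] \<beta>(1) mc cc
        by (cases "a = i") (simp_all add: minus_add r_distr r_minus l_minus m_assoc)
    qed
    have "\<zero> = (\<Oplus>a\<in>I. \<beta> a \<otimes> \<epsilon> a (\<ominus> (\<mu> i \<otimes> c i)))" by (rule q[symmetric])
    also have "\<dots> = (\<Oplus>a\<in>I. (if a = i then \<beta> i \<otimes> \<ominus> \<mu> i else \<zero>) \<oplus> (\<beta> a \<otimes> \<epsilon> a (\<mu> i)) \<otimes> \<ominus> c i)"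
      by (rule finsum_cong') (use e \<epsilon>c mc cc \<beta>(1) in auto)
    also have "\<dots> = (\<Oplus>a\<in>I. if a = i then \<beta> i \<otimes> \<ominus> \<mu> i else \<zero>) \<oplus> (\<Oplus>a\<in>I. (\<beta> a \<otimes> \<epsilon> a (\<mu> i)) \<otimes> \<ominus> c i)"
      by (rule finsum_addf) (use \<epsilon>c mc cc \<beta>(1) in auto)
    also have "(\<Oplus>a\<in>I. (\<beta> a \<otimes> \<epsilon> a (\<mu> i)) \<otimes> \<ominus> c i) = (\<Oplus>a\<in>I. \<beta> a \<otimes> \<epsilon> a (\<mu> i)) \<otimes> \<ominus> c i"
      by (rule finsum_ldistr[symmetric]) (use I(2) \<epsilon>c mc cc \<beta>(1) in auto)
    also have "(\<Oplus>a\<in>I. if a = i then \<beta> i \<otimes> \<ominus> \<mu> i else \<zero>) = \<beta> i \<otimes> \<ominus> \<mu> i"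
      by (subst finsum_single[OF I(2) i]) (use \<beta>(1) mc in auto)
    finally have "\<beta> i \<otimes> \<ominus> \<mu> i = \<zero>" unfolding p using \<beta>(1) mc cc by simp
    then have "\<beta> i = \<zero> \<or> \<ominus> \<mu> i = \<zero>" using integral[of "\<beta> i" "\<ominus> \<mu> i"] \<beta>(1) mc by blast
    moreover have "\<ominus> \<mu> i \<noteq> \<zero>" using i mc[of i] minus_minus[of "\<mu> i"] by (auto simp: I_def)
    ultimately show ?thesis by blast
  qed
  then show False using \<beta>(2) \<beta>n by (auto simp: A_def)
qed

text \<open>
  The derivations that agree with \<open>\<Delta>\<close> on \<open>K\<close> are the \<open>\<Delta> + \<delta>\<close> with \<open>\<delta>\<close> in \<open>Der K\<close>. Hence the equations
  \<open>\<delta>(y\<^sub>i) = c\<^sub>i \<delta>(x\<^sub>i)\<close> are an inhomogeneous linear system on \<open>Der K\<close>, whose left-hand sides satisfy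
  no linear relation.
\<close>

theorem derivation_solving_first_order:
  fixes n :: nat
  assumes K: "K \<subseteq> carrier R" and zc: "\<And>j. z j \<in> carrier R" and cc: "\<And>i. c i \<in> carrier R"
    and broad: "\<And>I. \<lbrakk>I \<subseteq> {..<n}; I \<noteq> {}\<rbrakk> \<Longrightarrow> \<exists>B\<subseteq>I \<union> (+) n ` I. card B = card I \<and>
      (\<forall>b\<in>B. \<exists>\<delta>\<in>Der K. \<forall>b'\<in>B. \<delta> (z b') = (if b' = b then \<one> else \<zero>))"
    and free: "\<And>a. a < n \<Longrightarrow> \<exists>\<epsilon>\<in>Der K. (\<forall>j<n + n. \<epsilon> (z j) = \<zero>) \<and> (\<forall>i<n. \<epsilon> (c i) = (if i = a then \<one> else \<zero>))"
    and \<Delta>: "derivation \<Delta>"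
  shows "\<exists>\<delta>. derivation \<delta> \<and> (\<forall>a\<in>K. \<delta> a = \<Delta> a) \<and> (\<forall>i<n. \<delta> (z (n + i)) = c i \<otimes> \<delta> (z i))"
proof -
  let ?t = "\<lambda>\<delta> i. \<delta> (z (n + i)) \<oplus> \<ominus> (c i \<otimes> \<delta> (z i))"
  let ?T = "?t ` Der K"
  have dc: "\<delta> x \<in> carrier R" if "\<delta> \<in> Der K" "x \<in> carrier R" for \<delta> x
    using that derivation_closed by (auto simp: Der_def)
  have tc: "?t \<delta> i \<in> carrier R" if "\<delta> \<in> Der K" for \<delta> i using dc[OF that] zc cc by simp
  let ?g = "\<lambda>i. \<ominus> (?t \<Delta> i)"
  have gc: "?g i \<in> carrier R" for i using derivation_closed[OF \<Delta>] zc cc by simp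
  have "\<exists>t\<in>?T. \<forall>i\<in>{..<n}. t i = ?g i"
  proof (rule surjective_if_no_relation)
    show "(\<lambda>k. t k \<oplus> a \<otimes> u k) \<in> ?T" if tu: "t \<in> ?T" "u \<in> ?T" and a: "a \<in> carrier R" for t u a
    proof -
      obtain d e where d: "d \<in> Der K" "t = ?t d" and e: "e \<in> Der K" "u = ?t e" using tu by blast
      have mem: "(\<lambda>x. d x \<oplus> a \<otimes> e x) \<in> Der K"
        using d e a derivation_combine[of d e a] by (auto simp: Der_def)
      have "?t (\<lambda>x. d x \<oplus> a \<otimes> e x) = (\<lambda>k. t k \<oplus> a \<otimes> u k)"
        using dc[OF d(1) zc] dc[OF e(1) zc] cc a unfolding d(2) e(2)
        by (auto simp: minus_add r_distr r_minus a_ac m_ac)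
      then show ?thesis using mem by (rule image_eqI[OF sym])
    qed
    show "t k \<in> carrier R" if "t \<in> ?T" for t k using that tc by auto
    have "(\<lambda>_. \<zero>) \<in> Der K" by (simp add: Der_def derivation_def)
    then show "?T \<noteq> {}" by blast
    fix l i
    assume lc: "\<And>i. l i \<in> carrier R" and rel: "\<And>t. t \<in> ?T \<Longrightarrow> (\<Oplus>i\<in>{..<n}. l i \<otimes> t i) = \<zero>" and i: "i \<in> {..<n}"
    show "l i = \<zero>"
    proof (rule ccontr)
      assume nz: "l i \<noteq> \<zero>"
      then have u: "l i \<in> Units R" using lc field_Units by auto
      define r where "r = inv (l i)"
      have r: "r \<in> carrier R" "r \<otimes> l i = \<one>" using u Units_l_inv[OF u] by (auto simp: r_def)
      define \<mu> where "\<mu> k = r \<otimes> l k" for k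
      have mc: "\<mu> k \<in> carrier R" for k using r lc by (simp add: \<mu>_def)
      have "annihilates K (n + n) z (\<lambda>j. if j < n then \<ominus> (\<mu> j \<otimes> c j) else \<mu> (j - n))"
        unfolding annihilates_def
      proof
        fix \<delta> assume d: "\<delta> \<in> Der K"
        let ?f = "\<lambda>j. (if j < n then \<ominus> (\<mu> j \<otimes> c j) else \<mu> (j - n)) \<otimes> \<delta> (z j)"
        have "(\<Oplus>j\<in>{..<n + n}. ?f j) = (\<Oplus>i\<in>{..<n}. ?f i) \<oplus> (\<Oplus>i\<in>{..<n}. ?f (n + i))"
          by (rule finsum_split_double) (use mc cc dc[OF d zc] in auto)
        also have "\<dots> = (\<Oplus>i\<in>{..<n}. ?f i \<oplus> ?f (n + i))"
          by (rule finsum_addf[symmetric]) (use mc cc dc[OF d zc] in auto)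
        also have "\<dots> = (\<Oplus>i\<in>{..<n}. r \<otimes> (l i \<otimes> ?t \<delta> i))"
        proof (rule finsum_cong')
          fix k assume "k \<in> {..<n}"
          then show "?f k \<oplus> ?f (n + k) = r \<otimes> (l k \<otimes> ?t \<delta> k)"
            using mc cc lc r(1) dc[OF d zc] by (simp add: \<mu>_def r_distr r_minus l_minus m_assoc a_comm)
        qed (use r lc tc[OF d] in auto)
        also have "\<dots> = r \<otimes> (\<Oplus>i\<in>{..<n}. l i \<otimes> ?t \<delta> i)"
          by (rule finsum_rdistr[symmetric]) (use r lc tc[OF d] in auto)
        also have "\<dots> = \<zero>" using rel[of "?t \<delta>"] d r by simp
        finally show "(\<Oplus>j\<in>{..<n + n}. ?f j) = \<zero>" .
      qed
      moreover have "\<mu> i = \<one>" using r by (simp add: \<mu>_def)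
      ultimately show False
        using i by (intro no_normalized_relation[of K z c n \<mu> i, OF K zc cc broad free mc]) auto
    qed
  qed (use gc in auto)
  then obtain \<delta>0 where d0: "\<delta>0 \<in> Der K" "\<And>i. i < n \<Longrightarrow> ?t \<delta>0 i = ?g i" by auto
  have d0d: "derivation \<delta>0" using d0 by (simp add: Der_def)
  let ?\<delta> = "\<lambda>x. \<Delta> x \<oplus> \<one> \<otimes> \<delta>0 x"
  have "derivation ?\<delta>" by (rule derivation_combine[OF \<Delta> d0d one_closed])
  moreover have "\<forall>a\<in>K. ?\<delta> a = \<Delta> a"
    using d0 K derivation_closed[OF \<Delta>] by (auto simp: Der_def)
  moreover have "?\<delta> (z (n + i)) = c i \<otimes> ?\<delta> (z i)" if i: "i < n" for i
  proof -
    let ?a = "\<Delta> (z (n + i))" and ?b = "\<Delta> (z i)" and ?a' = "\<delta>0 (z (n + i))" and ?b' = "\<delta>0 (z i)"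
    have cl: "?a \<in> carrier R" "?b \<in> carrier R" "?a' \<in> carrier R" "?b' \<in> carrier R" "c i \<in> carrier R"
      using derivation_closed[OF \<Delta>] dc[OF d0(1)] zc cc by auto
    have "(?a' \<oplus> \<ominus> (c i \<otimes> ?b')) \<oplus> (?a \<oplus> \<ominus> (c i \<otimes> ?b)) = \<zero>"
      using d0(2)[OF i] cl by (simp add: l_neg)
    moreover have "(?a' \<oplus> \<ominus> (c i \<otimes> ?b')) \<oplus> (?a \<oplus> \<ominus> (c i \<otimes> ?b)) = (?a \<oplus> ?a') \<ominus> c i \<otimes> (?b \<oplus> ?b')"
      using cl by (simp add: minus_eq r_distr minus_add a_ac)
    ultimately show ?thesis using cl by simp
  qed
  ultimately show ?thesis by blast
qed

end

section \<open>Derivations at a generic point\<close>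

context generic_point
begin

text \<open>
  Transcendental elements are added one at a time to the subring on which the derivation is
  prescribed.
\<close>

lemma derivation_on_free_coordinates:
  assumes "finite B" "B \<inter> C0 = {}"
    and tr: "\<And>j C. \<lbrakk>j \<in> B; C \<subseteq> (C0 \<union> B) - {j}\<rbrakk> \<Longrightarrow> L.transcendental_over (\<Phi> ` poly_fun C) (\<xi> j)"
    and v: "\<And>j. v j \<in> carrier L"
  shows "\<exists>\<delta>\<in>L.Der (\<kappa> ` carrier R). (\<forall>c\<in>C0. \<delta> (\<xi> c) = \<zero>\<^bsub>L\<^esub>) \<and> (\<forall>j\<in>B. \<delta> (\<xi> j) = v j)"
  using assms(1-3)
proof (induction B rule: finite_induct)
  case empty
  have "(\<lambda>_. \<zero>\<^bsub>L\<^esub>) \<in> L.Der (\<kappa> ` carrier R)" by (simp add: L.Der_def L.derivation_def)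
  then show ?case by (intro bexI[of _ "\<lambda>_. \<zero>\<^bsub>L\<^esub>"]) auto
next
  case (insert j B)
  have "\<exists>\<delta>\<in>L.Der (\<kappa> ` carrier R). (\<forall>c\<in>C0. \<delta> (\<xi> c) = \<zero>\<^bsub>L\<^esub>) \<and> (\<forall>j\<in>B. \<delta> (\<xi> j) = v j)"
  proof (rule insert.IH)
    show "B \<inter> C0 = {}" using insert.prems(1) by auto
    show "L.transcendental_over (\<Phi> ` poly_fun C) (\<xi> k)" if "k \<in> B" "C \<subseteq> C0 \<union> B - {k}" for k C
      using insert.prems(2)[of k C] that by auto
  qed
  then obtain \<delta> where \<delta>: "\<delta> \<in> L.Der (\<kappa> ` carrier R)" "\<forall>c\<in>C0. \<delta> (\<xi> c) = \<zero>\<^bsub>L\<^esub>" "\<forall>j\<in>B. \<delta> (\<xi> j) = v j" by blast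
  have dd: "L.derivation \<delta>" using \<delta>(1) by (simp add: L.Der_def)
  have "L.transcendental_over (\<Phi> ` poly_fun (C0 \<union> B)) (\<xi> j)"
    using insert.prems insert.hyps by auto
  then obtain \<delta>' where \<delta>': "L.derivation \<delta>'" "\<forall>x\<in>\<Phi> ` poly_fun (C0 \<union> B). \<delta>' x = \<delta> x" "\<delta>' (\<xi> j) = v j"
    using L.derivation_prescribe[OF L_char_zero subring_poly_fun dd \<xi>_closed _ v] by blast
  have "\<delta>' (\<xi> k) = \<delta> (\<xi> k)" if "k \<in> C0 \<union> B" for k
    using \<delta>'(2) poly_fun_var[OF that] unfolding \<xi>_def by blast
  moreover have "\<delta>' (\<kappa> a) = \<zero>\<^bsub>L\<^esub>" if "a \<in> carrier R" for a
  proof -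
    have "\<delta>' (\<kappa> a) = \<delta> (\<kappa> a)" using \<delta>'(2) poly_fun.poly_fun_const[OF that] unfolding \<kappa>_def by blast
    then show ?thesis using \<delta>(1) that by (auto simp: L.Der_def)
  qed
  ultimately show ?case using \<delta> \<delta>' by (intro bexI[of _ \<delta>']) (auto simp: L.Der_def)
qed

lemma alg_indep_transcendental:
  assumes "alg_indep B W" "j \<in> B" "C \<subseteq> B - {j}"
  shows "L.transcendental_over (\<Phi> ` poly_fun C) (\<xi> j)"
proof (rule \<xi>_transcendental)
  show "j \<notin> C" using assms by auto
  fix g w s assume g: "g \<in> poly_fun (insert j C)" "\<And>w. w \<in> W \<Longrightarrow> g w = \<zero>" and w: "w \<in> W" "s \<in> carrier R"
  have "g \<in> poly_fun B" using poly_fun_mono[OF g(1)] assms by auto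
  then have "\<forall>w\<in>points. g w = \<zero>" using assms(1) g(2) unfolding alg_indep_def by blast
  moreover have "w(j := s) \<in> points" using w W_points points_upd by blast
  ultimately show "g (w(j := s)) = \<zero>" by blast
qed

lemma \<Phi>_mpoly_eval:
  assumes P: "P \<in> indexed_pset I (carrier R)"
  shows "L.mpoly_eval (\<kappa> \<circ> P) \<xi> = \<Phi> (mpoly_eval P)"
  using P
proof (induction rule: indexed_pset.induct)
  note r = R.ring_axioms L.ring_axioms \<kappa>_hom
  {
    case (indexed_const k)
    have "\<Phi> (mpoly_eval (indexed_const k)) = \<kappa> k"
      unfolding \<kappa>_def using mpoly_eval_poly_fun[OF indexed_pset.indexed_const[OF indexed_const]] indexed_const W_points
      by (intro \<Phi>_cong) (auto intro: poly_fun_UNIV poly_fun.poly_fun_const simp: mpoly_eval_const points_def subset_iff)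
    then show ?case unfolding ring_hom_indexed(1)[OF r indexed_const]
      using L.mpoly_eval_const[of _ \<xi>, OF \<kappa>_closed[OF indexed_const] \<xi>_closed] by simp
  next
    case (indexed_padd P Q)
    have p: "mpoly_eval P \<in> poly_fun UNIV" "mpoly_eval Q \<in> poly_fun UNIV" "mpoly_eval (P \<Oplus> Q) \<in> poly_fun UNIV"
      by (rule poly_fun_UNIV[OF mpoly_eval_poly_fun[OF indexed_padd(1)]], rule poly_fun_UNIV[OF mpoly_eval_poly_fun[OF indexed_padd(2)]],
          rule poly_fun_UNIV[OF mpoly_eval_poly_fun[OF indexed_pset.indexed_padd[OF indexed_padd(1,2)]]])
    have "\<Phi> (mpoly_eval (P \<Oplus> Q)) = \<Phi> (\<lambda>w. mpoly_eval P w \<oplus> mpoly_eval Q w)"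
      using W_points p mpoly_eval_padd[OF indexed_padd(1,2)]
      by (intro \<Phi>_cong) (auto intro: poly_fun.poly_fun_add simp: points_def subset_iff)
    also have "\<dots> = \<Phi> (mpoly_eval P) \<oplus>\<^bsub>L\<^esub> \<Phi> (mpoly_eval Q)" by (rule \<Phi>_add[OF p(1,2)])
    finally show ?case unfolding ring_hom_indexed(2)[OF r indexed_padd(1,2)]
      using L.mpoly_eval_padd[of _ I _ \<xi>, OF ring_hom_indexed_pset[OF r indexed_padd(1)] ring_hom_indexed_pset[OF r indexed_padd(2)] \<xi>_closed]
        indexed_padd by (simp del: o_apply)
  next
    case (indexed_pmult P i)
    have p: "mpoly_eval P \<in> poly_fun UNIV" "mpoly_eval (P \<Otimes> i) \<in> poly_fun UNIV"
      by (rule poly_fun_UNIV[OF mpoly_eval_poly_fun[OF indexed_pmult(1)]],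
          rule poly_fun_UNIV[OF mpoly_eval_poly_fun[OF indexed_pset.indexed_pmult[OF indexed_pmult(1,2)]]])
    have "\<Phi> (mpoly_eval (P \<Otimes> i)) = \<Phi> (\<lambda>w. mpoly_eval P w \<otimes> w i)"
      using W_points p mpoly_eval_pmult[OF indexed_pmult(1)]
      by (intro \<Phi>_cong) (auto intro: poly_fun.poly_fun_var_mult simp: points_def subset_iff)
    also have "\<dots> = \<Phi> (mpoly_eval P) \<otimes>\<^bsub>L\<^esub> \<xi> i" using \<Phi>_mult[OF p(1) poly_fun_var[of i UNIV]] by (simp add: \<xi>_def)
    finally show ?case unfolding ring_hom_indexed(3)[OF r]
      using L.mpoly_eval_pmult[of _ I \<xi>, OF ring_hom_indexed_pset[OF r indexed_pmult(1)] \<xi>_closed] indexed_pmult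
      by (simp del: o_apply)
  }
qed

end

section \<open>Broad varieties\<close>

text \<open>
  The map \<open>\<theta>\<close> sends the coordinates of the projection to those of the ambient space; independence on the
  projection is transported along it by substitution.
\<close>

lemma (in field) j_broad_alg_indep:
  assumes ch: "char_zero" and V: "j_broad n V" and I: "I \<subseteq> {..<n}" "I \<noteq> {}"
  shows "\<exists>B\<subseteq>I \<union> (+) n ` I. card B = card I \<and> alg_indep B (cylinder (2 * n) V)"
proof -
  define il where "il = sorted_list_of_set I"
  define k where "k = length il"
  have fI: "finite I" using I finite_subset by blast
  have il: "set il = I" "sorted_wrt (<) il" "distinct il" "k = card I" "il \<noteq> []"
    using fI I(2) by (auto simp: il_def k_def)
  have Va: "V \<subseteq> affine_space (2 * n)" using V irreducible_affine unfolding j_broad_def by blast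
  define \<theta> where "\<theta> r = (if r < k then il ! r else n + il ! (r - k))" for r
  have isn: "il ! r < n" "il ! r \<in> I" if "r < k" for r using il(1) I(1) that nth_mem[of r "il"] by (auto simp: k_def)
  have \<theta>n: "\<theta> r < 2 * n" if "r < 2 * k" for r
  proof (cases "r < k")
    case True
    then show ?thesis using isn(1)[of r] by (simp add: \<theta>_def)
  next
    case False
    then show ?thesis using that isn(1)[of "r - k"] by (simp add: \<theta>_def)
  qed
  have proj: "coord_proj n il p = map (\<lambda>r. p ! \<theta> r) [0..<2 * k]" for p :: "'a list"
    by (rule nth_equalityI) (auto simp: coord_proj_def \<theta>_def nth_append k_def)
  have inj: "inj_on \<theta> {..<2 * k}"
  proof (rule inj_onI)
    fix r s assume rs: "r \<in> {..<2 * k}" "s \<in> {..<2 * k}" "\<theta> r = \<theta> s"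
    show "r = s"
    proof (cases "r < k"; cases "s < k")
      assume "r < k" "s < k"
      then show ?thesis using rs il(3) by (simp add: \<theta>_def k_def nth_eq_iff_index_eq)
    next
      assume "r < k" "\<not> s < k"
      then show ?thesis using rs isn(1)[of r] by (simp add: \<theta>_def)
    next
      assume "\<not> r < k" "s < k"
      then show ?thesis using rs isn(1)[of s] by (simp add: \<theta>_def)
    next
      assume h: "\<not> r < k" "\<not> s < k"
      then have "il ! (r - k) = il ! (s - k)" "r - k < k" "s - k < k" using rs by (auto simp: \<theta>_def)
      then have "r - k = s - k" using il(3) by (simp add: k_def nth_eq_iff_index_eq)
      then show ?thesis using h by simp
    qed
  qed
  have pa: "coord_proj n il ` V \<subseteq> affine_space (2 * k)"
    using Va \<theta>n unfolding proj by (auto simp: affine_space_def subset_iff)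
  have "enat k \<le> zariski_dim (2 * k) (coord_proj n il ` V)"
    using V il I unfolding j_broad_def k_def by blast
  moreover have "k > 0" using il(5) by (simp add: k_def)
  ultimately obtain B0 where B0: "B0 \<subseteq> {..<2 * k}" "card B0 = k" "alg_indep B0 (cylinder (2 * k) (coord_proj n il ` V))"
    using zariski_dim_alg_indep[OF ch _ _ pa] by blast
  define B where "B = \<theta> ` B0"
  have injB: "inj_on \<theta> B0" using inj B0(1) inj_on_subset by blast
  have "card B = card I" using card_image[OF injB] B0(2) il(4) by (simp add: B_def)
  moreover have "B \<subseteq> I \<union> (+) n ` I"
  proof
    fix b assume "b \<in> B"
    then obtain r where r: "r < 2 * k" "b = \<theta> r" using B0(1) by (auto simp: B_def)
    then show "b \<in> I \<union> (+) n ` I" using isn(2)[of r] isn(2)[of "r - k"] by (cases "r < k") (auto simp: \<theta>_def)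
  qed
  moreover have "alg_indep B (cylinder (2 * n) V)"
    unfolding alg_indep_def
  proof (intro ballI impI)
    fix g w assume g: "g \<in> poly_fun B" "\<forall>w\<in>cylinder (2 * n) V. g w = \<zero>" and w: "w \<in> points"
    \<comment> \<open>Substituting along the inverse of \<open>\<theta>\<close>; \<open>g\<close> depends only on the coordinates in \<open>B\<close>.\<close>
    define h where "h i = (if i \<in> B then (\<lambda>u. u (the_inv_into B0 \<theta> i)) else (\<lambda>_. \<zero>))" for i and u :: "nat \<Rightarrow> 'a"
    have hp: "h i \<in> poly_fun B0" for i
      using the_inv_into_into[OF injB, of i B0] by (auto simp: h_def B_def intro: poly_fun_var poly_fun.poly_fun_const)
    have h\<theta>: "h (\<theta> r) u = u r" if "r \<in> B0" for r and u :: "nat \<Rightarrow> 'a"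
      using the_inv_into_f_f[OF injB that] that by (simp add: h_def B_def)
    have hpts: "(\<lambda>i. h i u) \<in> points" if "u \<in> points" for u using poly_fun_closed[OF hp that] by (simp add: points_def)
    let ?f = "\<lambda>u. g (\<lambda>i. h i u)"
    have f: "?f \<in> poly_fun B0" by (rule poly_fun_subst[OF g(1) hp])
    have gf: "?f u = g v" if "u \<in> points" "v \<in> points" "\<And>r. r \<in> B0 \<Longrightarrow> v (\<theta> r) = u r" for u v
      by (rule poly_fun_cong[OF g(1) hpts[OF that(1)] that(2)]) (use that(3) h\<theta> in \<open>auto simp: B_def\<close>)
    have "?f u = \<zero>" if u: "u \<in> cylinder (2 * k) (coord_proj n il ` V)" for u
    proof -
      obtain p where p: "p \<in> V" "map u [0..<2 * k] = coord_proj n il p" using u by (auto simp: cylinder_def)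
      have up: "u \<in> points" using u cylinder_points by blast
      have pA: "p \<in> affine_space (2 * n)" using p Va by blast
      have eq: "u r = p ! \<theta> r" if "r < 2 * k" for r
        using arg_cong[OF p(2), of "\<lambda>l. l ! r"] that unfolding proj by simp
      have "?f u = g (ext_pt (2 * n) p)"
        by (rule gf[OF up ext_pt_points[OF pA]]) (use B0(1) eq \<theta>n in \<open>auto simp: ext_pt_def\<close>)
      then show ?thesis using g(2) ext_pt_cylinder[OF p(1) pA] by simp
    qed
    then have "\<forall>u\<in>cylinder (2 * k) (coord_proj n il ` V). ?f u = \<zero>" by (rule ballI)
    with bspec[OF B0(3)[unfolded alg_indep_def] f] have all: "\<forall>u\<in>points. ?f u = \<zero>" by (rule mp)
    have wp: "(\<lambda>r. w (\<theta> r)) \<in> points" using w by (simp add: points_def)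
    show "g w = \<zero>" using gf[OF wp w] bspec[OF all wp] by simp
  qed
  ultimately show ?thesis by blast
qed

lemma (in field) Psi_solvable:
  assumes "{y0, y1, y2} \<subseteq> carrier R" "y1 \<noteq> \<zero>" "y0 \<noteq> \<zero>" "y0 \<noteq> [(1728::nat)] \<cdot> \<one>" and ch: "char_zero"
  shows "\<exists>y3\<in>carrier R. Psi y0 y1 y2 y3 = \<zero>"
proof -
  have y: "y0 \<in> carrier R" "y1 \<in> carrier R" "y2 \<in> carrier R" using assms by auto
  have u1: "y1 \<in> Units R" using y assms field_Units by auto
  have two: "[(2::nat)] \<cdot> \<one> \<in> Units R" using ch field_Units by (auto simp: char_zero_def)
  let ?e = "y0 [^] (2::nat) \<otimes> (y0 \<ominus> [(1728::nat)] \<cdot> \<one>) [^] (2::nat)"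
  have dc: "y0 \<ominus> [(1728::nat)] \<cdot> \<one> \<in> carrier R" using y by simp
  have "y0 \<ominus> [(1728::nat)] \<cdot> \<one> \<noteq> \<zero>" using assms(4) y by simp
  then have "?e \<noteq> \<zero>" using assms(3) y dc by (simp add: numeral_2_eq_2 integral_iff)
  moreover have ec: "?e \<in> carrier R" using y dc by simp
  ultimately have "[(2::nat)] \<cdot> ?e \<noteq> \<zero>" using nat_mult_eq_zero[OF ch ec, of 2] by auto
  then have ue: "[(2::nat)] \<cdot> ?e \<in> Units R" using ec field_Units by auto
  define A where "A = ([(3::nat)] \<cdot> \<one> \<otimes> inv ([(2::nat)] \<cdot> \<one>)) \<otimes> (y2 \<otimes> inv y1) [^] (2::nat)"
  define B where "B = ((y0 [^] (2::nat) \<ominus> [(1968::nat)] \<cdot> y0 \<oplus> [(2654208::nat)] \<cdot> \<one>) \<otimes> inv ([(2::nat)] \<cdot> ?e)) \<otimes> y1 [^] (2::nat)"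
  have c: "A \<in> carrier R" "B \<in> carrier R" using y u1 two ue by (auto simp: A_def B_def)
  have "(A \<ominus> B) \<otimes> y1 \<otimes> inv y1 = A \<ominus> B" using c u1 y by (simp add: m_assoc)
  then have "Psi y0 y1 y2 ((A \<ominus> B) \<otimes> y1) = (A \<ominus> B) \<ominus> A \<oplus> B"
    unfolding Psi_def A_def[symmetric] B_def[symmetric] by simp
  also have "\<dots> = \<zero>"
  proof -
    have "(A \<ominus> B) \<ominus> A \<oplus> B = (A \<oplus> \<ominus> A) \<oplus> (\<ominus> B \<oplus> B)" using c by (simp add: minus_eq a_ac)
    then show ?thesis using c by (simp add: l_neg r_neg)
  qed
  finally show ?thesis using c y by (intro bexI[of _ "(A \<ominus> B) \<otimes> y1"]) auto
qed

section \<open>Embeddings of fields\<close>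

lemma ring_hom_nat:
  assumes "ring R" "ring S" "h \<in> ring_hom R S"
  shows "h ([(k::nat)] \<cdot>\<^bsub>R\<^esub> \<one>\<^bsub>R\<^esub>) = [k] \<cdot>\<^bsub>S\<^esub> \<one>\<^bsub>S\<^esub>"
proof -
  interpret R: ring R by fact
  interpret S: ring S by fact
  show ?thesis
    using ring_hom_zero[OF assms(3,1,2)] ring_hom_add[OF assms(3)] ring_hom_one[OF assms(3)]
    by (induction k) simp_all
qed

lemma field_hom_nonzero:
  assumes "field R" "field S" "h \<in> ring_hom R S" "x \<in> carrier R" "x \<noteq> \<zero>\<^bsub>R\<^esub>"
  shows "h x \<noteq> \<zero>\<^bsub>S\<^esub>"
proof
  interpret R: field R by fact
  interpret S: field S by fact
  assume z: "h x = \<zero>\<^bsub>S\<^esub>"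
  have u: "x \<in> Units R" using assms(4,5) R.field_Units by auto
  have "\<one>\<^bsub>S\<^esub> = h (x \<otimes>\<^bsub>R\<^esub> inv\<^bsub>R\<^esub> x)" using R.Units_r_inv[OF u] ring_hom_one[OF assms(3)] by simp
  also have "\<dots> = \<zero>\<^bsub>S\<^esub>" using ring_hom_mult[OF assms(3,4), of "inv\<^bsub>R\<^esub> x"] u z ring_hom_closed[OF assms(3), of "inv\<^bsub>R\<^esub> x"] by simp
  finally show False by simp
qed

lemma field_hom_inj:
  assumes "field R" "field S" "h \<in> ring_hom R S" "x \<in> carrier R" "y \<in> carrier R" "h x = h y"
  shows "x = y"
proof (rule ccontr)
  interpret R: field R by fact
  interpret S: field S by fact
  interpret h: ring_hom_cring R S h by (unfold_locales) (rule assms(3))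
  assume "x \<noteq> y"
  then have "x \<ominus>\<^bsub>R\<^esub> y \<noteq> \<zero>\<^bsub>R\<^esub>" using assms(4,5) by simp
  then have "h (x \<ominus>\<^bsub>R\<^esub> y) \<noteq> \<zero>\<^bsub>S\<^esub>" using assms by (intro field_hom_nonzero[OF assms(1-3)]) auto
  moreover have "h (x \<ominus>\<^bsub>R\<^esub> y) = h x \<ominus>\<^bsub>S\<^esub> h y" using assms(4,5) by (simp add: R.minus_eq S.minus_eq)
  ultimately show False using assms(4-6) by (simp add: S.r_neg S.minus_eq)
qed

lemma char_zero_hom:
  assumes "field R" "field S" "h \<in> ring_hom R S" "ring.char_zero R"
  shows "ring.char_zero S"
proof -
  interpret R: field R by fact
  interpret S: field S by fact
  show ?thesis
    unfolding S.char_zero_def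
  proof (intro allI impI)
    fix k :: nat assume "0 < k"
    then have "[k] \<cdot>\<^bsub>R\<^esub> \<one>\<^bsub>R\<^esub> \<noteq> \<zero>\<^bsub>R\<^esub>" using assms(4) by (simp add: R.char_zero_def)
    then have "h ([k] \<cdot>\<^bsub>R\<^esub> \<one>\<^bsub>R\<^esub>) \<noteq> \<zero>\<^bsub>S\<^esub>" by (intro field_hom_nonzero[OF assms(1-3)]) auto
    then show "[k] \<cdot>\<^bsub>S\<^esub> \<one>\<^bsub>S\<^esub> \<noteq> \<zero>\<^bsub>S\<^esub>" using ring_hom_nat[OF R.ring_axioms S.ring_axioms assms(3)] by simp
  qed
qed

lemma differential_field_char_zero: "differential_field F D \<Longrightarrow> ring.char_zero F"
proof -
  assume "differential_field F D"
  then interpret differential_field F D .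
  show ?thesis using char_0 by (simp add: char_zero_def)
qed

lemma (in field) derivation_differential_field:
  assumes "derivation \<delta>" "char_zero" shows "differential_field R \<delta>"
  by unfold_locales (use assms in \<open>auto simp: derivation_def char_zero_def\<close>)

section \<open>A generic point of the variety as solution\<close>

text \<open>
  An \<open>E\<^sub>j\<close>-point with its witnesses, in five blocks of \<open>n\<close> coordinates: \<open>x\<close>, \<open>y\<close>, \<open>y'\<close>, \<open>y''\<close>, \<open>y'''\<close>. Sequences
  are infinite, so that no length has to be tracked.
\<close>

definition j_solution :: "('a, 'm) ring_scheme \<Rightarrow> ('a \<Rightarrow> 'a) \<Rightarrow> nat \<Rightarrow> (nat \<Rightarrow> 'a) \<Rightarrow> bool" where
  "j_solution L \<delta> n z \<longleftrightarrow> (\<forall>j. z j \<in> carrier L) \<and> (\<forall>i<n. z (2 * n + i) \<noteq> \<zero>\<^bsub>L\<^esub> \<and> z (n + i) \<noteq> \<zero>\<^bsub>L\<^esub> \<and>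
     z (n + i) \<noteq> [(1728::nat)] \<cdot>\<^bsub>L\<^esub> \<one>\<^bsub>L\<^esub> \<and>
     field.Psi L (z (n + i)) (z (2 * n + i)) (z (3 * n + i)) (z (4 * n + i)) = \<zero>\<^bsub>L\<^esub> \<and>
     \<delta> (z (n + i)) = z (2 * n + i) \<otimes>\<^bsub>L\<^esub> \<delta> (z i) \<and>
     \<delta> (z (2 * n + i)) = z (3 * n + i) \<otimes>\<^bsub>L\<^esub> \<delta> (z i) \<and>
     \<delta> (z (3 * n + i)) = z (4 * n + i) \<otimes>\<^bsub>L\<^esub> \<delta> (z i))"

text \<open>
  The generic point of the cylinder over \<open>V\<close> supplies \<open>x\<close> and \<open>y\<close> in its first \<open>2n\<close> coordinates and
  independent elements \<open>y'\<close> and \<open>y''\<close> in the next \<open>2n\<close>. As \<open>y\<^sub>i\<close> is not identically 0 or 1728 on \<open>V\<close>, it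
  differs from both at the generic point, so that \<open>\<Psi> = 0\<close> can be solved for \<open>y'''\<close>. An extension \<open>\<Delta>\<close> of \<open>D\<close> is
  first corrected to satisfy \<open>\<delta>(y\<^sub>i) = y'\<^sub>i \<delta>(x\<^sub>i)\<close>. Adding a derivation \<open>\<epsilon>\<close> that kills \<open>V\<close>'s generic point
  then adjusts the values at \<open>y'\<close> and \<open>y''\<close>, without affecting what has been achieved.
\<close>

theorem generic_j_solution:
  fixes F :: "'a ring" and k :: "'c ring"
  assumes F: "differential_field F D" and kf: "field k" and \<iota>: "\<iota> \<in> ring_hom F k"
    and S: "S \<subseteq> ring.indexed_pset F {..<2 * n} (carrier F)"
    and broad: "ring.j_broad k n (variety_points k \<iota> (2 * n) S)"
    and nt: "\<And>i. i < n \<Longrightarrow> \<exists>p \<in> variety_points k \<iota> (2 * n) S.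
           p ! (n + i) \<noteq> \<zero>\<^bsub>k\<^esub> \<and> p ! (n + i) \<noteq> [(1728::nat)] \<cdot>\<^bsub>k\<^esub> \<one>\<^bsub>k\<^esub>"
  shows "\<exists>(L :: ((nat \<Rightarrow> 'c) \<Rightarrow> 'c) set ring) \<delta> \<sigma> z. differential_field_extension F D L \<delta> \<sigma> \<and>
    j_solution L \<delta> n z \<and> (\<forall>P\<in>S. ring.mpoly_eval L (\<sigma> \<circ> P) z = \<zero>\<^bsub>L\<^esub>)"
proof -
  interpret F: differential_field F D by (rule F)
  interpret k: field k by (rule kf)
  have chF: "F.char_zero" by (rule differential_field_char_zero[OF F])
  have chk: "k.char_zero" by (rule char_zero_hom[OF F.field_axioms kf \<iota> chF])
  define V where "V = variety_points k \<iota> (2 * n) S"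
  have VZ: "V = k.zero_locus (2 * n) ((\<lambda>P. \<iota> \<circ> P) ` S)" by (simp add: V_def variety_points_def)
  have jb: "k.j_broad n V" using broad by (simp add: V_def)
  have irr: "k.irreducible_variety (2 * n) V" using jb by (simp add: k.j_broad_def)
  have Va: "V \<subseteq> k.affine_space (2 * n)" by (rule k.irreducible_affine[OF irr])
  obtain L :: "((nat \<Rightarrow> 'c) \<Rightarrow> 'c) set ring" and \<Phi> where G: "generic_point k L (k.cylinder (2 * n) V) \<Phi>"
    using k.generic_point_exists[OF chk irr] by blast
  interpret G: generic_point k L "k.cylinder (2 * n) V" \<Phi> by (rule G)
  let ?W = "k.cylinder (2 * n) V" and ?K = "G.\<kappa> ` carrier k"
  let ?\<xi> = "G.\<xi>"
  have Kc: "?K \<subseteq> carrier L" using G.\<kappa>_closed by blast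
  have extra: "G.L.transcendental_over (\<Phi> ` k.poly_fun C) (?\<xi> j)" if "j \<ge> 2 * n" "j \<notin> C" for j C
  proof (rule G.\<xi>_transcendental[OF that(2)])
    fix g w s assume "\<And>w. w \<in> ?W \<Longrightarrow> g w = \<zero>\<^bsub>k\<^esub>" "w \<in> ?W" "s \<in> carrier k"
    moreover have "w(j := s) \<in> ?W"
      using that(1) \<open>w \<in> ?W\<close> \<open>s \<in> carrier k\<close> k.cylinder_points by (intro k.cylinder_upd[OF \<open>w \<in> ?W\<close> k.points_upd]) auto
    ultimately show "g (w(j := s)) = \<zero>\<^bsub>k\<^esub>" by blast
  qed
  have ext_der: "\<exists>\<epsilon>\<in>G.L.Der ?K. (\<forall>j<2 * n. \<epsilon> (?\<xi> j) = \<zero>\<^bsub>L\<^esub>) \<and> (\<forall>j\<in>{2 * n..<4 * n}. \<epsilon> (?\<xi> j) = v j)"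
    if v: "\<And>j. v j \<in> carrier L" for v
  proof -
    have "\<exists>\<epsilon>\<in>G.L.Der ?K. (\<forall>j\<in>{..<2 * n}. \<epsilon> (?\<xi> j) = \<zero>\<^bsub>L\<^esub>) \<and> (\<forall>j\<in>{2 * n..<4 * n}. \<epsilon> (?\<xi> j) = v j)"
      by (rule G.derivation_on_free_coordinates[OF _ _ extra v]) auto
    then obtain \<epsilon> where "\<epsilon> \<in> G.L.Der ?K" "\<forall>j\<in>{..<2 * n}. \<epsilon> (?\<xi> j) = \<zero>\<^bsub>L\<^esub>" "\<forall>j\<in>{2 * n..<4 * n}. \<epsilon> (?\<xi> j) = v j"
      by blast
    then show ?thesis by (intro bexI[of _ \<epsilon>]) auto
  qed
  define \<sigma> where "\<sigma> = G.\<kappa> \<circ> \<iota>"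
  have \<sigma>: "\<sigma> \<in> ring_hom F L" unfolding \<sigma>_def by (rule ring_hom_trans[OF \<iota> G.\<kappa>_hom])
  interpret \<sigma>: ring_hom_cring F L \<sigma> by unfold_locales (rule \<sigma>)
  note Linj = field_hom_inj[OF F.field_axioms G.L.field_axioms \<sigma>]
  define d where "d x = \<sigma> (D (inv_into (carrier F) \<sigma> x))" for x
  have inj: "inj_on \<sigma> (carrier F)" using Linj by (rule inj_onI)
  have d\<sigma>: "d (\<sigma> a) = \<sigma> (D a)" if "a \<in> carrier F" for a
    unfolding d_def using inv_into_f_f[OF inj that] by simp
  have A: "subring (\<sigma> ` carrier F) L"
    by (rule ring_hom_ring.img_is_subring[OF ring_hom_ringI2[OF F.ring_axioms G.L.ring_axioms \<sigma>] F.carrier_is_subring])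
  have "\<exists>\<Delta>. G.L.derivation \<Delta> \<and> (\<forall>x\<in>\<sigma> ` carrier F. \<Delta> x = d x)"
  proof (rule G.L.derivation_extend[OF G.L_char_zero A])
    show "d x \<in> carrier L" if "x \<in> \<sigma> ` carrier F" for x using that d\<sigma> F.D_closed by auto
    fix x y assume "x \<in> \<sigma> ` carrier F" "y \<in> \<sigma> ` carrier F"
    then obtain a b where ab: "a \<in> carrier F" "x = \<sigma> a" "b \<in> carrier F" "y = \<sigma> b" by blast
    have "d (\<sigma> (a \<oplus>\<^bsub>F\<^esub> b)) = \<sigma> (D a) \<oplus>\<^bsub>L\<^esub> \<sigma> (D b)" "d (\<sigma> (a \<otimes>\<^bsub>F\<^esub> b)) = \<sigma> a \<otimes>\<^bsub>L\<^esub> \<sigma> (D b) \<oplus>\<^bsub>L\<^esub> \<sigma> (D a) \<otimes>\<^bsub>L\<^esub> \<sigma> b"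
      using ab F.D_closed by (simp_all add: d\<sigma> F.D_add F.D_mult del: \<sigma>.hom_add \<sigma>.hom_mult) simp_all
    then show "d (x \<oplus>\<^bsub>L\<^esub> y) = d x \<oplus>\<^bsub>L\<^esub> d y" "d (x \<otimes>\<^bsub>L\<^esub> y) = x \<otimes>\<^bsub>L\<^esub> d y \<oplus>\<^bsub>L\<^esub> d x \<otimes>\<^bsub>L\<^esub> y"
      using ab by (simp_all add: d\<sigma>)
  qed
  then obtain \<Delta> where \<Delta>: "G.L.derivation \<Delta>" "\<And>a. a \<in> carrier F \<Longrightarrow> \<Delta> (\<sigma> a) = \<sigma> (D a)" using d\<sigma> by auto
  have "\<exists>\<delta>. G.L.derivation \<delta> \<and> (\<forall>a\<in>?K. \<delta> a = \<Delta> a) \<and> (\<forall>i<n. \<delta> (?\<xi> (n + i)) = ?\<xi> (2 * n + i) \<otimes>\<^bsub>L\<^esub> \<delta> (?\<xi> i))"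
  proof (rule G.L.derivation_solving_first_order[OF Kc G.\<xi>_closed G.\<xi>_closed _ _ \<Delta>(1)])
    fix I assume "I \<subseteq> {..<n}" "I \<noteq> {}"
    then obtain B where B: "B \<subseteq> I \<union> (+) n ` I" "card B = card I" "k.alg_indep B ?W"
      using k.j_broad_alg_indep[OF chk jb] by blast
    have "finite I" using \<open>I \<subseteq> {..<n}\<close> finite_subset by blast
    then have fB: "finite B" using B(1) finite_subset[of B "I \<union> (+) n ` I"] by simp
    have "\<exists>\<delta>\<in>G.L.Der ?K. \<forall>b'\<in>B. \<delta> (?\<xi> b') = (if b' = b then \<one>\<^bsub>L\<^esub> else \<zero>\<^bsub>L\<^esub>)" for b
      using G.derivation_on_free_coordinates[of B "{}" "\<lambda>b'. if b' = b then \<one>\<^bsub>L\<^esub> else \<zero>\<^bsub>L\<^esub>"]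
        fB G.alg_indep_transcendental[OF B(3)] by auto
    then show "\<exists>B\<subseteq>I \<union> (+) n ` I. card B = card I \<and>
        (\<forall>b\<in>B. \<exists>\<delta>\<in>G.L.Der ?K. \<forall>b'\<in>B. \<delta> (?\<xi> b') = (if b' = b then \<one>\<^bsub>L\<^esub> else \<zero>\<^bsub>L\<^esub>))"
      using B by blast
  next
    fix a assume a: "a < n"
    have vc: "(if j = 2 * n + a then \<one>\<^bsub>L\<^esub> else \<zero>\<^bsub>L\<^esub>) \<in> carrier L" for j by simp
    obtain \<epsilon> where e: "\<epsilon> \<in> G.L.Der ?K" "\<forall>j<2 * n. \<epsilon> (?\<xi> j) = \<zero>\<^bsub>L\<^esub>"
      "\<forall>j\<in>{2 * n..<4 * n}. \<epsilon> (?\<xi> j) = (if j = 2 * n + a then \<one>\<^bsub>L\<^esub> else \<zero>\<^bsub>L\<^esub>)"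
      using ext_der[of "\<lambda>j. if j = 2 * n + a then \<one>\<^bsub>L\<^esub> else \<zero>\<^bsub>L\<^esub>", OF vc] by (elim bexE conjE) (rule that)
    then show "\<exists>\<epsilon>\<in>G.L.Der ?K. (\<forall>j<n + n. \<epsilon> (?\<xi> j) = \<zero>\<^bsub>L\<^esub>) \<and>
        (\<forall>i<n. \<epsilon> (?\<xi> (2 * n + i)) = (if i = a then \<one>\<^bsub>L\<^esub> else \<zero>\<^bsub>L\<^esub>))"
      using a by (intro bexI[OF _ e(1)]) (auto simp: mult_2)
  qed
  then obtain \<delta>0 where d0: "G.L.derivation \<delta>0" "\<forall>a\<in>?K. \<delta>0 a = \<Delta> a"
    "\<forall>i<n. \<delta>0 (?\<xi> (n + i)) = ?\<xi> (2 * n + i) \<otimes>\<^bsub>L\<^esub> \<delta>0 (?\<xi> i)" by blast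
  note d0c = G.L.derivation_closed[OF d0(1)]
  have W1: "\<exists>w\<in>?W. w j \<noteq> \<zero>\<^bsub>k\<^esub>" if "j \<ge> 2 * n" for j
  proof -
    obtain w where w: "w \<in> ?W" using k.irreducible_cylinder_nonempty[OF irr] by blast
    then have "w(j := \<one>\<^bsub>k\<^esub>) \<in> ?W" using that k.cylinder_points by (intro k.cylinder_upd[OF w k.points_upd]) auto
    then show ?thesis by (intro bexI) auto
  qed
  have varU: "(\<lambda>w. w j) \<in> k.poly_fun UNIV" for j by (rule k.poly_fun_var) simp
  have cnz: "?\<xi> j \<noteq> \<zero>\<^bsub>L\<^esub>" if "j \<ge> 2 * n" for j
    using W1[OF that] G.\<Phi>_zero_iff[OF varU] by (auto simp: G.\<xi>_def)
  have ynz: "?\<xi> (n + i) \<noteq> \<zero>\<^bsub>L\<^esub> \<and> ?\<xi> (n + i) \<noteq> [(1728::nat)] \<cdot>\<^bsub>L\<^esub> \<one>\<^bsub>L\<^esub>" if i: "i < n" for i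
  proof -
    obtain p where p: "p \<in> V" "p ! (n + i) \<noteq> \<zero>\<^bsub>k\<^esub>" "p ! (n + i) \<noteq> [(1728::nat)] \<cdot>\<^bsub>k\<^esub> \<one>\<^bsub>k\<^esub>"
      using nt[OF i] by (auto simp: V_def)
    have w: "k.ext_pt (2 * n) p \<in> ?W" using p(1) Va by (intro k.ext_pt_cylinder) auto
    have wv: "k.ext_pt (2 * n) p (n + i) = p ! (n + i)" using i by (simp add: k.ext_pt_def)
    have c1: "[(1728::nat)] \<cdot>\<^bsub>L\<^esub> \<one>\<^bsub>L\<^esub> = \<Phi> (\<lambda>_. [(1728::nat)] \<cdot>\<^bsub>k\<^esub> \<one>\<^bsub>k\<^esub>)"
      using ring_hom_nat[OF k.ring_axioms G.L.ring_axioms G.\<kappa>_hom] by (simp add: G.\<kappa>_def)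
    have c2: "(\<lambda>_. [(1728::nat)] \<cdot>\<^bsub>k\<^esub> \<one>\<^bsub>k\<^esub>) \<in> k.poly_fun UNIV" by (intro k.poly_fun.poly_fun_const) simp
    have "?\<xi> (n + i) \<noteq> \<zero>\<^bsub>L\<^esub>"
      unfolding G.\<xi>_def G.\<Phi>_zero_iff[OF varU[of "n + i"]] using w wv p(2) by (metis (lifting))
    moreover have "?\<xi> (n + i) \<noteq> \<Phi> (\<lambda>_. [(1728::nat)] \<cdot>\<^bsub>k\<^esub> \<one>\<^bsub>k\<^esub>)"
      unfolding G.\<xi>_def G.\<Phi>_eq_iff[OF varU[of "n + i"] c2] using w wv p(3) by (metis (lifting))
    ultimately show ?thesis unfolding c1 by blast
  qed
  have "\<exists>y3\<in>carrier L. i < n \<longrightarrow> field.Psi L (?\<xi> (n + i)) (?\<xi> (2 * n + i)) (?\<xi> (3 * n + i)) y3 = \<zero>\<^bsub>L\<^esub>" for i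
  proof (cases "i < n")
    case True
    then show ?thesis
      using G.L.Psi_solvable[of "?\<xi> (n + i)" "?\<xi> (2 * n + i)" "?\<xi> (3 * n + i)"] ynz[OF True] cnz[of "2 * n + i"]
        G.\<xi>_closed G.L_char_zero by auto
  qed (use G.L.zero_closed in blast)
  then obtain y3 where y3: "\<And>i. y3 i \<in> carrier L"
    "\<And>i. i < n \<Longrightarrow> field.Psi L (?\<xi> (n + i)) (?\<xi> (2 * n + i)) (?\<xi> (3 * n + i)) (y3 i) = \<zero>\<^bsub>L\<^esub>" by metis
  \<comment> \<open>The required derivatives of \<open>y'\<close> (first case) and \<open>y''\<close> (second case).\<close>
  define tg where "tg j = (if j < 3 * n then ?\<xi> (n + j) \<otimes>\<^bsub>L\<^esub> \<delta>0 (?\<xi> (j - 2 * n)) else y3 (j - 3 * n) \<otimes>\<^bsub>L\<^esub> \<delta>0 (?\<xi> (j - 3 * n)))" for j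
  have tgc: "tg j \<in> carrier L" for j using G.\<xi>_closed d0c y3(1) by (simp add: tg_def)
  obtain \<epsilon> where e: "\<epsilon> \<in> G.L.Der ?K" "\<And>j. j < 2 * n \<Longrightarrow> \<epsilon> (?\<xi> j) = \<zero>\<^bsub>L\<^esub>"
    "\<And>j. \<lbrakk>2 * n \<le> j; j < 4 * n\<rbrakk> \<Longrightarrow> \<epsilon> (?\<xi> j) = tg j \<ominus>\<^bsub>L\<^esub> \<delta>0 (?\<xi> j)"
    using ext_der[of "\<lambda>j. tg j \<ominus>\<^bsub>L\<^esub> \<delta>0 (?\<xi> j)"] tgc d0c G.\<xi>_closed by auto
  have ed: "G.L.derivation \<epsilon>" using e(1) by (simp add: G.L.Der_def)
  define \<delta> where "\<delta> x = \<delta>0 x \<oplus>\<^bsub>L\<^esub> \<one>\<^bsub>L\<^esub> \<otimes>\<^bsub>L\<^esub> \<epsilon> x" for x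
  have dd: "G.L.derivation \<delta>" unfolding \<delta>_def by (rule G.L.derivation_combine[OF d0(1) ed G.L.one_closed])
  have dlow: "\<delta> (?\<xi> j) = \<delta>0 (?\<xi> j)" if "j < 2 * n" for j
    using e(2)[OF that] d0c G.\<xi>_closed by (simp add: \<delta>_def)
  have dhigh: "\<delta> (?\<xi> j) = tg j" if "2 * n \<le> j" "j < 4 * n" for j
  proof -
    have "\<delta> (?\<xi> j) = \<delta>0 (?\<xi> j) \<oplus>\<^bsub>L\<^esub> (tg j \<oplus>\<^bsub>L\<^esub> \<ominus>\<^bsub>L\<^esub> \<delta>0 (?\<xi> j))"
      using e(3)[OF that] d0c G.\<xi>_closed tgc by (simp add: \<delta>_def G.L.minus_eq)
    also have "\<dots> = tg j \<oplus>\<^bsub>L\<^esub> (\<delta>0 (?\<xi> j) \<oplus>\<^bsub>L\<^esub> \<ominus>\<^bsub>L\<^esub> \<delta>0 (?\<xi> j))"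
      using d0c G.\<xi>_closed tgc by (simp only: G.L.a_ac G.L.a_inv_closed G.L.a_closed)
    finally show ?thesis using d0c[OF G.\<xi>_closed] tgc by (simp add: G.L.r_neg)
  qed
  have dK: "\<delta> (\<sigma> a) = \<sigma> (D a)" if a: "a \<in> carrier F" for a
  proof -
    have K: "\<sigma> a \<in> ?K" using a ring_hom_closed[OF \<iota>] by (simp add: \<sigma>_def)
    then have "\<epsilon> (\<sigma> a) = \<zero>\<^bsub>L\<^esub>" "\<delta>0 (\<sigma> a) = \<Delta> (\<sigma> a)" using e(1) d0(2) by (auto simp: G.L.Der_def)
    then show ?thesis using \<Delta>(2)[OF a] d0c[of "\<sigma> a"] a by (simp add: \<delta>_def)
  qed
  define z where "z j = (if j < 4 * n then ?\<xi> j else y3 (j - 4 * n))" for j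
  have "j_solution L \<delta> n z"
    unfolding j_solution_def
  proof (intro conjI allI impI)
    show "z j \<in> carrier L" for j using G.\<xi>_closed y3 by (simp add: z_def)
    fix i assume i: "i < n"
    have zs: "z (2 * n + i) = ?\<xi> (2 * n + i)" "z (n + i) = ?\<xi> (n + i)" "z (3 * n + i) = ?\<xi> (3 * n + i)"
      "z (4 * n + i) = y3 i" "z i = ?\<xi> i" using i by (auto simp: z_def)
    show "z (2 * n + i) \<noteq> \<zero>\<^bsub>L\<^esub>" using cnz zs by simp
    show "z (n + i) \<noteq> \<zero>\<^bsub>L\<^esub>" "z (n + i) \<noteq> [(1728::nat)] \<cdot>\<^bsub>L\<^esub> \<one>\<^bsub>L\<^esub>" using ynz[OF i] zs by auto
    show "field.Psi L (z (n + i)) (z (2 * n + i)) (z (3 * n + i)) (z (4 * n + i)) = \<zero>\<^bsub>L\<^esub>"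
      using y3(2)[OF i] zs by simp
    show "\<delta> (z (n + i)) = z (2 * n + i) \<otimes>\<^bsub>L\<^esub> \<delta> (z i)"
      using d0(3) i dlow[of "n + i"] dlow[of i] zs by simp
    show "\<delta> (z (2 * n + i)) = z (3 * n + i) \<otimes>\<^bsub>L\<^esub> \<delta> (z i)"
      using i dhigh[of "2 * n + i"] dlow[of i] zs by (simp add: tg_def add.assoc[symmetric])
    show "\<delta> (z (3 * n + i)) = z (4 * n + i) \<otimes>\<^bsub>L\<^esub> \<delta> (z i)"
      using i dhigh[of "3 * n + i"] dlow[of i] zs by (simp add: tg_def)
  qed
  moreover have "ring.mpoly_eval L (\<sigma> \<circ> P) z = \<zero>\<^bsub>L\<^esub>" if P: "P \<in> S" for P
  proof -
    have PF: "P \<in> F.indexed_pset {..<2 * n} (carrier F)" using P S by blast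
    have Pk: "\<iota> \<circ> P \<in> k.indexed_pset {..<2 * n} (carrier k)"
      by (rule ring_hom_indexed_pset[OF F.ring_axioms k.ring_axioms \<iota> PF])
    have PL: "\<sigma> \<circ> P \<in> G.L.indexed_pset {..<2 * n} (carrier L)"
      by (rule ring_hom_indexed_pset[OF F.ring_axioms G.L.ring_axioms \<sigma> PF])
    have "k.mpoly_eval (\<iota> \<circ> P) w = \<zero>\<^bsub>k\<^esub>" if w: "w \<in> ?W" for w
    proof -
      have wp: "w \<in> k.points" using w k.cylinder_points by blast
      have "map w [0..<2 * n] \<in> V" using w by (simp add: k.cylinder_def)
      then have "k.mpoly_eval (\<iota> \<circ> P) (\<lambda>i. map w [0..<2 * n] ! i) = \<zero>\<^bsub>k\<^esub>"
        using P by (auto simp: VZ k.zero_locus_def)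
      then show ?thesis using k.mpoly_eval_nth[OF Pk wp] by simp
    qed
    then have "\<Phi> (k.mpoly_eval (\<iota> \<circ> P)) = \<zero>\<^bsub>L\<^esub>" using G.\<Phi>_zero_iff[OF G.poly_fun_UNIV[OF k.mpoly_eval_poly_fun[OF Pk]]] by blast
    then have "G.L.mpoly_eval (\<sigma> \<circ> P) ?\<xi> = \<zero>\<^bsub>L\<^esub>"
      using G.\<Phi>_mpoly_eval[OF Pk] by (simp only: \<sigma>_def o_assoc)
    moreover have "G.L.mpoly_eval (\<sigma> \<circ> P) ?\<xi> = G.L.mpoly_eval (\<sigma> \<circ> P) z"
      by (rule G.L.mpoly_eval_cong[OF PL]) (use G.\<xi>_closed in \<open>auto simp: z_def\<close>)
    ultimately show ?thesis by simp
  qed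
  moreover have "differential_field_extension F D L \<delta> \<sigma>"
    by (intro differential_field_extension.intro differential_field_extension_axioms.intro F \<sigma>
        G.L.derivation_differential_field[OF dd G.L_char_zero]) (use dK in simp)
  ultimately show ?thesis by blast
qed

section \<open>The differential equation under embeddings\<close>

text \<open>
  The numerator of \<open>\<Psi>\<close> over \<open>2 y\<^sub>0\<^sup>2 (y\<^sub>0 - 1728)\<^sup>2 y\<^sub>1\<^sup>2\<close>. Unlike \<open>Psi\<close> it involves no inverses, so it is preserved by
  ring homomorphisms and can serve as a differential polynomial.
\<close>

definition (in ring) Psi_numerator :: "'a \<Rightarrow> 'a \<Rightarrow> 'a \<Rightarrow> 'a \<Rightarrow> 'a" where
  "Psi_numerator y0 y1 y2 y3 =
     ((y0 \<otimes> y0) \<otimes> ((y0 \<ominus> [(1728::nat)] \<cdot> \<one>) \<otimes> (y0 \<ominus> [(1728::nat)] \<cdot> \<one>))) \<otimes>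
       ([(2::nat)] \<cdot> \<one> \<otimes> (y1 \<otimes> y3) \<ominus> [(3::nat)] \<cdot> \<one> \<otimes> (y2 \<otimes> y2)) \<oplus>
     (y0 \<otimes> y0 \<ominus> [(1968::nat)] \<cdot> \<one> \<otimes> y0 \<oplus> [(2654208::nat)] \<cdot> \<one>) \<otimes> ((y1 \<otimes> y1) \<otimes> (y1 \<otimes> y1))"

lemma (in field) Psi_eq_zero_iff:
  assumes y: "y0 \<in> carrier R" "y1 \<in> carrier R" "y2 \<in> carrier R" "y3 \<in> carrier R"
    and nz: "y1 \<noteq> \<zero>" "y0 \<noteq> \<zero>" "y0 \<noteq> [(1728::nat)] \<cdot> \<one>" and ch: "char_zero"
  shows "Psi y0 y1 y2 y3 = \<zero> \<longleftrightarrow> Psi_numerator y0 y1 y2 y3 = \<zero>"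
proof -
  define t where "t = [(2::nat)] \<cdot> \<one>"
  define h where "h = [(3::nat)] \<cdot> \<one>"
  define s where "s = y0 \<ominus> [(1728::nat)] \<cdot> \<one>"
  define e where "e = (y0 \<otimes> y0) \<otimes> (s \<otimes> s)"
  define N where "N = y0 \<otimes> y0 \<ominus> [(1968::nat)] \<cdot> \<one> \<otimes> y0 \<oplus> [(2654208::nat)] \<cdot> \<one>"
  have c: "t \<in> carrier R" "h \<in> carrier R" "s \<in> carrier R" "e \<in> carrier R" "N \<in> carrier R"
    using y by (simp_all add: t_def h_def s_def e_def N_def)
  have tn: "t \<noteq> \<zero>" using ch by (simp add: char_zero_def t_def)
  have sn: "s \<noteq> \<zero>" using nz(3) y by (simp add: s_def)
  have en: "e \<noteq> \<zero>" using nz(2) sn y c by (simp add: e_def integral_iff)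
  have u: "y1 \<in> Units R" "t \<in> Units R" "t \<otimes> e \<in> Units R"
    using y c nz tn en field_Units by (auto simp: integral_iff)
  define i where "i = inv y1"
  define b where "b = inv t"
  define j where "j = inv (t \<otimes> e)"
  have ic: "i \<in> carrier R" "b \<in> carrier R" "j \<in> carrier R" using u by (simp_all add: i_def b_def j_def)
  have iv: "i \<otimes> y1 = \<one>" "b \<otimes> t = \<one>" "j \<otimes> (t \<otimes> e) = \<one>"
    using Units_l_inv[OF u(1)] Units_l_inv[OF u(2)] Units_l_inv[OF u(3)] by (simp_all add: i_def b_def j_def)
  define m where "m = (t \<otimes> e) \<otimes> (y1 \<otimes> y1)"
  have mc: "m \<in> carrier R" using c y by (simp add: m_def)
  have mn: "m \<noteq> \<zero>" using tn en nz(1) c y by (simp add: m_def integral_iff)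
  have Psi: "Psi y0 y1 y2 y3 = y3 \<otimes> i \<ominus> (h \<otimes> b) \<otimes> ((y2 \<otimes> i) \<otimes> (y2 \<otimes> i)) \<oplus> (N \<otimes> j) \<otimes> (y1 \<otimes> y1)"
  proof -
    have 2: "x [^] (2::nat) = x \<otimes> x" if "x \<in> carrier R" for x using that by (simp add: numeral_2_eq_2)
    have "[(1968::nat)] \<cdot> y0 = [(1968::nat)] \<cdot> \<one> \<otimes> y0" using y by (simp add: add_pow_ldistr)
    moreover have "[(2::nat)] \<cdot> e = t \<otimes> e" using c by (simp add: t_def add_pow_ldistr)
    ultimately show ?thesis
      using y c ic unfolding Psi_def s_def[symmetric]
      by (simp add: 2 flip: i_def t_def b_def h_def e_def N_def j_def)
  qed
  have 1: "(y3 \<otimes> i) \<otimes> m = e \<otimes> (t \<otimes> (y1 \<otimes> y3))"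
  proof -
    have "(y3 \<otimes> i) \<otimes> m = (i \<otimes> y1) \<otimes> (e \<otimes> (t \<otimes> (y1 \<otimes> y3)))" unfolding m_def using y c ic by (simp add: m_ac)
    then show ?thesis using iv y c by simp
  qed
  have 2: "((h \<otimes> b) \<otimes> ((y2 \<otimes> i) \<otimes> (y2 \<otimes> i))) \<otimes> m = e \<otimes> (h \<otimes> (y2 \<otimes> y2))"
  proof -
    have "((h \<otimes> b) \<otimes> ((y2 \<otimes> i) \<otimes> (y2 \<otimes> i))) \<otimes> m = (b \<otimes> t) \<otimes> ((i \<otimes> y1) \<otimes> ((i \<otimes> y1) \<otimes> (e \<otimes> (h \<otimes> (y2 \<otimes> y2)))))"
      unfolding m_def using y c ic by (simp add: m_ac)
    then show ?thesis using iv y c by simp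
  qed
  have 3: "((N \<otimes> j) \<otimes> (y1 \<otimes> y1)) \<otimes> m = N \<otimes> ((y1 \<otimes> y1) \<otimes> (y1 \<otimes> y1))"
  proof -
    have "((N \<otimes> j) \<otimes> (y1 \<otimes> y1)) \<otimes> m = (j \<otimes> (t \<otimes> e)) \<otimes> (N \<otimes> ((y1 \<otimes> y1) \<otimes> (y1 \<otimes> y1)))"
      unfolding m_def using y c ic by (simp add: m_ac)
    then show ?thesis using iv y c by simp
  qed
  have "Psi y0 y1 y2 y3 \<otimes> m = (y3 \<otimes> i) \<otimes> m \<ominus> ((h \<otimes> b) \<otimes> ((y2 \<otimes> i) \<otimes> (y2 \<otimes> i))) \<otimes> m \<oplus> ((N \<otimes> j) \<otimes> (y1 \<otimes> y1)) \<otimes> m"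
    unfolding Psi using y c ic mc by (simp add: l_distr l_minus minus_eq)
  also have "\<dots> = Psi_numerator y0 y1 y2 y3"
    unfolding 1 2 3 Psi_numerator_def s_def[symmetric] e_def[symmetric] t_def[symmetric] h_def[symmetric] N_def[symmetric]
    using y c by (simp add: r_distr r_minus minus_eq)
  finally have eq: "Psi y0 y1 y2 y3 \<otimes> m = Psi_numerator y0 y1 y2 y3" .
  have "Psi y0 y1 y2 y3 \<in> carrier R" unfolding Psi using y c ic by simp
  then show ?thesis using eq mn mc by (metis integral_iff)
qed

lemma Psi_numerator_hom:
  assumes "cring R" "cring S" "h \<in> ring_hom R S"
    and "y0 \<in> carrier R" "y1 \<in> carrier R" "y2 \<in> carrier R" "y3 \<in> carrier R"
  shows "h (ring.Psi_numerator R y0 y1 y2 y3) = ring.Psi_numerator S (h y0) (h y1) (h y2) (h y3)"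
proof -
  interpret R: cring R by fact
  interpret S: cring S by fact
  interpret h: ring_hom_cring R S h by (unfold_locales) (rule assms(3))
  note n = ring_hom_nat[OF R.ring_axioms S.ring_axioms assms(3)]
  show ?thesis unfolding R.Psi_numerator_def S.Psi_numerator_def using assms(4-7)
    by (simp add: n R.minus_eq S.minus_eq)
qed

lemma j_solution_reflect:
  assumes ext: "differential_field_extension K \<delta>' L \<delta> h"
    and z: "\<And>j. z j \<in> carrier K" and sol: "j_solution L \<delta> n (\<lambda>j. h (z j))"
  shows "j_solution K \<delta>' n z"
proof -
  interpret E: differential_field_extension K \<delta>' L \<delta> h by (rule ext)
  interpret h: ring_hom_cring K L h by unfold_locales (rule E.hom)
  note inj = field_hom_inj[OF E.F.field_axioms E.K.field_axioms E.hom]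
  note chK = differential_field_char_zero[OF E.F.differential_field_axioms]
  note chL = differential_field_char_zero[OF E.K.differential_field_axioms]
  have dz: "\<delta>' (z j) \<in> carrier K" for j using z E.F.D_closed by blast
  have com: "\<delta> (h (z j)) = h (\<delta>' (z j))" for j using E.commutes z by simp
  show ?thesis
    unfolding j_solution_def
  proof (intro conjI allI impI)
    show "z j \<in> carrier K" for j by (rule z)
    fix i assume i: "i < n"
    have s: "h (z (2 * n + i)) \<noteq> \<zero>\<^bsub>L\<^esub>" "h (z (n + i)) \<noteq> \<zero>\<^bsub>L\<^esub>" "h (z (n + i)) \<noteq> [(1728::nat)] \<cdot>\<^bsub>L\<^esub> \<one>\<^bsub>L\<^esub>"
      "E.K.Psi (h (z (n + i))) (h (z (2 * n + i))) (h (z (3 * n + i))) (h (z (4 * n + i))) = \<zero>\<^bsub>L\<^esub>"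
      "\<delta> (h (z (n + i))) = h (z (2 * n + i)) \<otimes>\<^bsub>L\<^esub> \<delta> (h (z i))"
      "\<delta> (h (z (2 * n + i))) = h (z (3 * n + i)) \<otimes>\<^bsub>L\<^esub> \<delta> (h (z i))"
      "\<delta> (h (z (3 * n + i))) = h (z (4 * n + i)) \<otimes>\<^bsub>L\<^esub> \<delta> (h (z i))"
      using sol i unfolding j_solution_def by auto
    show nz: "z (2 * n + i) \<noteq> \<zero>\<^bsub>K\<^esub>" "z (n + i) \<noteq> \<zero>\<^bsub>K\<^esub>" using s(1,2) by auto
    show n1: "z (n + i) \<noteq> [(1728::nat)] \<cdot>\<^bsub>K\<^esub> \<one>\<^bsub>K\<^esub>"
      using s(3) ring_hom_nat[OF E.F.ring_axioms E.K.ring_axioms E.hom] by metis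
    have Jc: "E.F.Psi_numerator (z (n + i)) (z (2 * n + i)) (z (3 * n + i)) (z (4 * n + i)) \<in> carrier K"
      unfolding E.F.Psi_numerator_def using z by simp
    have "E.K.Psi_numerator (h (z (n + i))) (h (z (2 * n + i))) (h (z (3 * n + i))) (h (z (4 * n + i))) = \<zero>\<^bsub>L\<^esub>"
      using E.K.Psi_eq_zero_iff[OF _ _ _ _ s(1,2,3) chL] s(4) z by auto
    then have "h (E.F.Psi_numerator (z (n + i)) (z (2 * n + i)) (z (3 * n + i)) (z (4 * n + i))) = h \<zero>\<^bsub>K\<^esub>"
      using Psi_numerator_hom[OF E.F.is_cring E.K.is_cring E.hom z z z z] by simp
    then have "E.F.Psi_numerator (z (n + i)) (z (2 * n + i)) (z (3 * n + i)) (z (4 * n + i)) = \<zero>\<^bsub>K\<^esub>"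
      using inj[OF Jc E.F.zero_closed] by blast
    then show "E.F.Psi (z (n + i)) (z (2 * n + i)) (z (3 * n + i)) (z (4 * n + i)) = \<zero>\<^bsub>K\<^esub>"
      using E.F.Psi_eq_zero_iff[OF z z z z nz n1 chK] by blast
    show "\<delta>' (z (n + i)) = z (2 * n + i) \<otimes>\<^bsub>K\<^esub> \<delta>' (z i)"
      "\<delta>' (z (2 * n + i)) = z (3 * n + i) \<otimes>\<^bsub>K\<^esub> \<delta>' (z i)"
      "\<delta>' (z (3 * n + i)) = z (4 * n + i) \<otimes>\<^bsub>K\<^esub> \<delta>' (z i)"
      using s(5-7) z dz unfolding com by (intro inj; simp)+
  qed
qed

lemma j_solution_E_j_point:
  assumes K: "differential_field K \<delta>" and sol: "j_solution K \<delta> n z" and \<sigma>: "\<sigma> \<in> ring_hom F K" "ring F"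
    and S: "S \<subseteq> ring.indexed_pset F {..<2 * n} (carrier F)"
    and van: "\<And>P. P \<in> S \<Longrightarrow> ring.mpoly_eval K (\<sigma> \<circ> P) z = \<zero>\<^bsub>K\<^esub>"
  shows "\<exists>p\<in>variety_points K \<sigma> (2 * n) S. differential_field.E_j_point K \<delta> n p"
proof -
  interpret K: differential_field K \<delta> by (rule K)
  let ?p = "map z [0..<2 * n]"
  have zp: "z \<in> K.points" using sol by (simp add: j_solution_def K.points_def)
  then have zc: "z j \<in> carrier K" for j by (simp add: K.points_def)
  have "?p \<in> variety_points K \<sigma> (2 * n) S"
    unfolding variety_points_def K.zero_locus_def
    using K.map_points_affine[OF zp] van K.mpoly_eval_nth[OF ring_hom_indexed_pset[OF \<sigma>(2) K.ring_axioms \<sigma>(1)] zp] S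
    by (auto simp: subset_iff simp del: o_apply)
  moreover have "K.E_j_point n ?p"
    unfolding K.E_j_point_def
  proof (intro allI impI)
    fix i assume i: "i < n"
    then have "?p ! i = z i" "?p ! (n + i) = z (n + i)" by simp_all
    moreover have "K.E_j (z i) (z (n + i))"
      unfolding K.E_j_def K.E_J_def
      using sol i zc unfolding j_solution_def
      by (intro bexI[of _ "z (2 * n + i)"] bexI[of _ "z (3 * n + i)"] conjI bexI[of _ "z (4 * n + i)"]) auto
    ultimately show "K.E_j (?p ! i) (?p ! (n + i))" by simp
  qed
  ultimately show ?thesis by blast
qed

section \<open>Generated differential subfields\<close>

text \<open>
  Names for the elements of the differential subfield generated by the base field and a sequence. They
  can be encoded in the type of the base field, which bounds the cardinality of the subfield.
\<close>

datatype 'a dterm = Cst 'a | Gen nat | Add "'a dterm" "'a dterm" | Mul "'a dterm" "'a dterm"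
  | Neg "'a dterm" | Inv "'a dterm" | Dif "'a dterm"

primrec dterm_eval :: "('b, 'm) ring_scheme \<Rightarrow> ('b \<Rightarrow> 'b) \<Rightarrow> ('a \<Rightarrow> 'b) \<Rightarrow> (nat \<Rightarrow> 'b) \<Rightarrow> 'a dterm \<Rightarrow> 'b" where
  "dterm_eval L \<delta> \<sigma> z (Cst a) = \<sigma> a"
| "dterm_eval L \<delta> \<sigma> z (Gen j) = z j"
| "dterm_eval L \<delta> \<sigma> z (Add s t) = dterm_eval L \<delta> \<sigma> z s \<oplus>\<^bsub>L\<^esub> dterm_eval L \<delta> \<sigma> z t"
| "dterm_eval L \<delta> \<sigma> z (Mul s t) = dterm_eval L \<delta> \<sigma> z s \<otimes>\<^bsub>L\<^esub> dterm_eval L \<delta> \<sigma> z t"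
| "dterm_eval L \<delta> \<sigma> z (Neg s) = \<ominus>\<^bsub>L\<^esub> dterm_eval L \<delta> \<sigma> z s"
| "dterm_eval L \<delta> \<sigma> z (Inv s) = (if dterm_eval L \<delta> \<sigma> z s = \<zero>\<^bsub>L\<^esub> then \<zero>\<^bsub>L\<^esub> else inv\<^bsub>L\<^esub> dterm_eval L \<delta> \<sigma> z s)"
| "dterm_eval L \<delta> \<sigma> z (Dif s) = \<delta> (dterm_eval L \<delta> \<sigma> z s)"

text \<open>
  The sequence \<open>u\<close> provides constructor tags; with an injective pairing \<open>g\<close> and injective \<open>u\<close> the code is
  injective.
\<close>

primrec dterm_code :: "('a \<times> 'a \<Rightarrow> 'a) \<Rightarrow> (nat \<Rightarrow> 'a) \<Rightarrow> 'a dterm \<Rightarrow> 'a" where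
  "dterm_code g u (Cst a) = g (u 0, a)"
| "dterm_code g u (Gen j) = g (u 1, u j)"
| "dterm_code g u (Add s t) = g (u 2, g (dterm_code g u s, dterm_code g u t))"
| "dterm_code g u (Mul s t) = g (u 3, g (dterm_code g u s, dterm_code g u t))"
| "dterm_code g u (Neg s) = g (u 4, dterm_code g u s)"
| "dterm_code g u (Inv s) = g (u 5, dterm_code g u s)"
| "dterm_code g u (Dif s) = g (u 6, dterm_code g u s)"

lemma infinite_dterm_embedding:
  assumes "infinite (UNIV :: 'a set)"
  shows "\<exists>f :: 'a dterm \<Rightarrow> 'a. inj f"
proof -
  obtain u :: "nat \<Rightarrow> 'a" where u: "inj u" using infinite_countable_subset[OF assms] by blast
  obtain g :: "'a \<times> 'a \<Rightarrow> 'a" where "bij_betw g (UNIV \<times> UNIV) UNIV"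
    using iffD2[OF card_of_ordIso card_of_Times_same_infinite[OF assms]] by blast
  then have "inj g" by (simp add: bij_betw_def)
  then have g: "g p = g q \<longleftrightarrow> p = q" for p q by (rule inj_eq)
  have u': "u i = u j \<longleftrightarrow> i = j" for i j using u by (rule inj_eq)
  have "dterm_code g u s = dterm_code g u t \<Longrightarrow> s = t" for s t
  proof (induction s arbitrary: t)
    case (Cst a) then show ?case by (cases t) (auto simp: g u')
  next
    case (Gen a) then show ?case by (cases t) (auto simp: g u')
  next
    case (Add s1 s2) then show ?case by (cases t) (auto simp: g u')
  next
    case (Mul s1 s2) then show ?case by (cases t) (auto simp: g u')
  next
    case (Neg s) then show ?case by (cases t) (auto simp: g u')
  next
    case (Inv s) then show ?case by (cases t) (auto simp: g u')
  next
    case (Dif s) then show ?case by (cases t) (auto simp: g u')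
  qed
  then show ?thesis by (intro exI[of _ "dterm_code g u"] injI) blast
qed

lemma (in field) char_zero_infinite:
  assumes "char_zero" shows "infinite (carrier R)"
proof -
  have ne: "[k] \<cdot> \<one> \<noteq> [l] \<cdot> \<one>" if "k < l" for k l :: nat
  proof
    assume eq: "[k] \<cdot> \<one> = [l] \<cdot> \<one>"
    have "[l] \<cdot> \<one> = [k] \<cdot> \<one> \<oplus> [(l - k)] \<cdot> \<one>" using that by (simp add: add.nat_pow_mult)
    then have "[(l - k)] \<cdot> \<one> = \<zero>" using eq by simp
    then show False using assms that by (simp add: char_zero_def)
  qed
  have "inj (\<lambda>k::nat. [k] \<cdot> \<one>)"
  proof (rule injI)
    fix k l :: nat assume "[k] \<cdot> \<one> = [l] \<cdot> \<one>"
    then show "k = l" using ne[of k l] ne[of l k] by (metis linorder_neqE_nat)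
  qed
  moreover have "range (\<lambda>k::nat. [k] \<cdot> \<one>) \<subseteq> carrier R" by auto
  ultimately show ?thesis using infinite_iff_countable_subset by blast
qed

text \<open>
  Encoding each element of the generated subfield \<open>K0\<close> by the code of some name for it transfers the field
  structure to the type of \<open>F\<close>. The decoding \<open>h\<close> is an embedding into \<open>L\<close>.
\<close>

theorem differential_subextension_on_base_type:
  fixes F :: "'a ring" and L :: "'b ring" and z :: "nat \<Rightarrow> 'b"
  assumes ext: "differential_field_extension F D L \<delta> \<sigma>" and z: "\<And>j. z j \<in> carrier L"
  shows "\<exists>(K :: 'a ring) \<delta>' \<sigma>' h z'. differential_field_extension F D K \<delta>' \<sigma>' \<and>
    differential_field_extension K \<delta>' L \<delta> h \<and> (\<forall>a\<in>carrier F. h (\<sigma>' a) = \<sigma> a) \<and>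
    (\<forall>j. z' j \<in> carrier K \<and> h (z' j) = z j)"
proof -
  interpret E: differential_field_extension F D L \<delta> \<sigma> by (rule ext)
  have chF: "E.F.char_zero" by (rule differential_field_char_zero[OF E.F.differential_field_axioms])
  have "infinite (UNIV :: 'a set)" using E.F.char_zero_infinite[OF chF] infinite_super subset_UNIV by blast
  then obtain code :: "'a dterm \<Rightarrow> 'a" where code: "inj code" using infinite_dterm_embedding by blast
  \<comment> \<open>Outside of the carrier \<open>\<sigma>\<close> may leave \<open>L\<close>, but every term must have a value in \<open>L\<close>.\<close>
  let ?s = "\<lambda>a. if a \<in> carrier F then \<sigma> a else \<zero>\<^bsub>L\<^esub>"
  let ?ev = "dterm_eval L \<delta> ?s z"
  define K0 where "K0 = range ?ev"
  have sc: "?s a \<in> carrier L" for a using ring_hom_closed[OF E.hom] by simp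
  have evc: "?ev t \<in> carrier L" for t
  proof (induction t)
    case (Inv s)
    then show ?case using E.K.field_Units by auto
  qed (use sc z E.K.D_closed in auto)
  have K0c: "K0 \<subseteq> carrier L" using evc by (auto simp: K0_def)
  have K0I: "?ev t \<in> K0" for t unfolding K0_def by (rule rangeI)
  have one: "\<one>\<^bsub>L\<^esub> = ?ev (Cst \<one>\<^bsub>F\<^esub>)" using ring_hom_one[OF E.hom] by simp
  have sub: "subring K0 L"
  proof (rule E.K.subringI[OF K0c])
    show "\<one>\<^bsub>L\<^esub> \<in> K0" unfolding one by (rule K0I)
    show "\<ominus>\<^bsub>L\<^esub> x \<in> K0" if x: "x \<in> K0" for x
    proof -
      obtain t where "x = ?ev t" using x unfolding K0_def by (rule rangeE)
      then show ?thesis using K0I[of "Neg t"] by (simp only: dterm_eval.simps)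
    qed
    fix x y assume x: "x \<in> K0" and y: "y \<in> K0"
    obtain t where t: "x = ?ev t" using x unfolding K0_def by (rule rangeE)
    obtain s where s: "y = ?ev s" using y unfolding K0_def by (rule rangeE)
    show "x \<otimes>\<^bsub>L\<^esub> y \<in> K0" "x \<oplus>\<^bsub>L\<^esub> y \<in> K0"
      using K0I[of "Mul t s"] K0I[of "Add t s"] by (simp_all only: dterm_eval.simps t s)
  qed
  have dK0: "\<delta> x \<in> K0" if x: "x \<in> K0" for x
  proof -
    obtain t where "x = ?ev t" using x unfolding K0_def by (rule rangeE)
    then show ?thesis using K0I[of "Dif t"] by (simp only: dterm_eval.simps)
  qed
  have "subfield K0 L"
  proof (rule E.K.subfieldI'[OF sub])
    fix x assume x: "x \<in> K0 - {\<zero>\<^bsub>L\<^esub>}"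
    then obtain t where "x = ?ev t" by (auto simp: K0_def)
    then have "inv\<^bsub>L\<^esub> x = ?ev (Inv t)" using x by simp
    then show "inv\<^bsub>L\<^esub> x \<in> K0" using K0I[of "Inv t"] by (simp only:)
  qed
  then have fK0: "field (L\<lparr>carrier := K0\<rparr>)" by (rule E.K.subfield_iff(2))
  define \<phi> where "\<phi> x = code (SOME t. ?ev t = x)" for x
  have inj: "inj_on \<phi> K0"
  proof (rule inj_onI)
    fix x y assume xy: "x \<in> K0" "y \<in> K0" "\<phi> x = \<phi> y"
    have s: "?ev (SOME t. ?ev t = w) = w" if w: "w \<in> K0" for w
    proof -
      obtain t where "w = ?ev t" using w unfolding K0_def by (rule rangeE)
      then have "?ev t = w" by (rule sym)
      then show ?thesis by (rule someI)
    qed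
    have "(SOME t. ?ev t = x) = (SOME t. ?ev t = y)" using xy(3) code by (simp add: \<phi>_def inj_eq)
    then show "x = y" using s[OF xy(1)] s[OF xy(2)] by metis
  qed
  define K where "K = image_ring \<phi> (L\<lparr>carrier := K0\<rparr>)"
  define h where "h = inv_into K0 \<phi>"
  interpret K0: field "L\<lparr>carrier := K0\<rparr>" by (rule fK0)
  have inj': "inj_on \<phi> (carrier (L\<lparr>carrier := K0\<rparr>))" using inj by simp
  have fK: "field K" unfolding K_def by (rule K0.inj_imp_image_ring_is_field[OF inj'])
  have iso: "\<phi> \<in> ring_iso (L\<lparr>carrier := K0\<rparr>) K" unfolding K_def by (rule inj_imp_image_ring_iso[OF inj'])
  have \<phi>: "\<phi> \<in> ring_hom (L\<lparr>carrier := K0\<rparr>) K" using iso by (simp add: ring_iso_def)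
  have cK: "carrier K = \<phi> ` K0" by (simp add: K_def image_ring_carrier)
  interpret K: field K by (rule fK)
  have h\<phi>: "h (\<phi> x) = x" if "x \<in> K0" for x using that inj by (simp add: h_def)
  have \<phi>h: "\<phi> (h a) = a" "h a \<in> K0" if "a \<in> carrier K" for a using that h\<phi> by (auto simp: cK)
  have \<phi>c: "\<phi> x \<in> carrier K" if "x \<in> K0" for x using that by (simp add: cK)
  have hom: "h \<in> ring_hom K L"
  proof (rule ring_hom_memI)
    show "h a \<in> carrier L" if "a \<in> carrier K" for a using \<phi>h(2)[OF that] K0c by blast
    fix a b assume ab: "a \<in> carrier K" "b \<in> carrier K"
    have "h a \<otimes>\<^bsub>L\<^esub> h b \<in> K0" "h a \<oplus>\<^bsub>L\<^esub> h b \<in> K0" using subringE(6,7)[OF sub] \<phi>h(2) ab by auto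
    moreover have "a \<otimes>\<^bsub>K\<^esub> b = \<phi> (h a \<otimes>\<^bsub>L\<^esub> h b)" "a \<oplus>\<^bsub>K\<^esub> b = \<phi> (h a \<oplus>\<^bsub>L\<^esub> h b)"
      using ring_hom_mult[OF \<phi>, of "h a" "h b"] ring_hom_add[OF \<phi>, of "h a" "h b"] \<phi>h ab by simp_all
    ultimately show "h (a \<otimes>\<^bsub>K\<^esub> b) = h a \<otimes>\<^bsub>L\<^esub> h b" "h (a \<oplus>\<^bsub>K\<^esub> b) = h a \<oplus>\<^bsub>L\<^esub> h b" by (simp_all add: h\<phi>)
  next
    have "\<one>\<^bsub>K\<^esub> = \<phi> \<one>\<^bsub>L\<^esub>" using ring_hom_one[OF \<phi>] by simp
    then show "h \<one>\<^bsub>K\<^esub> = \<one>\<^bsub>L\<^esub>" using h\<phi>[OF subringE(3)[OF sub]] by simp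
  qed
  interpret h: ring_hom_cring K L h by unfold_locales (rule hom)
  note hinj = field_hom_inj[OF fK E.K.field_axioms hom]
  define \<delta>' where "\<delta>' a = \<phi> (\<delta> (h a))" for a
  have h\<delta>: "h (\<delta>' a) = \<delta> (h a)" if "a \<in> carrier K" for a
    unfolding \<delta>'_def by (rule h\<phi>[OF dK0[OF \<phi>h(2)[OF that]]])
  have \<delta>c: "\<delta>' a \<in> carrier K" if "a \<in> carrier K" for a
    unfolding \<delta>'_def by (rule \<phi>c[OF dK0[OF \<phi>h(2)[OF that]]])
  have "K.derivation \<delta>'"
    unfolding K.derivation_def
  proof (intro conjI ballI)
    fix a b assume ab: "a \<in> carrier K" "b \<in> carrier K"
    show "\<delta>' (a \<oplus>\<^bsub>K\<^esub> b) = \<delta>' a \<oplus>\<^bsub>K\<^esub> \<delta>' b"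
      by (rule hinj) (use ab \<delta>c in \<open>simp_all add: h\<delta> E.K.D_add\<close>)
    show "\<delta>' (a \<otimes>\<^bsub>K\<^esub> b) = a \<otimes>\<^bsub>K\<^esub> \<delta>' b \<oplus>\<^bsub>K\<^esub> \<delta>' a \<otimes>\<^bsub>K\<^esub> b"
      by (rule hinj) (use ab \<delta>c in \<open>simp_all add: h\<delta> E.K.D_mult\<close>)
  qed (rule \<delta>c)
  moreover have chK: "K.char_zero"
    unfolding K.char_zero_def
  proof (intro allI impI notI)
    fix m :: nat assume m: "0 < m" "[m] \<cdot>\<^bsub>K\<^esub> \<one>\<^bsub>K\<^esub> = \<zero>\<^bsub>K\<^esub>"
    then have "[m] \<cdot>\<^bsub>L\<^esub> \<one>\<^bsub>L\<^esub> = h \<zero>\<^bsub>K\<^esub>" using ring_hom_nat[OF K.ring_axioms E.K.ring_axioms hom, of m] by simp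
    then show False using E.K.char_0[OF m(1)] by simp
  qed
  ultimately have dK: "differential_field K \<delta>'" by (rule K.derivation_differential_field)
  have \<sigma>K0: "\<sigma> a \<in> K0" if "a \<in> carrier F" for a
    using that unfolding K0_def by (intro image_eqI[of _ _ "Cst a"]) auto
  have zK0: "z j \<in> K0" for j unfolding K0_def by (intro image_eqI[of _ _ "Gen j"]) auto
  define \<sigma>' where "\<sigma>' a = \<phi> (\<sigma> a)" for a
  have h\<sigma>: "h (\<sigma>' a) = \<sigma> a" if "a \<in> carrier F" for a using h\<phi> \<sigma>K0 that by (simp add: \<sigma>'_def)
  have \<sigma>c: "\<sigma>' a \<in> carrier K" if "a \<in> carrier F" for a using \<phi>c \<sigma>K0 that by (simp add: \<sigma>'_def)
  have \<sigma>hom: "\<sigma>' \<in> ring_hom F K"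
  proof (rule ring_hom_memI)
    show "\<sigma>' a \<in> carrier K" if "a \<in> carrier F" for a using \<sigma>c that .
    fix a b assume ab: "a \<in> carrier F" "b \<in> carrier F"
    show "\<sigma>' (a \<otimes>\<^bsub>F\<^esub> b) = \<sigma>' a \<otimes>\<^bsub>K\<^esub> \<sigma>' b" "\<sigma>' (a \<oplus>\<^bsub>F\<^esub> b) = \<sigma>' a \<oplus>\<^bsub>K\<^esub> \<sigma>' b"
      by (rule hinj, use ab \<sigma>c in \<open>simp_all add: h\<sigma> ring_hom_mult[OF E.hom] ring_hom_add[OF E.hom]\<close>)+
  next
    show "\<sigma>' \<one>\<^bsub>F\<^esub> = \<one>\<^bsub>K\<^esub>" by (rule hinj) (use \<sigma>c in \<open>simp_all add: h\<sigma> ring_hom_one[OF E.hom]\<close>)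
  qed
  have e1: "differential_field_extension F D K \<delta>' \<sigma>'"
  proof (intro differential_field_extension.intro differential_field_extension_axioms.intro)
    show "\<sigma>' (D a) = \<delta>' (\<sigma>' a)" if "a \<in> carrier F" for a
      by (rule hinj) (use that \<sigma>c \<delta>c E.F.D_closed E.commutes in \<open>simp_all add: h\<delta> h\<sigma>\<close>)
  qed (rule E.F.differential_field_axioms dK \<sigma>hom)+
  have e2: "differential_field_extension K \<delta>' L \<delta> h"
    by (intro differential_field_extension.intro differential_field_extension_axioms.intro dK
        E.K.differential_field_axioms hom h\<delta>)
  have e3: "\<phi> (z j) \<in> carrier K" "h (\<phi> (z j)) = z j" for j by (rule \<phi>c[OF zK0], rule h\<phi>[OF zK0])
  show ?thesis
    by (rule exI[of _ K], rule exI[of _ \<delta>'], rule exI[of _ \<sigma>'], rule exI[of _ h], rule exI[of _ "\<lambda>j. \<phi> (z j)"])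
      (intro conjI ballI allI e1 e2 e3 h\<sigma>)
qed

section \<open>Uniform polynomial expressions\<close>

text \<open>
  Polynomials over \<open>F\<close> can be evaluated in any extension \<open>K\<close>. The next notions describe the functions,
  uniform in \<open>K\<close> and the embedding, that arise in this way; uniformity is needed because a
  differentially closed field is compared with its extensions.
\<close>

definition evaluation :: "'a ring \<Rightarrow> 'a ring \<Rightarrow> ('a \<Rightarrow> 'a) \<Rightarrow> ('v \<Rightarrow> 'a) \<Rightarrow> bool" where
  "evaluation F K \<sigma> a \<longleftrightarrow> cring F \<and> cring K \<and> \<sigma> \<in> ring_hom F K \<and> (\<forall>v. a v \<in> carrier K)"

lemma evaluation_simps:
  assumes "evaluation F K \<sigma> a"
  shows "k \<in> carrier F \<Longrightarrow> ring.mpoly_eval K (\<sigma> \<circ> ring.indexed_const F k) a = \<sigma> k"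
    and "\<lbrakk>P \<in> ring.indexed_pset F I (carrier F); Q \<in> ring.indexed_pset F I (carrier F)\<rbrakk> \<Longrightarrow>
      ring.mpoly_eval K (\<sigma> \<circ> ring.indexed_padd F P Q) a = ring.mpoly_eval K (\<sigma> \<circ> P) a \<oplus>\<^bsub>K\<^esub> ring.mpoly_eval K (\<sigma> \<circ> Q) a"
    and "P \<in> ring.indexed_pset F I (carrier F) \<Longrightarrow>
      ring.mpoly_eval K (\<sigma> \<circ> ring.indexed_pmult F P i) a = ring.mpoly_eval K (\<sigma> \<circ> P) a \<otimes>\<^bsub>K\<^esub> a i"
    and "P \<in> ring.indexed_pset F I (carrier F) \<Longrightarrow> ring.mpoly_eval K (\<sigma> \<circ> P) a \<in> carrier K"
proof -
  interpret F: cring F using assms by (simp add: evaluation_def)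
  interpret K: cring K using assms by (simp add: evaluation_def)
  have \<sigma>: "\<sigma> \<in> ring_hom F K" and a: "\<And>v. a v \<in> carrier K" using assms by (simp_all add: evaluation_def)
  note r = F.ring_axioms K.ring_axioms \<sigma>
  note h = ring_hom_indexed_pset[OF r]
  show "K.mpoly_eval (\<sigma> \<circ> F.indexed_const k) a = \<sigma> k" if "k \<in> carrier F"
    unfolding ring_hom_indexed(1)[OF r that] by (rule K.mpoly_eval_const[OF ring_hom_closed[OF \<sigma> that] a])
  show "K.mpoly_eval (\<sigma> \<circ> F.indexed_padd P Q) a = K.mpoly_eval (\<sigma> \<circ> P) a \<oplus>\<^bsub>K\<^esub> K.mpoly_eval (\<sigma> \<circ> Q) a"
    if "P \<in> F.indexed_pset I (carrier F)" "Q \<in> F.indexed_pset I (carrier F)"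
    unfolding ring_hom_indexed(2)[OF r that] by (rule K.mpoly_eval_padd[OF h[OF that(1)] h[OF that(2)] a])
  show "K.mpoly_eval (\<sigma> \<circ> F.indexed_pmult P i) a = K.mpoly_eval (\<sigma> \<circ> P) a \<otimes>\<^bsub>K\<^esub> a i"
    if "P \<in> F.indexed_pset I (carrier F)"
    unfolding ring_hom_indexed(3)[OF r] by (rule K.mpoly_eval_pmult[OF h[OF that] a])
  show "K.mpoly_eval (\<sigma> \<circ> P) a \<in> carrier K" if "P \<in> F.indexed_pset I (carrier F)"
    by (rule K.mpoly_eval_closed[OF h[OF that] a])
qed

lemma evaluation_K: 
  assumes "evaluation F K \<sigma> a"
  shows "cring K" "\<sigma> \<in> ring_hom F K" "a v \<in> carrier K" "c \<in> carrier F \<Longrightarrow> \<sigma> c \<in> carrier K"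
  using assms ring_hom_closed by (auto simp: evaluation_def)

definition realizes :: "'a ring \<Rightarrow> 'v set \<Rightarrow> ('v multiset \<Rightarrow> 'a) \<Rightarrow> ('a ring \<Rightarrow> ('a \<Rightarrow> 'a) \<Rightarrow> ('v \<Rightarrow> 'a) \<Rightarrow> 'a) \<Rightarrow> bool" where
  "realizes F I P g \<longleftrightarrow> P \<in> ring.indexed_pset F I (carrier F) \<and>
     (\<forall>K \<sigma> a. evaluation F K \<sigma> a \<longrightarrow> ring.mpoly_eval K (\<sigma> \<circ> P) a = g K \<sigma> a)"

definition realizable :: "'a ring \<Rightarrow> 'v set \<Rightarrow> ('a ring \<Rightarrow> ('a \<Rightarrow> 'a) \<Rightarrow> ('v \<Rightarrow> 'a) \<Rightarrow> 'a) \<Rightarrow> bool" where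
  "realizable F I g \<longleftrightarrow> (\<exists>P. realizes F I P g)"

lemma realizable_cong:
  assumes "realizable F I g" "\<And>K \<sigma> a. evaluation F K \<sigma> a \<Longrightarrow> g K \<sigma> a = g' K \<sigma> a"
  shows "realizable F I g'"
  using assms unfolding realizable_def realizes_def by metis

lemma realizable_closed: "\<lbrakk>realizable F I g; evaluation F K \<sigma> a\<rbrakk> \<Longrightarrow> g K \<sigma> a \<in> carrier K"
  unfolding realizable_def realizes_def using evaluation_simps(4) by metis

context
  fixes F :: "'a ring" assumes F: "cring F"
begin

interpretation F: cring F by (rule F)

lemma realizable_const: "c \<in> carrier F \<Longrightarrow> realizable F I (\<lambda>K \<sigma> a. \<sigma> c)"
  unfolding realizable_def realizes_def
  by (intro exI[of _ "F.indexed_const c"] conjI allI impI F.indexed_pset.indexed_const evaluation_simps(1))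

lemma realizable_add:
  assumes "realizable F I g" "realizable F I h"
  shows "realizable F I (\<lambda>K \<sigma> a. g K \<sigma> a \<oplus>\<^bsub>K\<^esub> h K \<sigma> a)"
proof -
  obtain P Q where P: "realizes F I P g" and Q: "realizes F I Q h" using assms unfolding realizable_def by blast
  have "realizes F I (F.indexed_padd P Q) (\<lambda>K \<sigma> a. g K \<sigma> a \<oplus>\<^bsub>K\<^esub> h K \<sigma> a)"
    using P Q evaluation_simps(2)[of F _ _ _ P I Q] unfolding realizes_def
    by (auto intro: F.indexed_pset.indexed_padd simp del: o_apply)
  then show ?thesis unfolding realizable_def by blast
qed

lemma realizable_mult_var:
  assumes "realizable F I g" "v \<in> I"
  shows "realizable F I (\<lambda>K \<sigma> a. g K \<sigma> a \<otimes>\<^bsub>K\<^esub> a v)"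
proof -
  obtain P where P: "realizes F I P g" using assms unfolding realizable_def by blast
  have "realizes F I (F.indexed_pmult P v) (\<lambda>K \<sigma> a. g K \<sigma> a \<otimes>\<^bsub>K\<^esub> a v)"
    using P assms(2) evaluation_simps(3)[of F _ _ _ P I v] unfolding realizes_def
    by (auto intro: F.indexed_pset.indexed_pmult simp del: o_apply)
  then show ?thesis unfolding realizable_def by blast
qed

lemma realizable_var: "v \<in> I \<Longrightarrow> realizable F I (\<lambda>K \<sigma> a. a v)"
proof -
  assume v: "v \<in> I"
  show ?thesis
  proof (rule realizable_cong[OF realizable_mult_var[OF realizable_const[OF F.one_closed] v]])
    fix K \<sigma> and a :: "'b \<Rightarrow> 'a" assume e: "evaluation F K \<sigma> a"
    interpret K: cring K by (rule evaluation_K(1)[OF e])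
    show "\<sigma> \<one>\<^bsub>F\<^esub> \<otimes>\<^bsub>K\<^esub> a v = a v" using ring_hom_one[OF evaluation_K(2)[OF e]] evaluation_K(3)[OF e] by simp
  qed
qed

lemma realizable_scale:
  assumes g: "realizable F I g" and c: "c \<in> carrier F"
  shows "realizable F I (\<lambda>K \<sigma> a. g K \<sigma> a \<otimes>\<^bsub>K\<^esub> \<sigma> c)"
proof -
  obtain P where P: "realizes F I P g" using g unfolding realizable_def by blast
  have PI: "P \<in> F.indexed_pset I (carrier F)" using P by (simp add: realizes_def)
  have "realizable F I (\<lambda>K \<sigma> a. ring.mpoly_eval K (\<sigma> \<circ> P) a \<otimes>\<^bsub>K\<^esub> \<sigma> c)"
    using PI
  proof (induction rule: F.indexed_pset.induct)
    case (indexed_const k)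
    show ?case
    proof (rule realizable_cong[OF realizable_const])
      show "k \<otimes>\<^bsub>F\<^esub> c \<in> carrier F" using indexed_const c by simp
      fix K \<sigma> and a :: "'b \<Rightarrow> 'a" assume e: "evaluation F K \<sigma> a"
      show "\<sigma> (k \<otimes>\<^bsub>F\<^esub> c) = ring.mpoly_eval K (\<sigma> \<circ> F.indexed_const k) a \<otimes>\<^bsub>K\<^esub> \<sigma> c"
        using ring_hom_mult[OF evaluation_K(2)[OF e] indexed_const c] evaluation_simps(1)[OF e indexed_const] by simp
    qed
  next
    case (indexed_padd P Q)
    show ?case
    proof (rule realizable_cong[OF realizable_add[OF indexed_padd(3,4)]])
      fix K \<sigma> and a :: "'b \<Rightarrow> 'a" assume e: "evaluation F K \<sigma> a"
      interpret K: cring K by (rule evaluation_K(1)[OF e])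
      show "K.mpoly_eval (\<sigma> \<circ> P) a \<otimes>\<^bsub>K\<^esub> \<sigma> c \<oplus>\<^bsub>K\<^esub> K.mpoly_eval (\<sigma> \<circ> Q) a \<otimes>\<^bsub>K\<^esub> \<sigma> c
        = K.mpoly_eval (\<sigma> \<circ> F.indexed_padd P Q) a \<otimes>\<^bsub>K\<^esub> \<sigma> c"
        unfolding evaluation_simps(2)[OF e indexed_padd(1,2)]
        using evaluation_simps(4)[OF e indexed_padd(1)] evaluation_simps(4)[OF e indexed_padd(2)] evaluation_K(4)[OF e c]
        by (simp add: K.l_distr del: o_apply)
    qed
  next
    case (indexed_pmult P i)
    show ?case
    proof (rule realizable_cong[OF realizable_mult_var[OF indexed_pmult(3,2)]])
      fix K \<sigma> and a :: "'b \<Rightarrow> 'a" assume e: "evaluation F K \<sigma> a"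
      interpret K: cring K by (rule evaluation_K(1)[OF e])
      show "K.mpoly_eval (\<sigma> \<circ> P) a \<otimes>\<^bsub>K\<^esub> \<sigma> c \<otimes>\<^bsub>K\<^esub> a i = K.mpoly_eval (\<sigma> \<circ> F.indexed_pmult P i) a \<otimes>\<^bsub>K\<^esub> \<sigma> c"
        unfolding evaluation_simps(3)[OF e indexed_pmult(1)]
        using evaluation_simps(4)[OF e indexed_pmult(1)] evaluation_K(3,4)[OF e] c
        by (simp add: K.m_ac del: o_apply)
    qed
  qed
  then show ?thesis by (rule realizable_cong) (use P in \<open>simp add: realizes_def\<close>)
qed

lemma realizable_mult:
  assumes g: "realizable F I g" and h: "realizable F I h"
  shows "realizable F I (\<lambda>K \<sigma> a. g K \<sigma> a \<otimes>\<^bsub>K\<^esub> h K \<sigma> a)"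
proof -
  obtain Q where Q: "realizes F I Q h" using h unfolding realizable_def by blast
  have QI: "Q \<in> F.indexed_pset I (carrier F)" using Q by (simp add: realizes_def)
  have "realizable F I (\<lambda>K \<sigma> a. g K \<sigma> a \<otimes>\<^bsub>K\<^esub> ring.mpoly_eval K (\<sigma> \<circ> Q) a)"
    using QI
  proof (induction rule: F.indexed_pset.induct)
    case (indexed_const k)
    show ?case by (rule realizable_cong[OF realizable_scale[OF g indexed_const]])
        (simp add: evaluation_simps(1)[OF _ indexed_const] del: o_apply)
  next
    case (indexed_padd P Q)
    show ?case
    proof (rule realizable_cong[OF realizable_add[OF indexed_padd(3,4)]])
      fix K \<sigma> and a :: "'b \<Rightarrow> 'a" assume e: "evaluation F K \<sigma> a"
      interpret K: cring K by (rule evaluation_K(1)[OF e])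
      show "g K \<sigma> a \<otimes>\<^bsub>K\<^esub> K.mpoly_eval (\<sigma> \<circ> P) a \<oplus>\<^bsub>K\<^esub> g K \<sigma> a \<otimes>\<^bsub>K\<^esub> K.mpoly_eval (\<sigma> \<circ> Q) a
        = g K \<sigma> a \<otimes>\<^bsub>K\<^esub> K.mpoly_eval (\<sigma> \<circ> F.indexed_padd P Q) a"
        unfolding evaluation_simps(2)[OF e indexed_padd(1,2)]
        using evaluation_simps(4)[OF e indexed_padd(1)] evaluation_simps(4)[OF e indexed_padd(2)] realizable_closed[OF g e]
        by (simp add: K.r_distr del: o_apply)
    qed
  next
    case (indexed_pmult P i)
    show ?case
    proof (rule realizable_cong[OF realizable_mult_var[OF indexed_pmult(3,2)]])
      fix K \<sigma> and a :: "'b \<Rightarrow> 'a" assume e: "evaluation F K \<sigma> a"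
      interpret K: cring K by (rule evaluation_K(1)[OF e])
      show "g K \<sigma> a \<otimes>\<^bsub>K\<^esub> K.mpoly_eval (\<sigma> \<circ> P) a \<otimes>\<^bsub>K\<^esub> a i = g K \<sigma> a \<otimes>\<^bsub>K\<^esub> K.mpoly_eval (\<sigma> \<circ> F.indexed_pmult P i) a"
        unfolding evaluation_simps(3)[OF e indexed_pmult(1)]
        using evaluation_simps(4)[OF e indexed_pmult(1)] evaluation_K(3)[OF e] realizable_closed[OF g e]
        by (simp add: K.m_assoc del: o_apply)
    qed
  qed
  then show ?thesis by (rule realizable_cong) (use Q in \<open>simp add: realizes_def\<close>)
qed

lemma realizable_nat: "realizable F I (\<lambda>K \<sigma> a. [(k::nat)] \<cdot>\<^bsub>K\<^esub> \<one>\<^bsub>K\<^esub>)"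
proof (rule realizable_cong[OF realizable_const])
  show "[k] \<cdot>\<^bsub>F\<^esub> \<one>\<^bsub>F\<^esub> \<in> carrier F" by simp
  fix K \<sigma> and a :: "'b \<Rightarrow> 'a" assume e: "evaluation F K \<sigma> a"
  interpret K: cring K by (rule evaluation_K(1)[OF e])
  show "\<sigma> ([k] \<cdot>\<^bsub>F\<^esub> \<one>\<^bsub>F\<^esub>) = [k] \<cdot>\<^bsub>K\<^esub> \<one>\<^bsub>K\<^esub>" by (rule ring_hom_nat[OF F.ring_axioms K.ring_axioms evaluation_K(2)[OF e]])
qed

lemma realizable_diff:
  assumes g: "realizable F I g" and h: "realizable F I h"
  shows "realizable F I (\<lambda>K \<sigma> a. g K \<sigma> a \<ominus>\<^bsub>K\<^esub> h K \<sigma> a)"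
proof (rule realizable_cong[OF realizable_add[OF g realizable_scale[OF h]]])
  show "\<ominus>\<^bsub>F\<^esub> \<one>\<^bsub>F\<^esub> \<in> carrier F" by simp
  fix K \<sigma> and a :: "'b \<Rightarrow> 'a" assume e: "evaluation F K \<sigma> a"
  interpret K: cring K by (rule evaluation_K(1)[OF e])
  interpret s: ring_hom_cring F K \<sigma> by unfold_locales (rule evaluation_K(2)[OF e])
  show "g K \<sigma> a \<oplus>\<^bsub>K\<^esub> h K \<sigma> a \<otimes>\<^bsub>K\<^esub> \<sigma> (\<ominus>\<^bsub>F\<^esub> \<one>\<^bsub>F\<^esub>) = g K \<sigma> a \<ominus>\<^bsub>K\<^esub> h K \<sigma> a"
    using realizable_closed[OF g e] realizable_closed[OF h e] by (simp add: K.r_minus K.minus_eq)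
qed

lemma realizable_Psi_numerator:
  assumes "v0 \<in> I" "v1 \<in> I" "v2 \<in> I" "v3 \<in> I"
  shows "realizable F I (\<lambda>K \<sigma> a. ring.Psi_numerator K (a v0) (a v1) (a v2) (a v3))"
proof (rule realizable_cong)
  fix K \<sigma> and a :: "'b \<Rightarrow> 'a" assume e: "evaluation F K \<sigma> a"
  interpret K: cring K by (rule evaluation_K(1)[OF e])
  show "((a v0 \<otimes>\<^bsub>K\<^esub> a v0) \<otimes>\<^bsub>K\<^esub> ((a v0 \<ominus>\<^bsub>K\<^esub> [(1728::nat)] \<cdot>\<^bsub>K\<^esub> \<one>\<^bsub>K\<^esub>) \<otimes>\<^bsub>K\<^esub> (a v0 \<ominus>\<^bsub>K\<^esub> [(1728::nat)] \<cdot>\<^bsub>K\<^esub> \<one>\<^bsub>K\<^esub>))) \<otimes>\<^bsub>K\<^esub>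
       ([(2::nat)] \<cdot>\<^bsub>K\<^esub> \<one>\<^bsub>K\<^esub> \<otimes>\<^bsub>K\<^esub> (a v1 \<otimes>\<^bsub>K\<^esub> a v3) \<ominus>\<^bsub>K\<^esub> [(3::nat)] \<cdot>\<^bsub>K\<^esub> \<one>\<^bsub>K\<^esub> \<otimes>\<^bsub>K\<^esub> (a v2 \<otimes>\<^bsub>K\<^esub> a v2)) \<oplus>\<^bsub>K\<^esub>
     (a v0 \<otimes>\<^bsub>K\<^esub> a v0 \<ominus>\<^bsub>K\<^esub> [(1968::nat)] \<cdot>\<^bsub>K\<^esub> \<one>\<^bsub>K\<^esub> \<otimes>\<^bsub>K\<^esub> a v0 \<oplus>\<^bsub>K\<^esub> [(2654208::nat)] \<cdot>\<^bsub>K\<^esub> \<one>\<^bsub>K\<^esub>) \<otimes>\<^bsub>K\<^esub>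
     ((a v1 \<otimes>\<^bsub>K\<^esub> a v1) \<otimes>\<^bsub>K\<^esub> (a v1 \<otimes>\<^bsub>K\<^esub> a v1)) = K.Psi_numerator (a v0) (a v1) (a v2) (a v3)"
    by (simp only: K.Psi_numerator_def)
qed (intro realizable_add realizable_mult realizable_diff realizable_nat realizable_var assms)

lemma realizable_rename:
  assumes P: "P \<in> F.indexed_pset J (carrier F)" and f: "\<And>j. j \<in> J \<Longrightarrow> f j \<in> I"
  shows "realizable F I (\<lambda>K \<sigma> a. ring.mpoly_eval K (\<sigma> \<circ> P) (\<lambda>j. a (f j)))"
  using P
proof (induction rule: F.indexed_pset.induct)
  have e': "evaluation F K \<sigma> (\<lambda>j. a (f j))" if "evaluation F K \<sigma> a" for K \<sigma> a
    using that by (simp add: evaluation_def)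
  {
    case (indexed_const k)
    show ?case by (rule realizable_cong[OF realizable_const[OF indexed_const]])
      (rule evaluation_simps(1)[OF e' indexed_const, symmetric])
  next
    case (indexed_padd P Q)
    show ?case by (rule realizable_cong[OF realizable_add[OF indexed_padd(3,4)]])
      (rule evaluation_simps(2)[OF e' indexed_padd(1,2), symmetric])
  next
    case (indexed_pmult P i)
    show ?case by (rule realizable_cong[OF realizable_mult_var[OF indexed_pmult(3) f[OF indexed_pmult(2)]]])
      (rule evaluation_simps(3)[OF e' indexed_pmult(1), symmetric])
  }
qed

end

definition realization :: "'a ring \<Rightarrow> 'v set \<Rightarrow> ('a ring \<Rightarrow> ('a \<Rightarrow> 'a) \<Rightarrow> ('v \<Rightarrow> 'a) \<Rightarrow> 'a) \<Rightarrow> ('v multiset \<Rightarrow> 'a)" where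
  "realization F I g = (SOME P. realizes F I P g)"

lemma realizes_realization: "realizable F I g \<Longrightarrow> realizes F I (realization F I g) g"
  unfolding realizable_def realization_def by (rule someI_ex[of "\<lambda>P. realizes F I P g"])

text \<open>
  The points of \<open>diff_solution\<close> are lists, and the jet of a list takes arbitrary values beyond its
  length; only variables inside occur in the realization.
\<close>

lemma realization_at_jet:
  assumes F: "cring F" and K: "differential_field K \<delta>" and \<sigma>: "\<sigma> \<in> ring_hom F K"
    and g: "realizable F ({..<m} \<times> UNIV) g" and z: "\<And>j. z j \<in> carrier K"
  shows "ring.mpoly_eval K (\<sigma> \<circ> realization F ({..<m} \<times> UNIV) g) (\<lambda>(i, r). (\<delta> ^^ r) (map z [0..<m] ! i)) =
    g K \<sigma> (\<lambda>(i, r). (\<delta> ^^ r) (z i))"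
proof -
  interpret F: cring F by (rule F)
  interpret K: differential_field K \<delta> by (rule K)
  let ?P = "realization F ({..<m} \<times> UNIV) g"
  have P: "realizes F ({..<m} \<times> UNIV) ?P g" by (rule realizes_realization[OF g])
  have dc: "(\<delta> ^^ r) (z i) \<in> carrier K" for r i by (induction r) (use z K.D_closed in auto)
  have e: "evaluation F K \<sigma> (\<lambda>(i, r). (\<delta> ^^ r) (z i))"
    using F.is_cring K.is_cring \<sigma> dc by (auto simp: evaluation_def)
  have PK: "\<sigma> \<circ> ?P \<in> K.indexed_pset ({..<m} \<times> UNIV) (carrier K)"
    using P ring_hom_indexed_pset[OF F.ring_axioms K.ring_axioms \<sigma>] by (auto simp: realizes_def)
  have "K.mpoly_eval (\<sigma> \<circ> ?P) (\<lambda>(i, r). (\<delta> ^^ r) (map z [0..<m] ! i)) = K.mpoly_eval (\<sigma> \<circ> ?P) (\<lambda>(i, r). (\<delta> ^^ r) (z i))"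
    by (rule K.mpoly_eval_cong[OF PK]) (use dc in auto)
  also have "\<dots> = g K \<sigma> (\<lambda>(i, r). (\<delta> ^^ r) (z i))" using P e by (simp add: realizes_def)
  finally show ?thesis .
qed

section \<open>Existential closedness\<close>

text \<open>
  Being a \<open>j_solution\<close> on the variety is expressed by a finite system of differential polynomial
  equations \<open>EQ\<close> and inequations \<open>NE\<close> in \<open>5n\<close> unknowns. It is solvable in \<open>K\<close>, hence in \<open>F\<close>.
\<close>

theorem differentially_closed_j_solution:
  fixes F :: "'a ring" and K :: "'a ring"
  assumes dc: "differentially_closed F D" and ext: "differential_field_extension F D K \<delta> \<sigma>"
    and S: "finite S" "S \<subseteq> ring.indexed_pset F {..<2 * n} (carrier F)"
    and sol: "j_solution K \<delta> n z" and van: "\<And>P. P \<in> S \<Longrightarrow> ring.mpoly_eval K (\<sigma> \<circ> P) z = \<zero>\<^bsub>K\<^esub>"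
  shows "\<exists>w. j_solution F D n w \<and> (\<forall>P\<in>S. ring.mpoly_eval F (id \<circ> P) w = \<zero>\<^bsub>F\<^esub>)"
proof -
  interpret E: differential_field_extension F D K \<delta> \<sigma> by (rule ext)
  note cF = E.F.is_cring
  define m where "m = 5 * n"
  let ?I = "{..<m} \<times> (UNIV :: nat set)"
  let ?jet = "\<lambda>(\<delta> :: 'a \<Rightarrow> 'a) z (i :: nat, r :: nat). (\<delta> ^^ r) (z i)"
  define gJ where "gJ i = (\<lambda>(K :: 'a ring) (\<sigma> :: 'a \<Rightarrow> 'a) a. ring.Psi_numerator K (a (n + i, 0 :: nat)) (a (2 * n + i, 0)) (a (3 * n + i, 0)) (a (4 * n + i, 0)))" for i
  define gD where "gD b c i = (\<lambda>(K :: 'a ring) (\<sigma> :: 'a \<Rightarrow> 'a) a. a (b * n + i, 1 :: nat) \<ominus>\<^bsub>K\<^esub> a (c * n + i, 0) \<otimes>\<^bsub>K\<^esub> a (i, 1))" for b c i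
  define gS where "gS P = (\<lambda>(K :: 'a ring) \<sigma> a. ring.mpoly_eval K (\<sigma> \<circ> P) (\<lambda>j. a (j :: nat, 0 :: nat)))" for P :: "nat multiset \<Rightarrow> 'a"
  define gN where "gN b i = (\<lambda>(K :: 'a ring) (\<sigma> :: 'a \<Rightarrow> 'a) a. a (b * n + i, 0 :: nat) :: 'a)" for b i :: nat
  define gM where "gM i = (\<lambda>(K :: 'a ring) (\<sigma> :: 'a \<Rightarrow> 'a) a. a (n + i, 0 :: nat) \<ominus>\<^bsub>K\<^esub> [(1728::nat)] \<cdot>\<^bsub>K\<^esub> \<one>\<^bsub>K\<^esub>)" for i
  have bm: "b * n + i < m" if "i < n" "b < 5" for b i
  proof -
    have "b * n + i < b * n + n" using that by simp
    also have "\<dots> = (b + 1) * n" by simp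
    also have "\<dots> \<le> 5 * n" using that by (intro mult_right_mono) auto
    finally show ?thesis by (simp add: m_def)
  qed
  have vI: "(b * n + i, r) \<in> ?I" if "i < n" "b < 5" for b i r using bm[OF that] by simp
  have rJ: "realizable F ?I (gJ i)" if "i < n" for i
    unfolding gJ_def using vI[OF that, of 1] vI[OF that, of 2] vI[OF that, of 3] vI[OF that, of 4]
    by (intro realizable_Psi_numerator cF) auto
  have rD: "realizable F ?I (gD b c i)" if "i < n" "b < 5" "c < 5" for b c i
    unfolding gD_def using vI[OF that(1,2)] vI[OF that(1,3)] vI[OF that(1), of 0]
    by (intro realizable_diff realizable_mult realizable_var cF) auto
  have rS: "realizable F ?I (gS P)" if "P \<in> S" for P
    unfolding gS_def using that S(2) by (intro realizable_rename[OF cF, where J = "{..<2 * n}"]) (auto simp: m_def)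
  have rN: "realizable F ?I (gN b i)" if "i < n" "b < 5" for b i
    unfolding gN_def by (rule realizable_var[OF cF vI[OF that]])
  have rM: "realizable F ?I (gM i)" if "i < n" for i
    unfolding gM_def using vI[OF that, of 1] by (intro realizable_diff realizable_var realizable_nat cF) auto
  define EQ where "EQ = gJ ` {..<n} \<union> gD 1 2 ` {..<n} \<union> gD 2 3 ` {..<n} \<union> gD 3 4 ` {..<n} \<union> gS ` S"
  define NE where "NE = (\<lambda>(b, i). gN b i) ` ({1, 2} \<times> {..<n}) \<union> gM ` {..<n}"
  have fin: "finite EQ" "finite NE" using S(1) by (simp_all add: EQ_def NE_def)
  have real: "realizable F ?I g" if "g \<in> EQ \<union> NE" for g
    using that rJ rD rS rN rM by (auto simp: EQ_def NE_def)
  let ?r = "realization F ?I"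
  have sub: "?r ` EQ \<union> ?r ` NE \<subseteq> ring.indexed_pset F ?I (carrier F)"
    using realizes_realization[OF real] by (auto simp: realizes_def)
  have zc: "z j \<in> carrier K" for j using sol by (simp add: j_solution_def)
  have dzc: "\<delta> (z j) \<in> carrier K" for j using zc E.K.D_closed by blast
  note chK = differential_field_char_zero[OF E.K.differential_field_axioms]
  note chF = differential_field_char_zero[OF E.F.differential_field_axioms]
  have eqK: "g K \<sigma> (?jet \<delta> z) = \<zero>\<^bsub>K\<^esub>" if g: "g \<in> EQ" for g
  proof -
    have s: "z (2 * n + i) \<noteq> \<zero>\<^bsub>K\<^esub>" "z (n + i) \<noteq> \<zero>\<^bsub>K\<^esub>" "z (n + i) \<noteq> [(1728::nat)] \<cdot>\<^bsub>K\<^esub> \<one>\<^bsub>K\<^esub>"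
      "E.K.Psi (z (n + i)) (z (2 * n + i)) (z (3 * n + i)) (z (4 * n + i)) = \<zero>\<^bsub>K\<^esub>"
      "\<delta> (z (n + i)) = z (2 * n + i) \<otimes>\<^bsub>K\<^esub> \<delta> (z i)" "\<delta> (z (2 * n + i)) = z (3 * n + i) \<otimes>\<^bsub>K\<^esub> \<delta> (z i)"
      "\<delta> (z (3 * n + i)) = z (4 * n + i) \<otimes>\<^bsub>K\<^esub> \<delta> (z i)" if "i < n" for i
      using sol that unfolding j_solution_def by auto
    have J: "gJ i K \<sigma> (?jet \<delta> z) = \<zero>\<^bsub>K\<^esub>" if i: "i < n" for i
      using E.K.Psi_eq_zero_iff[OF zc zc zc zc s(1,2,3)[OF i] chK] s(4)[OF i] by (simp add: gJ_def)
    have Dq: "gD 1 2 i K \<sigma> (?jet \<delta> z) = \<zero>\<^bsub>K\<^esub>" "gD 2 3 i K \<sigma> (?jet \<delta> z) = \<zero>\<^bsub>K\<^esub>"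
      "gD 3 4 i K \<sigma> (?jet \<delta> z) = \<zero>\<^bsub>K\<^esub>" if "i < n" for i
      using s(5-7)[OF that] zc dzc by (simp_all add: gD_def)
    have Sq: "gS P K \<sigma> (?jet \<delta> z) = \<zero>\<^bsub>K\<^esub>" if "P \<in> S" for P using van[OF that] by (simp add: gS_def)
    show ?thesis using g J Dq Sq by (auto simp: EQ_def)
  qed
  have neK: "g K \<sigma> (?jet \<delta> z) \<noteq> \<zero>\<^bsub>K\<^esub>" if "g \<in> NE" for g
    using that sol zc unfolding j_solution_def NE_def gN_def gM_def by auto
  let ?a = "map z [0..<m]"
  have "E.K.diff_solution m ((\<lambda>p. \<sigma> \<circ> p) ` ?r ` EQ) ((\<lambda>p. \<sigma> \<circ> p) ` ?r ` NE) ?a"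
    unfolding E.K.diff_solution_def
  proof (intro conjI ballI)
    show "?a \<in> E.K.affine_space m" using zc by (auto simp: E.K.affine_space_def)
    note rj = realization_at_jet[of F K \<delta> \<sigma> m _ z, OF cF E.K.differential_field_axioms E.hom real zc]
    show "E.K.mpoly_eval p (\<lambda>(i, r). (\<delta> ^^ r) (?a ! i)) = \<zero>\<^bsub>K\<^esub>" if pX: "p \<in> (\<lambda>p. \<sigma> \<circ> p) ` ?r ` EQ" for p
    proof -
      obtain g where g: "g \<in> EQ" "p = \<sigma> \<circ> ?r g" using pX by blast
      show ?thesis unfolding g(2) using rj[of g] eqK[OF g(1)] g(1) by simp
    qed
    show "E.K.mpoly_eval p (\<lambda>(i, r). (\<delta> ^^ r) (?a ! i)) \<noteq> \<zero>\<^bsub>K\<^esub>" if pX: "p \<in> (\<lambda>p. \<sigma> \<circ> p) ` ?r ` NE" for p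
    proof -
      obtain g where g: "g \<in> NE" "p = \<sigma> \<circ> ?r g" using pX by blast
      show ?thesis unfolding g(2) using rj[of g] neK[OF g(1)] g(1) by simp
    qed
  qed
  then obtain a where a: "E.F.diff_solution m (?r ` EQ) (?r ` NE) a"
    using dc ext fin sub unfolding differentially_closed_def by (metis (no_types, lifting) finite_imageI)
  define w where "w = E.F.ext_pt m a"
  have aA: "a \<in> E.F.affine_space m" using a by (simp add: E.F.diff_solution_def)
  have wc: "w j \<in> carrier F" for j using E.F.ext_pt_points[OF aA] by (simp add: w_def E.F.points_def)
  have wa: "map w [0..<m] = a" using E.F.map_ext_pt[OF aA] by (simp add: w_def)
  have id: "id \<in> ring_hom F F" by (rule ring_hom_memI) auto
  have rj: "E.F.mpoly_eval (?r g) (\<lambda>(i, r). (D ^^ r) (a ! i)) = g F id (?jet D w)" if "g \<in> EQ \<union> NE" for g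
    using realization_at_jet[of F F D id m g w, OF cF E.F.differential_field_axioms id real[OF that] wc] by (simp add: wa id_comp)
  have eqF: "g F id (?jet D w) = \<zero>\<^bsub>F\<^esub>" if "g \<in> EQ" for g
    using a rj[of g] that by (auto simp: E.F.diff_solution_def)
  have neF: "g F id (?jet D w) \<noteq> \<zero>\<^bsub>F\<^esub>" if "g \<in> NE" for g
    using a rj[of g] that by (auto simp: E.F.diff_solution_def)
  have dwc: "D (w j) \<in> carrier F" for j using wc E.F.D_closed by blast
  have "j_solution F D n w"
    unfolding j_solution_def
  proof (intro conjI allI impI)
    show "w j \<in> carrier F" for j by (rule wc)
    fix i assume i: "i < n"
    have "gN 2 i \<in> NE" "gN 1 i \<in> NE" "gM i \<in> NE" using i by (force simp: NE_def)+
    from this[THEN neF] show n: "w (2 * n + i) \<noteq> \<zero>\<^bsub>F\<^esub>" "w (n + i) \<noteq> \<zero>\<^bsub>F\<^esub>" "w (n + i) \<noteq> [(1728::nat)] \<cdot>\<^bsub>F\<^esub> \<one>\<^bsub>F\<^esub>"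
      using wc by (auto simp: gN_def gM_def)
    have "gJ i \<in> EQ" using i by (simp add: EQ_def)
    from eqF[OF this] show "E.F.Psi (w (n + i)) (w (2 * n + i)) (w (3 * n + i)) (w (4 * n + i)) = \<zero>\<^bsub>F\<^esub>"
      using E.F.Psi_eq_zero_iff[OF wc wc wc wc n chF] by (simp add: gJ_def)
    have "gD 1 2 i \<in> EQ" "gD 2 3 i \<in> EQ" "gD 3 4 i \<in> EQ" using i by (force simp: EQ_def)+
    from this[THEN eqF] show "D (w (n + i)) = w (2 * n + i) \<otimes>\<^bsub>F\<^esub> D (w i)"
      "D (w (2 * n + i)) = w (3 * n + i) \<otimes>\<^bsub>F\<^esub> D (w i)" "D (w (3 * n + i)) = w (4 * n + i) \<otimes>\<^bsub>F\<^esub> D (w i)"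
      using wc dwc by (simp_all add: gD_def)
  qed
  moreover have "E.F.mpoly_eval (id \<circ> P) w = \<zero>\<^bsub>F\<^esub>" if "P \<in> S" for P
  proof -
    have "gS P \<in> EQ" using that by (simp add: EQ_def)
    from eqF[OF this] show ?thesis by (simp add: gS_def id_comp)
  qed
  ultimately show ?thesis by blast
qed

theorem theorem1p1:
  fixes F :: "'a ring" and D :: "'a \<Rightarrow> 'a"
    and Falg :: "'c ring" and \<iota> :: "'a \<Rightarrow> 'c"
    and n :: nat and S :: "(nat multiset \<Rightarrow> 'a) set"
  assumes "differential_field F D"
    and "\<iota> \<in> ring_hom F Falg" and "algebraic_closure Falg (\<iota> ` carrier F)"
    and "n \<ge> 1"
    and "finite S" and "S \<subseteq> ring.indexed_pset F {..<2 * n} (carrier F)"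
    and "ring.j_broad Falg n (variety_points Falg \<iota> (2 * n) S)"
    and "\<And>i. i < n \<Longrightarrow> \<exists>p \<in> variety_points Falg \<iota> (2 * n) S.
           p ! (n + i) \<noteq> \<zero>\<^bsub>Falg\<^esub> \<and> p ! (n + i) \<noteq> [(1728::nat)] \<cdot>\<^bsub>Falg\<^esub> \<one>\<^bsub>Falg\<^esub>"
  shows "(\<exists>(K :: 'a ring) \<delta> \<sigma>. differential_field_extension F D K \<delta> \<sigma> \<and>
            (\<exists>p \<in> variety_points K \<sigma> (2 * n) S. differential_field.E_j_point K \<delta> n p)) \<and>
         (differentially_closed F D \<longrightarrow>
            (\<exists>p \<in> variety_points F id (2 * n) S. differential_field.E_j_point F D n p))"
proof -
  interpret F: differential_field F D by (rule assms(1))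
  have Falg: "field Falg"
    using assms(3) algebraic_closure.axioms(1) algebraically_closed.axioms(1) by blast
  obtain L :: "((nat \<Rightarrow> 'c) \<Rightarrow> 'c) set ring" and \<delta>L \<sigma>L zL where
    L: "differential_field_extension F D L \<delta>L \<sigma>L" "j_solution L \<delta>L n zL"
       "\<forall>P\<in>S. ring.mpoly_eval L (\<sigma>L \<circ> P) zL = \<zero>\<^bsub>L\<^esub>"
    using generic_j_solution[OF assms(1) Falg assms(2,6,7,8)] by blast
  have zLc: "zL j \<in> carrier L" for j using L(2) by (simp add: j_solution_def)
  obtain K :: "'a ring" and \<delta> \<sigma> h z where
    K: "differential_field_extension F D K \<delta> \<sigma>" "differential_field_extension K \<delta> L \<delta>L h"
       "\<forall>a\<in>carrier F. h (\<sigma> a) = \<sigma>L a" "\<And>j. z j \<in> carrier K" "\<And>j. h (z j) = zL j"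
    using differential_subextension_on_base_type[of F D L \<delta>L \<sigma>L zL, OF L(1) zLc] by blast
  interpret FK: differential_field_extension F D K \<delta> \<sigma> by (rule K(1))
  interpret KL: differential_field_extension K \<delta> L \<delta>L h by (rule K(2))
  have sol: "j_solution K \<delta> n z"
    by (rule j_solution_reflect[OF K(2,4)]) (simp add: K(5) L(2))
  have van: "ring.mpoly_eval K (\<sigma> \<circ> P) z = \<zero>\<^bsub>K\<^esub>" if P: "P \<in> S" for P
  proof -
    have PF: "P \<in> F.indexed_pset {..<2 * n} (carrier F)" using P assms(6) by blast
    have PK: "\<sigma> \<circ> P \<in> FK.K.indexed_pset {..<2 * n} (carrier K)"
      by (rule ring_hom_indexed_pset[OF F.ring_axioms FK.K.ring_axioms FK.hom PF])
    have "h \<circ> (\<sigma> \<circ> P) = \<sigma>L \<circ> P"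
      using K(3) F.indexed_pset_in_carrier[OF subset_refl PF] by (auto simp: F.carrier_coeff_def)
    then have eq: "h (FK.K.mpoly_eval (\<sigma> \<circ> P) z) = h \<zero>\<^bsub>K\<^esub>"
      using ring_hom_mpoly_eval[of K L h _ _ z, OF FK.K.is_cring KL.K.is_cring KL.hom PK K(4)] K(5) L(3) P
        ring_hom_zero[OF KL.hom FK.K.ring_axioms KL.K.ring_axioms] by simp
    show ?thesis
      by (rule field_hom_inj[OF FK.K.field_axioms KL.K.field_axioms KL.hom _ FK.K.zero_closed eq])
        (rule FK.K.mpoly_eval_closed[of _ _ z, OF PK K(4)])
  qed
  have "\<exists>p\<in>variety_points K \<sigma> (2 * n) S. FK.K.E_j_point n p"
    by (rule j_solution_E_j_point[OF FK.K.differential_field_axioms sol FK.hom F.ring_axioms assms(6) van])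
  moreover have "\<exists>p\<in>variety_points F id (2 * n) S. F.E_j_point n p" if dc: "differentially_closed F D"
  proof -
    obtain w where w: "j_solution F D n w" "\<And>P. P \<in> S \<Longrightarrow> F.mpoly_eval (id \<circ> P) w = \<zero>\<^bsub>F\<^esub>"
      using differentially_closed_j_solution[OF dc K(1) assms(5,6) sol van] by blast
    have "id \<in> ring_hom F F" by (rule ring_hom_memI) auto
    then show ?thesis
      using j_solution_E_j_point[OF assms(1) w(1) _ F.ring_axioms assms(6) w(2)] by blast
  qed
  ultimately show ?thesis using K(1) by blast
qed

end
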